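(* Let $\Theta_k(n)=\frac{\Delta_k(n-1)\Delta_k(n+1)}{\Delta_k(n)^2}$. Then $\Theta_1(n)<\Theta_1(n+1)$ for all integers $n\ge 5$, and $\Theta_2(n)<\Theta_2(n+1)$ for all integers $n\ge 7$.
   Context: For an integer $k\ge 0$, $\Delta_k(n)$ denotes the number of broken $k$-diamond partitions of $n$ (Andrews–Paule), defined equivalently by the generating function \[ \sum_{n\ge 0}\Delta_k(n)q^n=\prod_{n\ge1}\frac{(1-q^{2n})(1-q^{(2k+1)n})}{(1-q^n)^3(1-q^{(4k+2)n})}. \] *)

theory Defs
  imports "HOL-Analysis.Analysis"
begin

definition broken_diamond_factor :: "nat \<Rightarrow> nat \<Rightarrow> real fps" where
  "broken_diamond_factor k n =
     ((1 - fps_X ^ (2 * n)) * (1 - fps_X ^ ((2 * k + 1) * n))) /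
     ((1 - fps_X ^ n) ^ 3 * (1 - fps_X ^ ((4 * k + 2) * n)))"

(* The product is taken in the ring of formal power series with its X-adic
   topology; the infinite product of the library starts at index 0. *)
definition broken_diamond_gf :: "nat \<Rightarrow> real fps" where
  "broken_diamond_gf k = (\<Prod>i. broken_diamond_factor k (i + 1))"

(* The number of broken k-diamond partitions of n, as a real number. *)
definition Delta :: "nat \<Rightarrow> nat \<Rightarrow> real" where
  "Delta k n = fps_nth (broken_diamond_gf k) n"

(* Meaningful only for n \<ge> 1, since subtraction on nat truncates. *)
definition Theta :: "nat \<Rightarrow> nat \<Rightarrow> real" where
  "Theta k n = Delta k (n - 1) * Delta k (n + 1) / (Delta k n)\<^sup>2"

(* The remaining lemmas show that the infinite product converges, so that
   broken_diamond_gf is not an artefact of the totality of prodinf. *)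

lemma dvd_mult_minus_one:
  fixes a b c :: "'a :: comm_ring_1"
  assumes "c dvd a - 1" "c dvd b - 1"
  shows "c dvd a * b - 1"
proof -
  have "a * b - 1 = (a - 1) * b + (b - 1)" by (simp add: algebra_simps)
  with assms show ?thesis by (simp only:) (intro dvd_add dvd_mult2)
qed

lemma fps_X_power_dvd_one_minus:
  "m \<ge> n \<Longrightarrow> fps_X ^ n dvd (1 - fps_X ^ m :: real fps) - 1"
  by (simp add: le_imp_power_dvd)

lemma fps_X_power_dvd_factor:
  "fps_X ^ n dvd broken_diamond_factor k n - 1"
proof (cases "n = 0")
  case False
  define N D :: "real fps" where
    "N = (1 - fps_X ^ (2 * n)) * (1 - fps_X ^ ((2 * k + 1) * n))" and
    "D = (1 - fps_X ^ n) ^ 3 * (1 - fps_X ^ ((4 * k + 2) * n))"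
  have N: "fps_X ^ n dvd N - 1"
    unfolding N_def by (intro dvd_mult_minus_one fps_X_power_dvd_one_minus) auto
  have D: "fps_X ^ n dvd D - 1"
    unfolding D_def power3_eq_cube
    by (intro dvd_mult_minus_one fps_X_power_dvd_one_minus) auto
  have D0: "fps_nth D 0 \<noteq> 0"
    using False by (simp add: D_def fps_nth_power_0 power_0_left)
  have "broken_diamond_factor k n - 1 = N * inverse D - D * inverse D"
    using D0 unfolding broken_diamond_factor_def N_def[symmetric] D_def[symmetric]
    by (simp add: fps_divide_unit inverse_mult_eq_1')
  also have "\<dots> = ((N - 1) - (D - 1)) * inverse D"
    by (simp add: algebra_simps)
  finally have *: "broken_diamond_factor k n - 1 = ((N - 1) - (D - 1)) * inverse D" .
  show ?thesis
    unfolding * by (intro dvd_mult2 dvd_diff N D)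
qed auto

theorem broken_diamond_has_prod:
  "(\<lambda>i. broken_diamond_factor k (i + 1)) has_prod broken_diamond_gf k"
proof -
  define P where "P n = (\<Prod>i\<le>n. broken_diamond_factor k (i + 1))" for n
  have step: "fps_nth (P (Suc n)) m = fps_nth (P n) m" if "m \<le> n" for m n
  proof -
    have "P (Suc n) - P n = P n * (broken_diamond_factor k (Suc (Suc n)) - 1)"
      by (simp add: P_def algebra_simps)
    then have "fps_X ^ Suc (Suc n) dvd P (Suc n) - P n"
      by (simp only:) (intro dvd_mult fps_X_power_dvd_factor)
    then obtain g where "P (Suc n) - P n = fps_X ^ Suc (Suc n) * g" by (elim dvdE)
    then have "fps_nth (P (Suc n) - P n) m = 0"
      using that by (simp add: fps_X_power_mult_nth del: power_Suc)
    then show ?thesis by simp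
  qed
  have stable: "fps_nth (P n) m = fps_nth (P m) m" if "m \<le> n" for m n
    using that by (induction n rule: dec_induct) (auto simp: step)
  define L where "L = Abs_fps (\<lambda>m. fps_nth (P m) m)"
  have "P \<longlonglongrightarrow> L"
  proof (rule tendsto_fpsI)
    show "\<forall>\<^sub>F n in sequentially. fps_nth (P n) m = fps_nth L m" for m
      unfolding L_def fps_nth_Abs_fps by (rule eventually_sequentiallyI) (rule stable)
  qed
  moreover have "fps_nth L 0 = 1"
  proof -
    have "fps_nth (P 0) 0 = fps_nth (broken_diamond_factor k 1) 0"
      by (simp add: P_def)
    moreover obtain g where "broken_diamond_factor k 1 - 1 = fps_X ^ 1 * g"
      using fps_X_power_dvd_factor[of 1 k] by (elim dvdE)
    then have "fps_nth (broken_diamond_factor k 1 - 1) 0 = 0" by simp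
    ultimately show ?thesis by (simp add: L_def)
  qed
  then have "L \<noteq> 0" by auto
  ultimately have *: "(\<lambda>i. broken_diamond_factor k (i + 1)) has_prod L"
    by (simp add: has_prod_def raw_has_prod_def P_def[abs_def])
  show ?thesis
    unfolding broken_diamond_gf_def has_prod_unique[OF *, symmetric] by (rule *)
qed

end

theory Submission
  imports Defs "HOL-Complex_Analysis.Complex_Analysis" "HOL-Real_Asymp.Real_Asymp"
begin

text \<open>
  The generating function F(q) of Delta k is an eta quotient of weight -1. The modular
  transformation of the Euler product follows from Eisenstein's conditionally convergent double
  series, whose two orders of summation differ by 1/(2z). With q = exp(-z) it gives
  F(q) = z/(2 pi) exp(A/z - (k+1)z/12) times a factor exponentially close to 1, and the circle method
  shows that Delta k n equals A^2/(2 pi) g(A nu) with nu = n - (k+1)/12 and g(t) = I_2(2 sqrt t)/t, up to a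
  relative error of 11 T^2 exp(-0.67 T), where T = sqrt(A nu).

  That Theta k is increasing means that the third differences of ln (Delta k n) are positive. For g, the
  reciprocal v of the logarithmic derivative solves a Riccati equation, which forces v to be concave;
  this bounds the third derivative of ln g below by a quantity of order t^(-5/2), which dominates the
  error once n is at least 484. The finitely many smaller n are settled by computing the coefficients
  with Euler's pentagonal number theorem.
\<close>

section \<open>Partial fractions of the hyperbolic cotangent\<close>

text \<open>The quantity to be controlled is a third difference of ln (Delta k n), of size n^(-5/2)
  only, so every error must be explicit; an error that is exponentially small in sqrt n wins from a
  moderate n on. On the major arc the correction factor is tamed by \<open>A_le\<close>, which
  confines the argument to k = 1 and k = 2; what is left there is exp T, against a main term of size
  exp (2 T). On the minor arcs no other cusp is visited: log F is compared term by term with its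
  value at |q|, and the saving 0.67 T is essentially the size 3 / x of 3 q / (1 - q) at real q,
  where x = A / T. The condition n >= 484 guarantees T >= 43, where twelve times the relative error
  already lies below the third difference. For smaller n the ratios of consecutive coefficients are
  rounded to multiples of 2^(-24), so that their log-convexity is tested on short integers although
  the coefficients themselves are long.\<close>

lemma Digamma_reflection_complex:
  fixes z :: complex
  assumes "z \<notin> \<int>"
  shows "Digamma (1 - z) - Digamma z = of_real pi * cot (of_real pi * z)"
proof -
  have nz: "z \<notin> \<int>\<^sub>\<le>\<^sub>0" "1 - z \<notin> \<int>\<^sub>\<le>\<^sub>0"
    using assms by (auto dest: nonpos_Ints_Int Ints_diff[of 1])
  \<comment> \<open>Logarithmic differentiation of the reflection formula, carried out for the
    entire function \<open>rGamma\<close>: both sides of the formula are differentiated and the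
    derivatives compared.\<close>
  have "((\<lambda>z. rGamma z * rGamma (1 - z)) has_field_derivative
      (- rGamma z * Digamma z * rGamma (1 - z) + rGamma z * rGamma (1 - z) * Digamma (1 - z))) (at z)"
    using nz by (auto intro!: derivative_eq_intros)
  moreover have "(\<lambda>z. rGamma z * rGamma (1 - z)) = (\<lambda>z::complex. sin (of_real pi * z) / of_real pi)"
    by (auto simp: rGamma_reflection_complex)
  ultimately have "((\<lambda>z::complex. sin (of_real pi * z) / of_real pi) has_field_derivative
      (- rGamma z * Digamma z * rGamma (1 - z) + rGamma z * rGamma (1 - z) * Digamma (1 - z))) (at z)"
    by simp
  moreover have "((\<lambda>z::complex. sin (of_real pi * z) / of_real pi) has_field_derivative
      cos (of_real pi * z)) (at z)"
    by (auto intro!: derivative_eq_intros)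
  ultimately have "(rGamma z * rGamma (1 - z)) * (Digamma (1 - z) - Digamma z) = cos (of_real pi * z)"
    by (metis (no_types, lifting) DERIV_unique add_uminus_conv_diff mult.assoc mult.commute
        mult_minus_left ring_class.ring_distribs(1) right_diff_distrib uminus_add_conv_diff)
  then have *: "sin (of_real pi * z) / of_real pi * (Digamma (1 - z) - Digamma z) = cos (of_real pi * z)"
    by (simp add: rGamma_reflection_complex)
  have "sin (of_real pi * z) \<noteq> 0"
  proof
    assume "sin (of_real pi * z) = 0"
    then obtain n :: int where "of_real pi * z = complex_of_real (real_of_int n * pi)"
      by (auto simp: sin_eq_0)
    then have "z = of_int n" by (auto simp: mult.commute)
    with assms show False by simp
  qed
  with * show ?thesis
    by (simp add: cot_def field_simps)
qed

text \<open>The Digamma series at 1 + z and 1 - z, with z = i w / (2 pi), differ termwise by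
  quantities whose imaginary parts are the terms wanted. Reflection turns the sum into a cotangent
  at an imaginary point, that is, into (exp w + 1) / (exp w - 1).\<close>

lemma exp_minus_1_expansion:
  fixes w :: real
  assumes "w > 0"
  shows "(\<lambda>k. 2 * w / (w\<^sup>2 + (2 * pi * real (Suc k))\<^sup>2)) sums (1 / (exp w - 1) + 1 / 2 - 1 / w)"
proof -
  define y where "y = w / (2 * pi)"
  define z where "z = \<i> * complex_of_real y"
  have y: "y > 0" using assms by (simp add: y_def)
  have w: "w = 2 * pi * y" by (simp add: y_def)
  have zInt: "z \<notin> \<int>"
    using y by (auto simp: z_def Ints_def complex_eq_iff)
  have z0: "z \<noteq> 0" using y by (auto simp: z_def)
  have z1: "1 - z \<noteq> 0" "1 + z \<noteq> 0" using zInt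
    by (auto simp: z_def complex_eq_iff)
  have s1: "(\<lambda>n. inverse (of_nat (Suc n)) - inverse ((1 + z) + of_nat n)) sums (Digamma (1 + z) + euler_mascheroni)"
    using summable_Digamma[OF z1(2)] by (simp add: Digamma_def sums_iff)
  have s2: "(\<lambda>n. inverse (of_nat (Suc n)) - inverse ((1 - z) + of_nat n)) sums (Digamma (1 - z) + euler_mascheroni)"
    using summable_Digamma[OF z1(1)] by (simp add: Digamma_def sums_iff)
  have s3: "(\<lambda>n. inverse ((1 - z) + of_nat n) - inverse ((1 + z) + of_nat n)) sums (Digamma (1 + z) - Digamma (1 - z))"
    using sums_diff[OF s1 s2] by simp
  have "Digamma (1 + z) = Digamma z + 1 / z"
    using Digamma_plus1[OF z0] by (simp add: add.commute)
  then have D: "Digamma (1 + z) - Digamma (1 - z) = 1 / z - of_real pi * cot (of_real pi * z)"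
    using Digamma_reflection_complex[OF zInt] by (simp add: algebra_simps)
  have cot: "cot (of_real pi * z) = - \<i> * of_real ((exp w + 1) / (exp w - 1))"
  proof -
    have *: "\<i> * (of_real pi * z) = - of_real (w / 2)" "-(\<i> * (of_real pi * z)) = of_real (w / 2)"
      by (auto simp: z_def w complex_eq_iff)
    have e: "exp (w / 2) ^ 2 = exp w" by (simp add: exp_double[symmetric])
    have g1: "exp (w / 2) > 1" using assms by simp
    then have g2: "exp (w/2) ^ 2 > 1" by (simp add: one_less_power)
    have gen: "((a + b) / 2) / ((a - b) / (2 * \<i>)) = \<i> * (a + b) / (a - b)" for a b :: complex
      by (simp add: divide_simps)
    have "cot (of_real pi * z) = \<i> * (of_real (exp (-(w/2))) + of_real (exp (w/2))) / (of_real (exp (-(w/2))) - of_real (exp (w/2)))"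
      unfolding cot_def cos_exp_eq sin_exp_eq * exp_of_real of_real_minus[symmetric] minus_minus
      by (rule gen)
    also have "\<dots> = \<i> * of_real ((exp (-(w/2)) + exp (w/2)) / (exp (-(w/2)) - exp (w/2)))"
      by simp
    also have "(exp (-(w/2)) + exp (w/2)) / (exp (-(w/2)) - exp (w/2)) = - ((exp w + 1) / (exp w - 1))"
      unfolding e[symmetric] exp_minus using g1 g2 by (simp add: divide_simps power2_eq_square) (simp add: algebra_simps)
    finally show ?thesis by simp
  qed
  have summand: "Im (inverse ((1 - z) + of_nat n) - inverse ((1 + z) + of_nat n)) = 2 * y / (y\<^sup>2 + (real (Suc n))\<^sup>2)" for n
  proof -
    have "(1 - z) + of_nat n = Complex (real (Suc n)) (- y)" "(1 + z) + of_nat n = Complex (real (Suc n)) y"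
      by (auto simp: z_def complex_eq_iff)
    then show ?thesis by (simp add: add.commute add_divide_distrib[symmetric])
  qed
  have "(\<lambda>n. 2 * y / (y\<^sup>2 + (real (Suc n))\<^sup>2)) sums (Im (1 / z - of_real pi * cot (of_real pi * z)))"
    using sums_Im[OF s3] unfolding summand D .
  also have "Im (1 / z - of_real pi * cot (of_real pi * z)) = pi * ((exp w + 1) / (exp w - 1)) - 1 / y"
    using y unfolding cot by (simp add: z_def Im_divide power2_eq_square)
  finally have "(\<lambda>n. 1 / (2 * pi) * (2 * y / (y\<^sup>2 + (real (Suc n))\<^sup>2))) sums (1 / (2 * pi) * (pi * ((exp w + 1) / (exp w - 1)) - 1 / y))"
    by (rule sums_mult)
  moreover have "1 / (2 * pi) * (2 * y / (y\<^sup>2 + (real (Suc n))\<^sup>2)) = 2 * w / (w\<^sup>2 + (2 * pi * real (Suc n))\<^sup>2)" for n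
  proof -
    have "w\<^sup>2 + (2 * pi * real (Suc n))\<^sup>2 = (2 * pi)\<^sup>2 * (y\<^sup>2 + (real (Suc n))\<^sup>2)"
      unfolding w power_mult_distrib by (simp add: algebra_simps)
    then show ?thesis unfolding w by (simp add: power2_eq_square)
  qed
  moreover have "1 / (2 * pi) * (pi * ((exp w + 1) / (exp w - 1)) - 1 / y) = 1 / (exp w - 1) + 1 / 2 - 1 / w"
  proof -
    have "exp w > 1" using assms by simp
    then show ?thesis using y by (simp add: w divide_simps) (simp add: algebra_simps)
  qed
  ultimately show ?thesis by simp
qed

text \<open>Minus the termwise derivative of \<open>exp_minus_1_expansion\<close>. The derivatives
  are dominated by 2 / (k + 1)^2 uniformly in w, which justifies the exchange.\<close>

lemma csch_expansion:
  fixes w :: real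
  assumes w: "w > 0"
  shows "(\<lambda>k. 2 * (w\<^sup>2 - (2 * pi * real (Suc k))\<^sup>2) / (w\<^sup>2 + (2 * pi * real (Suc k))\<^sup>2)\<^sup>2) sums
          (exp w / (exp w - 1)\<^sup>2 - 1 / w\<^sup>2)"
proof -
  define f where "f k w = 2 * w / (w\<^sup>2 + (2 * pi * real (Suc k))\<^sup>2)" for k and w :: real
  define f' where "f' k w = - 2 * (w\<^sup>2 - (2 * pi * real (Suc k))\<^sup>2) / (w\<^sup>2 + (2 * pi * real (Suc k))\<^sup>2)\<^sup>2" for k and w :: real
  have bnd: "norm (f' k v) \<le> 2 / (real (Suc k))\<^sup>2" for k v
  proof -
    define c where "c = (2 * pi * real (Suc k))\<^sup>2"
    have c: "c \<ge> (real (Suc k))\<^sup>2" unfolding c_def using pi_gt3 by (intro power_mono) auto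
    moreover have "(real (Suc k))\<^sup>2 > 0" by simp
    ultimately have c0: "c > 0" by linarith
    have "\<bar>v\<^sup>2 - c\<bar> \<le> v\<^sup>2 + c" using c0 by (simp add: abs_le_iff)
    then have "\<bar>v\<^sup>2 - c\<bar> / (v\<^sup>2 + c)\<^sup>2 \<le> (v\<^sup>2 + c) / (v\<^sup>2 + c)\<^sup>2"
      by (intro divide_right_mono) auto
    also have "\<dots> = 1 / (v\<^sup>2 + c)" by (simp add: power2_eq_square)
    also have "\<dots> \<le> 1 / (real (Suc k))\<^sup>2" using c c0 by (intro divide_left_mono) (auto intro!: add_increasing mult_pos_pos add_nonneg_pos)
    finally have "2 * (\<bar>v\<^sup>2 - c\<bar> / (v\<^sup>2 + c)\<^sup>2) \<le> 2 * (1 / (real (Suc k))\<^sup>2)" by simp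
    moreover have "norm (f' k v) = 2 * (\<bar>v\<^sup>2 - c\<bar> / (v\<^sup>2 + c)\<^sup>2)"
      unfolding f'_def c_def[symmetric] real_norm_def by (simp only: abs_mult abs_divide abs_power2 abs_minus_cancel abs_numeral times_divide_eq_right)
    ultimately show ?thesis by simp
  qed
  have sm: "summable (\<lambda>k. 2 / (real (Suc k))\<^sup>2)"
    using inverse_power_summable[of 2, where 'a = real] 
    by (subst summable_Suc_iff) (auto simp: divide_inverse intro!: summable_mult)
  have unif: "uniformly_convergent_on {0<..} (\<lambda>n v. \<Sum>k<n. f' k v)"
    by (rule Weierstrass_m_test'[OF bnd sm])
  have der: "(f k has_field_derivative f' k v) (at v within {0<..})" if "v \<in> {0<..}" for k v
  proof -
    have "v\<^sup>2 + (2 * pi * real (Suc k))\<^sup>2 > 0" using that by (simp add: add_pos_nonneg)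
    then show ?thesis unfolding f_def f'_def
      by (auto intro!: derivative_eq_intros simp: power2_eq_square divide_simps) (simp add: algebra_simps)?
  qed
  have sums: "(\<lambda>k. f k v) sums (1 / (exp v - 1) + 1 / 2 - 1 / v)" if "v > 0" for v
    using exp_minus_1_expansion[OF that] by (simp add: f_def)
  note D = has_field_derivative_series'[OF _ der unif _ sums_summable[OF sums[OF w]], of w]
  have "((\<lambda>v. \<Sum>k. f k v) has_field_derivative (\<Sum>k. f' k w)) (at w)"
    by (rule D(2)) (use w in \<open>auto simp: interior_open\<close>)
  moreover have "((\<lambda>v. \<Sum>k. f k v) has_field_derivative (- exp w / (exp w - 1)\<^sup>2 + 1 / w\<^sup>2)) (at w)"
  proof (rule DERIV_cong_ev[THEN iffD2, OF refl _ refl])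
    show "\<forall>\<^sub>F v in nhds w. (\<Sum>k. f k v) = 1 / (exp v - 1) + 1 / 2 - 1 / v"
      using eventually_nhds_in_open[of "{0<..}" w] w by (auto elim!: eventually_mono simp: sums_iff dest!: sums)
    show "((\<lambda>v. 1 / (exp v - 1) + 1 / 2 - 1 / v) has_field_derivative (- exp w / (exp w - 1)\<^sup>2 + 1 / w\<^sup>2)) (at w)"
      using w by (auto intro!: derivative_eq_intros simp: power2_eq_square)
  qed
  ultimately have "(\<Sum>k. f' k w) = - exp w / (exp w - 1)\<^sup>2 + 1 / w\<^sup>2"
    by (rule DERIV_unique)
  moreover have "summable (\<lambda>k. f' k w)" by (rule summable_comparison_test'[OF sm bnd])
  ultimately have "(\<lambda>k. f' k w) sums (- exp w / (exp w - 1)\<^sup>2 + 1 / w\<^sup>2)" by (simp add: sums_iff)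
  from sums_minus[OF this] have "(\<lambda>k. - f' k w) sums (exp w / (exp w - 1)\<^sup>2 - 1 / w\<^sup>2)" by simp
  then show ?thesis unfolding f'_def by (simp only: mult_minus_left minus_divide_left minus_minus)
qed

section \<open>Interchanging the two summations of the weight two Eisenstein series\<close>

text \<open>This is 2 Re (c^(-2)) for c = m x + i h k.\<close>

definition eis_term :: "real \<Rightarrow> real \<Rightarrow> nat \<Rightarrow> nat \<Rightarrow> real" where
  "eis_term x h m k = 2 * ((real m * x)\<^sup>2 - (h * real k)\<^sup>2) / ((real m * x)\<^sup>2 + (h * real k)\<^sup>2)\<^sup>2"

text \<open>This is - (2 / h) Im (1 / c) for c = m x + i h k. Its increment in k is 2 Re (1 / (c (c
  + i h))), a telescoping substitute for \<open>eis_term\<close>.\<close>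

definition eis_tele :: "real \<Rightarrow> real \<Rightarrow> nat \<Rightarrow> nat \<Rightarrow> real" where
  "eis_tele x h m k = 2 * real k / ((real m * x)\<^sup>2 + (h * real k)\<^sup>2)"

text \<open>1 / c^2 and 1 / (c c') with c' = c + i h differ by i h / (c^2 c'), of order |c|^(-3).
  The inequality |c|^2 >= 2 x h m k between the means then separates the variables, and the exponent
  3/2 makes both sums converge.\<close>

lemma eis_term_diff_bound:
  assumes x: "x > 0" and h: "h > 0" and m: "m > 0" and k: "k > 0"
  shows "\<bar>eis_term x h m k - (eis_tele x h m (Suc k) - eis_tele x h m k)\<bar>
    \<le> 2 * h / (2 * x * h) powr (3/2) * (1 / (real m) powr (3/2)) * (1 / (real k) powr (3/2))"
proof -
  define X where "X = real m * x"
  have X: "X > 0" using x m by (simp add: X_def)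
  define c where "c = Complex X (h * real k)"
  define c' where "c' = Complex X (h * real (Suc k))"
  have c0: "c \<noteq> 0" "c' \<noteq> 0" using X by (auto simp: c_def c'_def complex_eq_iff)
  have ca: "(norm c)\<^sup>2 = X\<^sup>2 + (h * real k)\<^sup>2" "(norm c')\<^sup>2 = X\<^sup>2 + (h * real (Suc k))\<^sup>2"
    by (auto simp: c_def c'_def cmod_power2)
  have inv: "1 / z = Complex (Re z / (norm z)\<^sup>2) (- Im z / (norm z)\<^sup>2)" for z :: complex
    by (simp add: complex_eq_iff Re_divide Im_divide cmod_power2)
  have 1: "eis_term x h m k = 2 * Re (1 / c ^ 2)"
  proof -
    have "Re ((1 / c)\<^sup>2) = (X\<^sup>2 - (h * real k)\<^sup>2) / (X\<^sup>2 + (h * real k)\<^sup>2)\<^sup>2"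
      unfolding inv ca by (simp add: power2_eq_square c_def diff_divide_distrib)
    then show ?thesis by (simp add: eis_term_def X_def power_divide)
  qed
  have 2: "eis_tele x h m (Suc k) - eis_tele x h m k = 2 * Re (1 / (c * c'))"
  proof -
    have dd: "c' - c = \<i> * of_real h" by (simp add: c_def c'_def complex_eq_iff algebra_simps)
    have Im: "Im (\<i> * of_real h * z) = h * Re z" for z by simp
    have "1 / c - 1 / c' = (c' - c) / (c * c')" using c0 by (simp add: field_simps)
    then have "\<i> * of_real h * (1 / (c * c')) = 1 / c - 1 / c'" unfolding dd by simp
    then have "Im (\<i> * of_real h * (1 / (c * c'))) = Im (1 / c - 1 / c')" by (rule arg_cong)
    then have "h * Re (1 / (c * c')) = - (h * real k) / (X\<^sup>2 + (h * real k)\<^sup>2) + h * real (Suc k) / (X\<^sup>2 + (h * real (Suc k))\<^sup>2)"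
      unfolding Im by (simp add: inv ca, simp add: c_def c'_def)
    then have "h * Re (1 / (c * c')) = h * (real (Suc k) / (X\<^sup>2 + (h * real (Suc k))\<^sup>2) - real k / (X\<^sup>2 + (h * real k)\<^sup>2))"
      by (simp only: right_diff_distrib) simp
    with h have "Re (1 / (c * c')) = real (Suc k) / (X\<^sup>2 + (h * real (Suc k))\<^sup>2) - real k / (X\<^sup>2 + (h * real k)\<^sup>2)"
      by simp
    then show ?thesis by (simp add: eis_tele_def X_def)
  qed
  have amgm: "2 * x * h * (real m * real k) \<le> (norm c)\<^sup>2" 
    using sum_squares_bound[of X "h * real k"] by (simp add: ca X_def algebra_simps)
  have amgm': "2 * x * h * (real m * real k) \<le> (norm c')\<^sup>2"
  proof -
    have "2 * x * h * (real m * real k) \<le> 2 * x * h * (real m * real (Suc k))" using x h by (intro mult_left_mono) auto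
    also have "\<dots> \<le> (norm c')\<^sup>2"
      using sum_squares_bound[of X "h * real (Suc k)"] by (simp add: ca X_def algebra_simps)
    finally show ?thesis .
  qed
  define y where "y = 2 * x * h * (real m * real k)"
  have y: "y > 0" using assms by (simp add: y_def)
  have n1: "norm c \<ge> y powr (1/2)" "norm c' \<ge> y powr (1/2)"
    using amgm amgm' y by (auto simp: powr_half_sqrt y_def real_le_lsqrt)
  have eq: "1 / c\<^sup>2 - 1 / (c * c') = (\<i> * of_real h) / (c * c * c')"
  proof -
    have dd: "c' - c = \<i> * of_real h" by (simp add: c_def c'_def complex_eq_iff algebra_simps)
    show ?thesis unfolding dd[symmetric] using c0 by (simp add: field_simps power2_eq_square)
  qed
  have "\<bar>eis_term x h m k - (eis_tele x h m (Suc k) - eis_tele x h m k)\<bar> = 2 * \<bar>Re (1 / c\<^sup>2 - 1 / (c * c'))\<bar>"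
    unfolding 1 2 by (simp only: minus_complex.sel right_diff_distrib[symmetric] abs_mult abs_numeral)
  also have "\<dots> \<le> 2 * norm (1 / c\<^sup>2 - 1 / (c * c'))" by (intro mult_left_mono abs_Re_le_cmod) simp
  also have "\<dots> = 2 * h / (norm c * norm c * norm c')" unfolding eq using h by (simp add: norm_mult norm_divide)
  also have "\<dots> \<le> 2 * h / (y powr (1/2) * y powr (1/2) * y powr (1/2))"
    using n1 h y by (intro divide_left_mono mult_mono mult_pos_pos) (auto intro!: mult_nonneg_nonneg simp: c0)
  also have "y powr (1/2) * y powr (1/2) * y powr (1/2) = y powr (3/2)"
    by (simp only: powr_add[symmetric]) simp
  also have "y powr (3/2) = (2 * x * h) powr (3/2) * (real m powr (3/2) * real k powr (3/2))"
    unfolding y_def using x h by (simp add: powr_mult)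
  finally show ?thesis by (simp add: mult.assoc)
qed

text \<open>For fixed K the sum over m is an instance of \<open>exp_minus_1_expansion\<close> with w
  = 2 pi h K / x. As K grows only the constant 1/2 of that expansion survives.\<close>

lemma eis_tele_limit:
  assumes x: "x > 0" and h: "h > 0"
  shows "(\<lambda>K. \<Sum>m. eis_tele x h (Suc m) K) \<longlonglongrightarrow> pi / (x * h)"
    and "K > 0 \<Longrightarrow> summable (\<lambda>m. eis_tele x h (Suc m) K)"
proof -
  have *: "(\<lambda>m. eis_tele x h (Suc m) K) sums (2 * pi / (x * h) * (1 / (exp w - 1) + 1/2 - 1 / w))"
    if "K > 0" "w = 2 * pi * h * real K / x" for K w
  proof -
    have w: "w > 0" using that x h by simp
    have "(\<lambda>m. 2 * pi / (x * h) * (2 * w / (w\<^sup>2 + (2 * pi * real (Suc m))\<^sup>2))) sums (2 * pi / (x * h) * (1 / (exp w - 1) + 1/2 - 1 / w))"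
      by (intro sums_mult exp_minus_1_expansion w)
    moreover have "2 * pi / (x * h) * (2 * w / (w\<^sup>2 + (2 * pi * real (Suc m))\<^sup>2)) = eis_tele x h (Suc m) K" for m
    proof -
      define D where "D = (real (Suc m) * x)\<^sup>2 + (h * real K)\<^sup>2"
      have "w\<^sup>2 + (2 * pi * real (Suc m))\<^sup>2 = (2 * pi / x)\<^sup>2 * D"
        using x unfolding that D_def by (simp add: power2_eq_square field_simps)
      moreover have "D > 0" unfolding D_def using x by (intro add_pos_nonneg) auto
      ultimately show ?thesis using x h unfolding eis_tele_def D_def[symmetric]
        by (simp add: that power2_eq_square field_simps)
    qed
    ultimately show ?thesis by simp
  qed
  show "K > 0 \<Longrightarrow> summable (\<lambda>m. eis_tele x h (Suc m) K)" using * by (auto simp: sums_iff)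
  have "eventually (\<lambda>K. (\<Sum>m. eis_tele x h (Suc m) K) = 2 * pi / (x * h) * (1 / (exp (2 * pi * h * real K / x) - 1) + 1/2 - 1 / (2 * pi * h * real K / x))) sequentially"
    using eventually_gt_at_top[of 0] by eventually_elim (use * in \<open>auto simp: sums_iff\<close>)
  moreover have "(\<lambda>K. 2 * pi / (x * h) * (1 / (exp (2 * pi * h * real K / x) - 1) + 1/2 - 1 / (2 * pi * h * real K / x))) \<longlonglongrightarrow> 2 * pi / (x * h) * (0 + 1/2 - 0)"
  proof -
    have b: "filterlim (\<lambda>K. 2 * pi * h * real K / x) at_top sequentially"
      using x h by real_asymp
    have "((\<lambda>w::real. 1 / (exp w - 1)) \<longlongrightarrow> 0) at_top" "((\<lambda>w::real. 1 / w) \<longlongrightarrow> 0) at_top" by real_asymp+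
    from this[THEN filterlim_compose, OF b] show ?thesis
      by (intro tendsto_intros)
  qed
  ultimately show "(\<lambda>K. \<Sum>m. eis_tele x h (Suc m) K) \<longlonglongrightarrow> pi / (x * h)"
    by (subst tendsto_cong) auto
qed

text \<open>
  The tail over k \<ge> K of the inner series splits into a part dominated by an absolutely summable double
  series, which disappears as K grows, and a telescoping part, which contributes the defect pi/(x h).
\<close>
lemma eisenstein_swap:
  fixes \<sigma>1 \<sigma>2 :: "nat \<Rightarrow> real"
  assumes x: "x > 0" and h: "h > 0"
  assumes s1: "\<And>m. (\<lambda>k. eis_term x h (Suc m) (Suc k)) sums \<sigma>1 m" and S1: "\<sigma>1 sums S1"
  assumes s2: "\<And>k. (\<lambda>m. eis_term x h (Suc m) (Suc k)) sums \<sigma>2 k" and S2: "\<sigma>2 sums S2"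
  shows "S2 - S1 = pi / (x * h)"
proof -
  define C where "C = 2 * h / (2 * x * h) powr (3/2)"
  have C: "C \<ge> 0" using x h by (simp add: C_def)
  define z where "z k = 1 / real (Suc k) powr (3/2)" for k
  have z0: "z k \<ge> 0" for k by (simp add: z_def)
  have sz: "summable z" unfolding z_def
    using summable_real_powr_iff[of "-3/2"] by (subst summable_Suc_iff) (simp add: powr_minus_divide)
  define \<delta> where "\<delta> m k = eis_term x h (Suc m) (Suc k) - (eis_tele x h (Suc m) (Suc (Suc k)) - eis_tele x h (Suc m) (Suc k))" for m k
  have \<delta>b: "\<bar>\<delta> m k\<bar> \<le> C * z m * z k" for m k
    unfolding \<delta>_def C_def z_def by (rule eis_term_diff_bound) (use x h in auto)
  have s\<delta>: "summable (\<lambda>k. \<delta> m (k + K))" for m K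
    by (rule summable_comparison_test'[of "\<lambda>k. C * z m * z (k + K)"]) (use \<delta>b sz in \<open>auto intro!: summable_mult summable_ignore_initial_segment\<close>)
  have tele: "(\<lambda>k. eis_tele x h (Suc m) (Suc (Suc (k + K))) - eis_tele x h (Suc m) (Suc (k + K))) sums (0 - eis_tele x h (Suc m) (Suc K))" for m K
  proof -
    have "(\<lambda>k. eis_tele x h (Suc m) (Suc (k + K))) \<longlonglongrightarrow> 0"
      unfolding eis_tele_def using x h by real_asymp
    from telescope_sums[OF this] show ?thesis by simp
  qed
  have tail: "\<sigma>1 m - (\<Sum>k<K. eis_term x h (Suc m) (Suc k)) = (\<Sum>k. \<delta> m (k + K)) - eis_tele x h (Suc m) (Suc K)" for m K
  proof -
    have "(\<lambda>k. \<delta> m (k + K) + (eis_tele x h (Suc m) (Suc (Suc (k + K))) - eis_tele x h (Suc m) (Suc (k + K)))) sums ((\<Sum>k. \<delta> m (k + K)) + (0 - eis_tele x h (Suc m) (Suc K)))"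
      by (intro sums_add tele summable_sums s\<delta>)
    moreover have "(\<lambda>k. \<delta> m (k + K) + (eis_tele x h (Suc m) (Suc (Suc (k + K))) - eis_tele x h (Suc m) (Suc (k + K)))) = (\<lambda>k. eis_term x h (Suc m) (Suc (k + K)))"
      by (auto simp: \<delta>_def)
    moreover have "(\<lambda>k. eis_term x h (Suc m) (Suc (k + K))) sums (\<sigma>1 m - (\<Sum>k<K. eis_term x h (Suc m) (Suc k)))"
      using sums_split_initial_segment[OF s1[of m], of K] by simp
    ultimately show ?thesis using sums_unique2 by fastforce
  qed
  define t where "t K = (\<Sum>k. z (k + K))" for K
  have t0: "t \<longlonglongrightarrow> 0" unfolding t_def using suminf_exist_split2[OF sz] .
  have \<Delta>b: "\<bar>\<Sum>k. \<delta> m (k + K)\<bar> \<le> C * t K * z m" for m K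
  proof -
    have "norm (\<Sum>k. \<delta> m (k + K)) \<le> (\<Sum>k. C * z m * z (k + K))"
      using sz by (intro norm_suminf_le) 
        (auto simp: \<delta>b intro!: summable_mult summable_ignore_initial_segment)
    also have "\<dots> = C * z m * t K" unfolding t_def by (intro suminf_mult summable_ignore_initial_segment sz)
    finally show ?thesis by (simp add: mult_ac)
  qed
  have s\<Delta>: "summable (\<lambda>m. \<Sum>k. \<delta> m (k + K))" for K
    by (rule summable_comparison_test'[of "\<lambda>m. C * t K * z m"]) (use \<Delta>b sz in \<open>auto intro!: summable_mult\<close>)
  have eq: "S1 - (\<Sum>k<K. \<sigma>2 k) = (\<Sum>m. \<Sum>k. \<delta> m (k + K)) - (\<Sum>m. eis_tele x h (Suc m) (Suc K))" for K
  proof -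
    have "(\<lambda>m. \<sigma>1 m - (\<Sum>k<K. eis_term x h (Suc m) (Suc k))) sums (S1 - (\<Sum>k<K. \<sigma>2 k))"
      by (intro sums_diff S1 sums_sum s2)
    moreover have "(\<lambda>m. (\<Sum>k. \<delta> m (k + K)) - eis_tele x h (Suc m) (Suc K)) sums ((\<Sum>m. \<Sum>k. \<delta> m (k + K)) - (\<Sum>m. eis_tele x h (Suc m) (Suc K)))"
      by (intro sums_diff summable_sums s\<Delta> eis_tele_limit(2)[OF x h]) auto
    ultimately show ?thesis unfolding tail using sums_unique2 by blast
  qed
  have l1: "(\<lambda>K. \<Sum>m. \<Sum>k. \<delta> m (k + K)) \<longlonglongrightarrow> 0"
  proof (rule Lim_null_comparison)
    show "\<forall>\<^sub>F K in sequentially. norm (\<Sum>m. \<Sum>k. \<delta> m (k + K)) \<le> C * t K * (\<Sum>m. z m)"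
    proof (rule always_eventually, rule allI)
      fix K
      have "norm (\<Sum>m. \<Sum>k. \<delta> m (k + K)) \<le> (\<Sum>m. C * t K * z m)"
        using sz by (intro norm_suminf_le) (auto simp: \<Delta>b intro!: summable_mult)
      also have "\<dots> = C * t K * (\<Sum>m. z m)" by (intro suminf_mult sz)
      finally show "norm (\<Sum>m. \<Sum>k. \<delta> m (k + K)) \<le> C * t K * (\<Sum>m. z m)" by simp
    qed
    show "(\<lambda>K. C * t K * (\<Sum>m. z m)) \<longlonglongrightarrow> 0"
      using tendsto_mult[OF tendsto_mult[OF tendsto_const[of C] t0] tendsto_const[of "\<Sum>m. z m"]] by simp
  qed
  have l2: "(\<lambda>K. \<Sum>m. eis_tele x h (Suc m) (Suc K)) \<longlonglongrightarrow> pi / (x * h)"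
    by (rule LIMSEQ_Suc[OF eis_tele_limit(1)[OF x h]])
  have "(\<lambda>K. S1 - (\<Sum>k<K. \<sigma>2 k)) \<longlonglongrightarrow> 0 - pi / (x * h)"
    unfolding eq by (intro tendsto_diff l1 l2)
  moreover have "(\<lambda>K. S1 - (\<Sum>k<K. \<sigma>2 k)) \<longlonglongrightarrow> S1 - S2"
    using S2 by (intro tendsto_intros) (simp add: sums_def)
  ultimately have "S1 - S2 = 0 - pi / (x * h)" using LIMSEQ_unique by blast
  then show ?thesis by simp
qed

section \<open>The logarithm of the Euler product\<close>

lemma sums_swap_nonneg:
  fixes f :: "nat \<Rightarrow> nat \<Rightarrow> real"
  assumes nonneg: "\<And>n m. f n m \<ge> 0"
    and f: "\<And>n. f n sums g n" and g: "g sums S" and h: "\<And>m. (\<lambda>n. f n m) sums h m"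
  shows "h sums S"
proof -
  have g0: "g n \<ge> 0" for n using f[of n] nonneg sums_le[of "\<lambda>_. 0" "f n" 0 "g n"] by auto
  have hf: "(f n has_sum g n) UNIV" for n by (rule sums_nonneg_imp_has_sum[OF f nonneg])
  have hh: "((\<lambda>n. f n m) has_sum h m) UNIV" for m by (rule sums_nonneg_imp_has_sum[OF h nonneg])
  have hg: "(g has_sum S) UNIV" by (rule sums_nonneg_imp_has_sum[OF g g0])
  have "(\<lambda>(n, m). f n m) summable_on (UNIV \<times> UNIV)"
    by (rule summable_on_SigmaI[where g = g]) (use hf hg nonneg in \<open>auto simp: summable_on_def\<close>)
  then have "((\<lambda>(n, m). f n m) has_sum S) (UNIV \<times> UNIV)"
    by (intro has_sum_SigmaI[where g = g]) (use hf hg in auto)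
  then have "((\<lambda>(m, n). f n m) has_sum S) (UNIV \<times> UNIV)"
    by (subst (asm) has_sum_swap) simp
  then have "(h has_sum S) UNIV"
    by (rule has_sum_SigmaD) (use hh in auto)
  then show ?thesis by (rule has_sum_imp_sums)
qed

lemma neg_Ln_sums:
  fixes w :: complex
  assumes "norm w < 1"
  shows "(\<lambda>n. w ^ Suc n / of_nat (Suc n)) sums (- Ln (1 - w))"
proof -
  have "(\<lambda>n. w ^ n / of_nat n) sums (- Ln (1 - w))"
    using sums_minus[OF Ln_series'[of "-w"]] assms by simp
  then show ?thesis by (subst sums_Suc_iff) simp
qed

lemma neg_ln_sums:
  fixes w :: real
  assumes "\<bar>w\<bar> < 1"
  shows "(\<lambda>n. w ^ Suc n / real (Suc n)) sums (- ln (1 - w))"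
proof -
  have "(\<lambda>n. w ^ n / real n) sums (- ln (1 - w))"
    using sums_minus[OF ln_series'[of "-w"]] assms by simp
  then show ?thesis by (subst sums_Suc_iff) simp
qed

lemma norm_Ln_le:
  fixes w :: complex
  assumes "norm w < 1"
  shows "norm (Ln (1 - w)) \<le> - ln (1 - norm w)"
proof -
  have s: "(\<lambda>n. norm w ^ Suc n / real (Suc n)) sums (- ln (1 - norm w))"
    by (rule neg_ln_sums) (use assms in auto)
  have "norm (\<Sum>n. w ^ Suc n / of_nat (Suc n)) \<le> (\<Sum>n. norm w ^ Suc n / real (Suc n))"
    by (rule norm_suminf_le) (use s in \<open>auto simp: sums_iff norm_divide norm_mult norm_power simp del: of_nat_Suc\<close>)
  then have "norm (- Ln (1 - w)) \<le> - ln (1 - norm w)"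
    using neg_Ln_sums[OF assms] s by (simp only: sums_iff)
  then show ?thesis by simp
qed

lemma neg_ln_le:
  fixes w :: real
  assumes "0 \<le> w" "w < 1"
  shows "- ln (1 - w) \<le> w / (1 - w)"
proof -
  have "ln (1 / (1 - w)) \<le> 1 / (1 - w) - 1"
    using assms by (intro ln_le_minus_one) auto
  then show ?thesis using assms by (simp add: ln_div field_simps)
qed

text \<open>A branch of - log of the Euler product, fixed by taking the principal \<open>Ln\<close>
  of each factor; it is holomorphic on the unit disc and vanishes at 0.\<close>

definition Lam :: "complex \<Rightarrow> complex" where
  "Lam q = (\<Sum>n. - Ln (1 - q ^ Suc n))"

definition lam :: "real \<Rightarrow> real" where
  "lam r = (\<Sum>n. - ln (1 - r ^ Suc n))"

lemma neg_ln_power_bound: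
  fixes r :: real
  assumes "0 \<le> r" "r < 1"
  shows "- ln (1 - r ^ Suc n) \<le> r ^ Suc n / (1 - r)"
proof -
  have "r ^ Suc n \<le> r" using assms by (simp add: mult_left_le power_le_one)
  have "- ln (1 - r ^ Suc n) \<le> r ^ Suc n / (1 - r ^ Suc n)"
    using assms \<open>r ^ Suc n \<le> r\<close> by (intro neg_ln_le) auto
  also have "\<dots> \<le> r ^ Suc n / (1 - r)"
    using assms \<open>r ^ Suc n \<le> r\<close> by (intro divide_left_mono) auto
  finally show ?thesis .
qed

lemma norm_Ln_power_bound:
  assumes "norm q \<le> r" "r < 1"
  shows "norm (- Ln (1 - q ^ Suc n)) \<le> r ^ Suc n / (1 - r)"
proof -
  have r: "0 \<le> r" using assms norm_ge_zero order_trans by blast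
  have p: "norm q ^ Suc n \<le> r ^ Suc n" "r ^ Suc n < 1"
    using assms r power_mono[of "norm q" r "Suc n"] by (auto simp: power_less_one_iff simp del: power_Suc)
  have "norm (- Ln (1 - q ^ Suc n)) \<le> - ln (1 - norm q ^ Suc n)"
    using norm_Ln_le[of "q ^ Suc n"] p by (simp add: norm_power norm_mult)
  also have "\<dots> \<le> - ln (1 - r ^ Suc n)" using p by simp
  also have "\<dots> \<le> r ^ Suc n / (1 - r)" by (rule neg_ln_power_bound[OF r assms(2)])
  finally show ?thesis .
qed

lemma summable_power_bound:
  fixes r :: real
  assumes "0 \<le> r" "r < 1"
  shows "summable (\<lambda>n. r ^ Suc n / (1 - r))" "(\<Sum>n. r ^ Suc n / (1 - r)) = r / (1 - r)\<^sup>2"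
proof -
  have "(\<lambda>n. r / (1 - r) * r ^ n) sums (r / (1 - r) * (1 / (1 - r)))"
    using assms by (intro sums_mult geometric_sums) auto
  then have "(\<lambda>n. r ^ Suc n / (1 - r)) sums (r / (1 - r)\<^sup>2)" by (simp add: power2_eq_square)
  then show "summable (\<lambda>n. r ^ Suc n / (1 - r))" "(\<Sum>n. r ^ Suc n / (1 - r)) = r / (1 - r)\<^sup>2"
    by (auto simp: sums_iff)
qed

lemma Lam_sums:
  assumes "norm q < 1"
  shows "(\<lambda>n. - Ln (1 - q ^ Suc n)) sums Lam q"
  unfolding Lam_def
  by (intro summable_sums summable_comparison_test'[OF summable_power_bound(1)[of "norm q"] norm_Ln_power_bound]) (use assms in auto)

lemma lam_sums:
  assumes "0 \<le> r" "r < 1"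
  shows "(\<lambda>n. - ln (1 - r ^ Suc n)) sums lam r"
  unfolding lam_def
proof (intro summable_sums summable_comparison_test'[OF summable_power_bound(1)[of r]])
  fix n
  have "r ^ Suc n \<le> 1" using assms by (intro power_le_one) auto
  moreover have "r ^ Suc n < 1" using assms by (simp add: power_less_one_iff del: power_Suc)
  ultimately show "norm (- ln (1 - r ^ Suc n)) \<le> r ^ Suc n / (1 - r)"
    using neg_ln_power_bound[OF assms, of n] assms by (simp add: abs_if del: power_Suc)
qed (use assms in auto)

lemma Lam_of_real:
  assumes "0 \<le> r" "r < 1"
  shows "Lam (of_real r) = of_real (lam r)"
proof -
  have "(\<lambda>n. of_real (- ln (1 - r ^ Suc n))) sums (of_real (lam r) :: complex)"
    by (rule sums_of_real[OF lam_sums[OF assms]])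
  moreover have "of_real (- ln (1 - r ^ Suc n)) = - Ln (1 - of_real r ^ Suc n)" for n
  proof -
    have "r ^ Suc n < 1" using assms by (simp add: power_less_one_iff del: power_Suc)
    then show ?thesis using Ln_of_real[of "1 - r ^ Suc n"] by (simp del: power_Suc)
  qed
  ultimately have "(\<lambda>n. - Ln (1 - of_real r ^ Suc n)) sums (of_real (lam r) :: complex)" by simp
  moreover have "(\<lambda>n. - Ln (1 - of_real r ^ Suc n)) sums Lam (of_real r)"
    by (rule Lam_sums) (use assms in auto)
  ultimately show ?thesis using sums_unique2 by blast
qed

lemma Lam_uniform_limit:
  assumes "0 \<le> r" "r < 1"
  shows "uniform_limit (cball 0 r) (\<lambda>N q. \<Sum>n<N. - Ln (1 - q ^ Suc n)) Lam sequentially"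
proof -
  have "uniform_limit (cball 0 r) (\<lambda>N q. \<Sum>n<N. - Ln (1 - q ^ Suc n)) (\<lambda>q. \<Sum>n. - Ln (1 - q ^ Suc n)) sequentially"
    by (rule Weierstrass_m_test[OF norm_Ln_power_bound[OF _ assms(2)] summable_power_bound(1)[OF assms]]) auto
  then show ?thesis by (simp add: Lam_def[abs_def])
qed

lemma holomorphic_Ln_power: "(\<lambda>q. - Ln (1 - q ^ Suc n)) holomorphic_on ball 0 1"
proof -
  have "1 - q ^ Suc n \<notin> \<real>\<^sub>\<le>\<^sub>0" if "q \<in> ball 0 1" for q :: complex
  proof -
    have "norm (q ^ Suc n) < 1" using that unfolding norm_power by (auto simp: power_less_one_iff simp del: power_Suc)
    then have "Re (q ^ Suc n) < 1" using complex_Re_le_cmod order.strict_trans1 by blast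
    then have "Re (1 - q ^ Suc n) > 0" by (simp del: power_Suc)
    then show ?thesis using complex_nonpos_Reals_iff not_le by blast
  qed
  then show ?thesis by (intro holomorphic_intros) auto
qed

lemma Lam_holomorphic: "Lam holomorphic_on ball 0 1"
proof (rule holomorphic_uniform_sequence[OF open_ball])
  show "(\<lambda>q. \<Sum>n<N. - Ln (1 - q ^ Suc n)) holomorphic_on ball 0 1" for N
    by (intro holomorphic_on_sum holomorphic_Ln_power)
  fix q :: complex assume "q \<in> ball 0 1"
  then obtain d where d: "d > 0" "d + norm q < 1"
    using field_lbound_gt_zero[of "1 - norm q" "1 - norm q"] by (auto intro: that[of "(1 - norm q) / 2"])
  have "cball q d \<subseteq> cball 0 (d + norm q)"
  proof
    fix z assume "z \<in> cball q d"
    then show "z \<in> cball 0 (d + norm q)" using norm_triangle_sub[of z q] by (simp add: dist_norm norm_minus_commute)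
  qed
  moreover have "cball 0 (d + norm q) \<subseteq> ball (0::complex) 1" using d by auto
  moreover have "uniform_limit (cball 0 (d + norm q)) (\<lambda>N q. \<Sum>n<N. - Ln (1 - q ^ Suc n)) Lam sequentially"
    by (rule Lam_uniform_limit) (use d in auto)
  ultimately show "\<exists>d>0. cball q d \<subseteq> ball 0 1 \<and> uniform_limit (cball q d) (\<lambda>N q. \<Sum>n<N. - Ln (1 - q ^ Suc n)) Lam sequentially"
    using d(1) uniform_limit_on_subset by blast
qed

lemma lam_bounds:
  assumes "0 \<le> r" "r < 1"
  shows "0 \<le> lam r" "lam r \<le> r / (1 - r)\<^sup>2"
proof -
  have *: "0 \<le> - ln (1 - r ^ Suc n)" for n
  proof -
    have "r ^ Suc n < 1" "0 \<le> r ^ Suc n" using assms by (auto simp add: power_less_one_iff simp del: power_Suc)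
    then show ?thesis by (simp del: power_Suc)
  qed
  show "0 \<le> lam r" using sums_le[OF _ sums_zero lam_sums[OF assms]] * by blast
  show "lam r \<le> r / (1 - r)\<^sup>2"
    using sums_le[OF neg_ln_power_bound[OF assms] lam_sums[OF assms] summable_sums[OF summable_power_bound(1)[OF assms]]]
    by (simp only: summable_power_bound(2)[OF assms])
qed

lemma norm_Lam_le:
  assumes "norm q < 1"
  shows "norm (Lam q) \<le> lam (norm q)"
proof -
  have "norm (- Ln (1 - q ^ Suc n)) \<le> - ln (1 - norm q ^ Suc n)" for n
    using norm_Ln_le[of "q ^ Suc n"] assms by (simp add: norm_power power_less_one_iff del: power_Suc)
  then have "norm (\<Sum>n. - Ln (1 - q ^ Suc n)) \<le> (\<Sum>n. - ln (1 - norm q ^ Suc n))"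
    using lam_sums[of "norm q"] assms by (intro norm_suminf_le) (auto simp only: sums_iff norm_ge_zero)
  then show ?thesis by (simp only: Lam_def lam_def)
qed

lemma lam_mono:
  assumes "0 \<le> r" "r \<le> s" "s < 1"
  shows "lam r \<le> lam s"
proof (rule sums_le[OF _ lam_sums lam_sums])
  fix n
  have "r ^ Suc n \<le> s ^ Suc n" "s ^ Suc n < 1" using assms by (auto simp: power_mono power_less_one_iff simp del: power_Suc)
  then show "- ln (1 - r ^ Suc n) \<le> - ln (1 - s ^ Suc n)" by (simp del: power_Suc)
qed (use assms in auto)

section \<open>The modular transformation\<close>

text \<open>Both series are the sum of n exp (- n m x) over n, m >= 1, taken first over m and first
  over n respectively. The second form is the one that \<open>csch_expansion\<close> expands
  further.\<close>

lemma lambert_swap: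
  fixes x :: real
  assumes x: "x > 0"
  assumes S: "(\<lambda>n. real (Suc n) * exp (- (real (Suc n) * x)) / (1 - exp (- (real (Suc n) * x)))) sums S"
  shows "(\<lambda>m. exp (real (Suc m) * x) / (exp (real (Suc m) * x) - 1)\<^sup>2) sums S"
proof (rule sums_swap_nonneg[OF _ _ S])
  define f where "f n m = real (Suc n) * exp (- (real (Suc n) * real (Suc m) * x))" for n m
  show "f n m \<ge> 0" for n m by (simp add: f_def)
  show "f n sums (real (Suc n) * exp (- (real (Suc n) * x)) / (1 - exp (- (real (Suc n) * x))))" for n
  proof -
    define r where "r = exp (- (real (Suc n) * x))"
    have "(\<lambda>m. real (Suc n) * r * r ^ m) sums (real (Suc n) * r * (1 / (1 - r)))"
      by (intro sums_mult geometric_sums) (use x in \<open>auto simp: r_def\<close>)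
    moreover have "real (Suc n) * r * r ^ m = f n m" for m
      by (simp add: f_def r_def exp_of_nat_mult[symmetric] exp_add[symmetric] algebra_simps)
    ultimately show ?thesis by (simp add: r_def)
  qed
  show "(\<lambda>n. f n m) sums (exp (real (Suc m) * x) / (exp (real (Suc m) * x) - 1)\<^sup>2)" for m
  proof -
    define r where "r = exp (- (real (Suc m) * x))"
    have r: "0 < r" "r < 1" using x by (auto simp: r_def)
    have "(\<lambda>n. r * (of_nat (Suc n) * r ^ n)) sums (r * (1 / (1 - r)\<^sup>2))"
      by (intro sums_mult geometric_deriv_sums) (use r in auto)
    moreover have "r * (of_nat (Suc n) * r ^ n) = f n m" for n
      by (simp add: f_def r_def exp_of_nat_mult[symmetric] exp_add[symmetric] algebra_simps)
    moreover have "r * (1 / (1 - r)\<^sup>2) = exp (real (Suc m) * x) / (exp (real (Suc m) * x) - 1)\<^sup>2"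
    proof -
      have "exp (real (Suc m) * x) = 1 / r" by (simp only: r_def exp_minus inverse_eq_divide) simp
      moreover have "1 / r / (1 / r - 1)\<^sup>2 = r * (1 / (1 - r)\<^sup>2)" 
        using r by (simp add: field_simps power2_eq_square)
      ultimately show ?thesis by simp
    qed
    ultimately show ?thesis by simp
  qed
qed

lemma lam_exp_deriv:
  fixes x :: real
  assumes x: "x > 0"
  obtains D where "((\<lambda>x. lam (exp (- x))) has_field_derivative (- D)) (at x)"
    "(\<lambda>m. exp (real (Suc m) * x) / (exp (real (Suc m) * x) - 1)\<^sup>2) sums D"
proof -
  \<comment> \<open>Half of x leaves an open half-line around x on which all derivatives are
    dominated by one convergent series.\<close>
  define \<delta> where "\<delta> = x / 2"
  have \<delta>: "\<delta> > 0" "\<delta> < x" using x by (auto simp: \<delta>_def)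
  define f where "f n y = - ln (1 - exp (- y) ^ Suc n)" for n and y :: real
  define f' where "f' n y = - (real (Suc n) * exp (- (real (Suc n) * y)) / (1 - exp (- (real (Suc n) * y))))" for n and y :: real
  have der: "(f n has_field_derivative f' n y) (at y within {\<delta><..})" if "y \<in> {\<delta><..}" for n y
  proof -
    have e: "exp (- y) ^ Suc n = exp (- (real (Suc n) * y))" for y :: real by (simp add: exp_of_nat_mult[symmetric] del: power_Suc)
    have p: "real (Suc n) * y > 0" using that \<delta> by (intro mult_pos_pos) auto
    then have "exp (- (real (Suc n) * y)) < 1" by simp
    then show ?thesis unfolding f_def f'_def e
      by (auto intro!: derivative_eq_intros simp: field_simps simp del: of_nat_Suc)
  qed
  define r where "r = exp (- \<delta>)"
  have r: "0 < r" "r < 1" using \<delta> by (auto simp: r_def)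
  have bnd: "norm (f' n y) \<le> (r / (1 - r)) * (of_nat (Suc n) * r ^ n)" if "y \<in> {\<delta><..}" for n y
  proof -
    have a: "exp (- (real (Suc n) * y)) \<le> exp (- (real (Suc n) * \<delta>))" using that by (simp del: of_nat_Suc)
    have b: "exp (- (real (Suc n) * \<delta>)) = r ^ Suc n" by (simp add: r_def exp_of_nat_mult[symmetric] del: power_Suc)
    have c: "r ^ Suc n \<le> r" using r by (simp add: mult_left_le power_le_one)
    have "exp (- (real (Suc n) * y)) / (1 - exp (- (real (Suc n) * y))) \<le> r ^ Suc n / (1 - r)"
      using a b c r by (intro frac_le) (auto simp del: power_Suc of_nat_Suc)
    then have "real (Suc n) * (exp (- (real (Suc n) * y)) / (1 - exp (- (real (Suc n) * y)))) \<le> real (Suc n) * (r ^ Suc n / (1 - r))"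
      by (intro mult_left_mono) auto
    moreover have "norm (f' n y) = real (Suc n) * (exp (- (real (Suc n) * y)) / (1 - exp (- (real (Suc n) * y))))"
    proof -
      have "exp (- (real (Suc n) * y)) < 1" using a b c r by linarith
      then show ?thesis by (simp add: f'_def abs_mult del: of_nat_Suc)
    qed
    ultimately show ?thesis by (simp add: mult_ac)
  qed
  have sm: "summable (\<lambda>n. (r / (1 - r)) * (of_nat (Suc n) * r ^ n))"
    by (intro summable_mult sums_summable[OF geometric_deriv_sums]) (use r in auto)
  have unif: "uniformly_convergent_on {\<delta><..} (\<lambda>n v. \<Sum>k<n. f' k v)"
    by (rule Weierstrass_m_test'[OF bnd sm])
  have sums: "(\<lambda>n. f n y) sums lam (exp (- y))" if "y > 0" for y
    unfolding f_def by (rule lam_sums) (use that in auto)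
  note D = has_field_derivative_series'[OF _ der unif _ sums_summable[OF sums[OF x]], of x]
  have "((\<lambda>v. \<Sum>k. f k v) has_field_derivative (\<Sum>k. f' k x)) (at x)"
    by (rule D(2)) (use x \<delta> in \<open>auto simp: interior_open\<close>)
  then have 1: "((\<lambda>x. lam (exp (- x))) has_field_derivative (- (- (\<Sum>k. f' k x)))) (at x)"
  proof (subst DERIV_cong_ev[OF refl _ refl])
    show "\<forall>\<^sub>F v in nhds x. lam (exp (- v)) = (\<Sum>k. f k v)"
      using eventually_nhds_in_open[of "{0<..}" x] x by (auto elim!: eventually_mono simp: sums_iff dest!: sums)
  qed auto
  have "summable (\<lambda>k. f' k x)" by (rule summable_comparison_test'[OF sm bnd]) (use \<delta> in auto)
  then have "(\<lambda>k. - f' k x) sums (- (\<Sum>k. f' k x))" by (intro sums_minus summable_sums)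
  then have "(\<lambda>m. exp (real (Suc m) * x) / (exp (real (Suc m) * x) - 1)\<^sup>2) sums (- (\<Sum>k. f' k x))"
    unfolding f'_def minus_minus by (rule lambert_swap[OF x])
  with 1 show ?thesis by (rule that)
qed

text \<open>Expanding D by \<open>csch_expansion\<close> sums the Eisenstein series with h = 2 pi
  first over k. Expanding D' at the dual point gives the same terms up to the factor - 4 pi^2 / x^2,
  summed first over m. The terms 1 / w^2 add up to zeta values, and the defect pi / (x h) becomes 1
  / (2 x).\<close>

lemma lam_dual_derivatives:
  fixes x :: real
  assumes x: "x > 0"
  assumes D: "(\<lambda>m. exp (real (Suc m) * x) / (exp (real (Suc m) * x) - 1)\<^sup>2) sums D"
  assumes y: "y = 4 * pi\<^sup>2 / x"
  assumes D': "(\<lambda>m. exp (real (Suc m) * y) / (exp (real (Suc m) * y) - 1)\<^sup>2) sums D'"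
  shows "D + 4 * pi\<^sup>2 / x\<^sup>2 * D' = pi\<^sup>2 / (6 * x\<^sup>2) + 1 / 24 - 1 / (2 * x)"
proof -
  have y0: "y > 0" using x y by simp
  have basel: "(\<lambda>n. 1 / (real (Suc n))\<^sup>2) sums (pi\<^sup>2 / 6)" using inverse_squares_sums by (simp add: add.commute)
  have 1: "(\<lambda>k. eis_term x (2 * pi) (Suc m) (Suc k)) sums
     (exp (real (Suc m) * x) / (exp (real (Suc m) * x) - 1)\<^sup>2 - 1 / x\<^sup>2 * (1 / (real (Suc m))\<^sup>2))" for m
    using csch_expansion[of "real (Suc m) * x"] x unfolding eis_term_def by (simp add: power_mult_distrib mult.commute)
  have 2: "(\<lambda>m. exp (real (Suc m) * x) / (exp (real (Suc m) * x) - 1)\<^sup>2 - 1 / x\<^sup>2 * (1 / (real (Suc m))\<^sup>2)) sums (D - 1 / x\<^sup>2 * (pi\<^sup>2 / 6))"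
    by (intro sums_diff D sums_mult basel)
  have 3: "(\<lambda>m. eis_term x (2 * pi) (Suc m) (Suc k)) sums
     (- (4 * pi\<^sup>2 / x\<^sup>2) * (exp (real (Suc k) * y) / (exp (real (Suc k) * y) - 1)\<^sup>2 - 1 / y\<^sup>2 * (1 / (real (Suc k))\<^sup>2)))" for k
  proof -
    define w where "w = real (Suc k) * y"
    have w: "w > 0" using y0 by (simp add: w_def)
    have "(\<lambda>m. - (4 * pi\<^sup>2 / x\<^sup>2) * (2 * (w\<^sup>2 - (2 * pi * real (Suc m))\<^sup>2) / (w\<^sup>2 + (2 * pi * real (Suc m))\<^sup>2)\<^sup>2)) sums
        (- (4 * pi\<^sup>2 / x\<^sup>2) * (exp w / (exp w - 1)\<^sup>2 - 1 / w\<^sup>2))"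
      by (intro sums_mult csch_expansion w)
    moreover have "- (4 * pi\<^sup>2 / x\<^sup>2) * (2 * (w\<^sup>2 - (2 * pi * real (Suc m))\<^sup>2) / (w\<^sup>2 + (2 * pi * real (Suc m))\<^sup>2)\<^sup>2)
       = eis_term x (2 * pi) (Suc m) (Suc k)" for m
    proof -
      define P where "P = (2 * pi * real (Suc k))\<^sup>2"
      define Q where "Q = (real (Suc m) * x)\<^sup>2"
      define c where "c = 4 * pi\<^sup>2 / x\<^sup>2"
      have c: "c > 0" using x by (simp add: c_def)
      have PQ: "P + Q > 0" unfolding P_def Q_def using x by (intro add_pos_pos) auto
      have a: "w\<^sup>2 = c * P" "(2 * pi * real (Suc m))\<^sup>2 = c * Q" unfolding w_def y c_def P_def Q_def using x
        by (auto simp: power2_eq_square field_simps)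
      have b: "eis_term x (2 * pi) (Suc m) (Suc k) = 2 * (Q - P) / (Q + P)\<^sup>2" 
        by (simp only: eis_term_def P_def Q_def)
      have "- c * (2 * (c * P - c * Q) / (c * P + c * Q)\<^sup>2) = - c * (2 * (c * (P - Q)) / (c * (P + Q))\<^sup>2)"
        by (simp add: algebra_simps)
      also have "\<dots> = 2 * (Q - P) / (Q + P)\<^sup>2"
        using c PQ by (simp add: power_mult_distrib power2_eq_square divide_simps) (simp add: algebra_simps)
      finally show ?thesis unfolding a b c_def[symmetric] .
    qed
    ultimately show ?thesis by (simp add: w_def power_mult_distrib mult.commute)
  qed
  have 4: "(\<lambda>k. - (4 * pi\<^sup>2 / x\<^sup>2) * (exp (real (Suc k) * y) / (exp (real (Suc k) * y) - 1)\<^sup>2 - 1 / y\<^sup>2 * (1 / (real (Suc k))\<^sup>2))) sums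
     (- (4 * pi\<^sup>2 / x\<^sup>2) * (D' - 1 / y\<^sup>2 * (pi\<^sup>2 / 6)))"
    by (intro sums_diff D' sums_mult basel)
  have "- (4 * pi\<^sup>2 / x\<^sup>2) * (D' - 1 / y\<^sup>2 * (pi\<^sup>2 / 6)) - (D - 1 / x\<^sup>2 * (pi\<^sup>2 / 6)) = pi / (x * (2 * pi))"
    by (rule eisenstein_swap[OF x _ 1 2 3 4]) simp
  moreover have "(4 * pi\<^sup>2 / x\<^sup>2) * (1 / y\<^sup>2 * (pi\<^sup>2 / 6)) = 1 / 24"
    using x unfolding y by (simp add: field_simps power2_eq_square)
  moreover have "pi / (x * (2 * pi)) = 1 / (2 * x)" by simp
  moreover have "1 / x\<^sup>2 * (pi\<^sup>2 / 6) = pi\<^sup>2 / (6 * x\<^sup>2)" by simp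
  ultimately show ?thesis by (simp add: right_diff_distrib)
qed

theorem lam_transformation_real:
  fixes x :: real
  assumes x: "x > 0"
  shows "lam (exp (- x)) = pi\<^sup>2 / (6 * x) - x / 24 + ln (x / (2 * pi)) / 2 + lam (exp (- (4 * pi\<^sup>2 / x)))"
proof -
  define H where "H x = lam (exp (- x)) - lam (exp (- (4 * pi\<^sup>2 / x))) - (pi\<^sup>2 / (6 * x) - x / 24 + ln (x / (2 * pi)) / 2)" for x :: real
  have "\<exists>c. \<forall>x\<in>{0<..}. H x = c"
  proof (rule has_field_derivative_zero_constant)
    show "convex {0::real<..}" by simp
    fix x :: real assume "x \<in> {0<..}"
    then have x: "x > 0" by simp
    define y where "y = 4 * pi\<^sup>2 / x"
    have y: "y > 0" using x by (simp add: y_def)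
    obtain D where D: "((\<lambda>x. lam (exp (- x))) has_field_derivative (- D)) (at x)"
      "(\<lambda>m. exp (real (Suc m) * x) / (exp (real (Suc m) * x) - 1)\<^sup>2) sums D" using lam_exp_deriv[OF x] .
    obtain D' where D': "((\<lambda>x. lam (exp (- x))) has_field_derivative (- D')) (at y)"
      "(\<lambda>m. exp (real (Suc m) * y) / (exp (real (Suc m) * y) - 1)\<^sup>2) sums D'" using lam_exp_deriv[OF y] .
    have "((\<lambda>x. 4 * pi\<^sup>2 / x) has_field_derivative (- (4 * pi\<^sup>2 / x\<^sup>2))) (at x)"
      using x by (auto intro!: derivative_eq_intros simp: power2_eq_square)
    from DERIV_chain2[OF D'(1)[unfolded y_def] this]
    have d2: "((\<lambda>x. lam (exp (- (4 * pi\<^sup>2 / x)))) has_field_derivative (- D' * (- (4 * pi\<^sup>2 / x\<^sup>2)))) (at x)" .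
    have d3: "((\<lambda>x. pi\<^sup>2 / (6 * x) - x / 24 + ln (x / (2 * pi)) / 2) has_field_derivative (- pi\<^sup>2 / (6 * x\<^sup>2) - 1 / 24 + 1 / (2 * x))) (at x)"
      using x by (auto intro!: derivative_eq_intros simp: power2_eq_square field_simps)
    have "(H has_field_derivative (- D - (- D' * (- (4 * pi\<^sup>2 / x\<^sup>2))) - (- pi\<^sup>2 / (6 * x\<^sup>2) - 1 / 24 + 1 / (2 * x)))) (at x)"
      unfolding H_def by (intro DERIV_diff D(1) d2 d3)
    moreover have "- D - (- D' * (- (4 * pi\<^sup>2 / x\<^sup>2))) - (- pi\<^sup>2 / (6 * x\<^sup>2) - 1 / 24 + 1 / (2 * x)) = 0"
      using lam_dual_derivatives[OF x D(2) y_def D'(2)] by (simp add: mult.commute)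
    ultimately show "(H has_field_derivative 0) (at x within {0<..})"
      by (metis has_field_derivative_at_within)
  qed
  \<comment> \<open>2 pi is the fixed point of x -> 4 pi^2 / x: the two \<open>lam\<close> terms
    cancel there and so do the elementary ones, which determines the constant of
    integration.\<close>
  then have "H x = H (2 * pi)" using x by (auto simp: Ball_def) 
  also have "H (2 * pi) = 0" unfolding H_def by (simp add: power2_eq_square field_simps)
  finally show ?thesis by (simp add: H_def)
qed

text \<open>Both sides are holomorphic on the right half-plane and agree on the positive reals, so
  the identity theorem applies. The principal \<open>Ln\<close> is the right branch because z / (2
  pi) stays in that half-plane.\<close>

theorem Lam_transformation:
  fixes z :: complex
  assumes z: "Re z > 0"
  shows "Lam (exp (- z)) = of_real (pi\<^sup>2) / (6 * z) - z / 24 + Ln (z / (2 * of_real pi)) / 2 + Lam (exp (- (4 * of_real (pi\<^sup>2) / z)))"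
proof -
  define S where "S = {z. Re z > 0}"
  define f where "f z = Lam (exp (- z)) - (of_real (pi\<^sup>2) / (6 * z) - z / 24 + Ln (z / (2 * of_real pi)) / 2 + Lam (exp (- (4 * of_real (pi\<^sup>2) / z))))" for z
  have e: "exp (- z) \<in> ball 0 1" if "Re z > 0" for z :: complex using that by simp
  have inv: "Re (4 * of_real (pi\<^sup>2) / z) > 0" if "Re z > 0" for z :: complex
  proof -
    have "4 * of_real (pi\<^sup>2) / z = of_real (4 * pi\<^sup>2) / z" by simp
    moreover have "Re (of_real (4 * pi\<^sup>2) / z) = 4 * pi\<^sup>2 * Re z / (cmod z)\<^sup>2" by (simp only: Re_divide cmod_power2) simp
    moreover have "4 * pi\<^sup>2 * Re z / (cmod z)\<^sup>2 > 0"
      using that by (intro divide_pos_pos mult_pos_pos) auto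
    ultimately show ?thesis by simp
  qed
  have L: "(\<lambda>z. Lam (g z)) holomorphic_on S" if "g holomorphic_on S" "\<And>z. z \<in> S \<Longrightarrow> g z \<in> ball 0 1" for g
    by (rule holomorphic_on_compose_gen[OF that(1) Lam_holomorphic, unfolded o_def]) (use that(2) in auto)
  have h1: "(\<lambda>z. Lam (exp (- z))) holomorphic_on S"
    by (rule L) (use e in \<open>auto simp: S_def intro!: holomorphic_intros\<close>)
  have h2: "(\<lambda>z. Lam (exp (- (4 * of_real (pi\<^sup>2) / z)))) holomorphic_on S"
  proof (rule L)
    show "(\<lambda>z. exp (- (4 * of_real (pi\<^sup>2) / z))) holomorphic_on S"
      by (intro holomorphic_intros) (auto simp: S_def)
    show "exp (- (4 * of_real (pi\<^sup>2) / z)) \<in> ball 0 1" if "z \<in> S" for z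
      using that by (intro e inv) (simp add: S_def)
  qed
  have "z / (2 * of_real pi) \<notin> \<real>\<^sub>\<le>\<^sub>0" if "z \<in> S" for z
  proof -
    have "z / (2 * of_real pi) = z / of_real (2 * pi)" by simp
    then have "Re (z / (2 * of_real pi)) > 0" using that by (simp only: Re_divide_of_real) (simp add: S_def)
    then show ?thesis using complex_nonpos_Reals_iff not_le by blast
  qed
  then have hol: "f holomorphic_on S"
    unfolding f_def by (intro holomorphic_intros h1 h2) (auto simp: S_def)
  have "f z = 0"
  proof (rule analytic_continuation[OF hol, of "complex_of_real ` {0<..}" 1])
    show "open S" unfolding S_def by (rule open_halfspace_Re_gt)
    show "connected S" unfolding S_def by (intro convex_connected convex_halfspace_Re_gt)
    show "complex_of_real ` {0<..} \<subseteq> S" by (auto simp: S_def)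
    show "1 \<in> S" "z \<in> S" using z by (auto simp: S_def)
    show "1 islimpt complex_of_real ` {0<..}"
      unfolding islimpt_sequential
    proof (intro exI[of _ "\<lambda>n. of_real (1 + inverse (real (Suc n)))"] conjI allI)
      show "complex_of_real (1 + inverse (real (Suc n))) \<in> complex_of_real ` {0<..} - {1}" for n
        by (auto simp: complex_eq_iff add_pos_pos)
      have "(\<lambda>n. complex_of_real (1 + inverse (real (Suc n)))) \<longlonglongrightarrow> of_real (1 + 0)"
        by (intro tendsto_of_real tendsto_add tendsto_const LIMSEQ_inverse_real_of_nat)
      then show "(\<lambda>n. complex_of_real (1 + inverse (real (Suc n)))) \<longlonglongrightarrow> 1" by simp
    qed
    fix w assume "w \<in> complex_of_real ` {0<..}"
    then obtain x where x: "w = of_real x" "x > 0" by auto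
    have a: "Lam (exp (- w)) = of_real (lam (exp (- x)))"
      using Lam_of_real[of "exp (- x)"] x by (simp add: exp_of_real[symmetric])
    have b: "Lam (exp (- (4 * of_real (pi\<^sup>2) / w))) = of_real (lam (exp (- (4 * pi\<^sup>2 / x))))"
      using Lam_of_real[of "exp (- (4 * pi\<^sup>2 / x))"] x by (simp add: exp_of_real[symmetric])
    have c: "Ln (w / (2 * of_real pi)) = of_real (ln (x / (2 * pi)))"
      using Ln_of_real[of "x / (2 * pi)"] x by simp
    show "f w = 0" unfolding f_def a b c by (subst lam_transformation_real[OF x(2)]) (simp add: x(1))
  qed
  then show ?thesis by (simp add: f_def)
qed

section \<open>Log-concavity properties of a Bessel function\<close>

text \<open>In terms of the modified Bessel functions, bes j t = I_j(2 sqrt t) / t^(j/2).\<close>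
definition bes :: "nat \<Rightarrow> real \<Rightarrow> real" where
  "bes j t = (\<Sum>m. t ^ m / (fact m * fact (m + j)))"

lemma bes_summable: "summable (\<lambda>m. t ^ m / (fact m * fact (m + j)) :: real)"
proof (rule summable_comparison_test')
  show "summable (\<lambda>m. inverse (fact m) * \<bar>t\<bar> ^ m)" by (rule summable_exp)
  fix m
  have "\<bar>t\<bar> ^ m / (fact m * fact (m + j)) \<le> \<bar>t\<bar> ^ m / (fact m * 1)"
    by (intro divide_left_mono mult_left_mono) auto
  then show "norm (t ^ m / (fact m * fact (m + j))) \<le> inverse (fact m) * \<bar>t\<bar> ^ m"
    by (simp add: power_abs divide_inverse mult.commute abs_mult)
qed

lemma bes_sums: "(\<lambda>m. t ^ m / (fact m * fact (m + j))) sums bes j t"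
  unfolding bes_def using bes_summable by (rule summable_sums)

lemma bes_deriv: "(bes j has_field_derivative bes (Suc j) t) (at t)"
proof -
  define c :: "nat \<Rightarrow> real" where "c m = 1 / (fact m * fact (m + j))" for m
  have "summable (\<lambda>m. c m * x ^ m)" for x
    using bes_summable[of x j] by (simp add: c_def)
  then have "((\<lambda>x. \<Sum>m. c m * x ^ m) has_field_derivative (\<Sum>m. diffs c m * t ^ m)) (at t)"
    by (rule termdiffs_strong_converges_everywhere)
  moreover have "diffs c m * t ^ m = t ^ m / (fact m * fact (m + Suc j))" for m
    by (simp add: diffs_def c_def)
  moreover have "c m * x ^ m = x ^ m / (fact m * fact (m + j))" for m x by (simp add: c_def)
  ultimately show ?thesis by (simp add: bes_def[abs_def])
qed

lemma bes_pos:
  assumes "t \<ge> 0"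
  shows "bes j t > 0"
  unfolding bes_def 
proof (rule suminf_pos2[OF bes_summable, of _ _ 0])
  show "0 \<le> t ^ n / (fact n * fact (n + j))" for n using assms by simp
qed simp

text \<open>Of the factor (j + 1) + m in fact (m + j + 1), the part j + 1 gives the first series,
  and the part m, cancelled against fact m, gives the second.\<close>

lemma bes_recurrence: "bes j t = real (Suc j) * bes (Suc j) t + t * bes (Suc (Suc j)) t"
proof -
  have 1: "(\<lambda>m. t ^ Suc m / (fact m * fact (m + Suc (Suc j)))) sums (t * bes (Suc (Suc j)) t)"
    using sums_mult[OF bes_sums[of t "Suc (Suc j)"], of t] by simp
  have "(\<lambda>m. real m * t ^ m / (fact m * fact (m + Suc j))) sums (t * bes (Suc (Suc j)) t)"
  proof -
    define f where "f m = real m * t ^ m / (fact m * fact (m + Suc j))" for m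
    have "f (Suc m) = t ^ Suc m / (fact m * fact (m + Suc (Suc j)))" for m
      unfolding f_def fact_Suc[of m] of_nat_mult by (simp del: of_nat_Suc power_Suc)
    then have "(\<lambda>m. f (Suc m)) sums (t * bes (Suc (Suc j)) t)" using 1 by simp
    then have "f sums (t * bes (Suc (Suc j)) t + f 0)" by (simp only: sums_Suc_iff)
    then show ?thesis by (simp add: f_def[abs_def])
  qed
  from sums_add[OF sums_mult[OF bes_sums[of t "Suc j"], of "real (Suc j)"] this]
  have "(\<lambda>m. real (Suc j) * (t ^ m / (fact m * fact (m + Suc j))) + real m * t ^ m / (fact m * fact (m + Suc j))) sums
     (real (Suc j) * bes (Suc j) t + t * bes (Suc (Suc j)) t)" .
  moreover have "real (Suc j) * (t ^ m / (fact m * fact (m + Suc j))) + real m * t ^ m / (fact m * fact (m + Suc j)) = t ^ m / (fact m * fact (m + j))" for m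
  proof -
    have gen: "b * (u / (v * (a * w))) + c * u / (v * (a * w)) = u / (v * w)" if "a > 0" "a = b + c" for a b c u v w :: real
    proof -
      have "b * (u / (v * (a * w))) + c * u / (v * (a * w)) = (b + c) * (u / (v * (a * w)))"
        by (simp only: distrib_right) simp
      then show ?thesis using that(1) unfolding that(2)[symmetric] by simp
    qed
    have "(fact (m + Suc j) :: real) = (real (Suc j) + real m) * fact (m + j)" by (simp add: algebra_simps)
    then show ?thesis by (simp only:) (rule gen, auto simp: add_pos_nonneg)
  qed
  ultimately have "(\<lambda>m. t ^ m / (fact m * fact (m + j))) sums (real (Suc j) * bes (Suc j) t + t * bes (Suc (Suc j)) t)"
    by (simp only:)
  then show ?thesis by (rule sums_unique2[OF bes_sums])
qed

text \<open>Compares (2 n + 1)! with 4^n (n!)^2, the denominators by which the series of sinh and of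
  \<open>bes\<close> differ.\<close>

lemma four_power_le_central_binomial: "4 ^ n \<le> (2 * real n + 1) * real ((2 * n) choose n)"
proof (induction n)
  case (Suc n)
  have "Suc n * ((2 * Suc n) choose Suc n) = (2 * Suc n) * ((Suc (2 * n)) choose n)"
    using Suc_times_binomial_eq[of "Suc (2 * n)" n] by simp
  moreover have "Suc n * (Suc (2 * n) choose n) = Suc (2 * n) * ((2 * n) choose n)"
    using binomial_absorb_comp[of "Suc (2 * n)" n] by (simp add: Suc_diff_le mult_2)
  ultimately have "real (Suc n) * real ((2 * Suc n) choose Suc n) = 2 * real (Suc (2 * n)) * real ((2 * n) choose n)"
    by (metis (no_types, opaque_lifting) mult.assoc mult.commute of_nat_mult of_nat_numeral)
  then have e: "real ((2 * Suc n) choose Suc n) = 2 * (2 * real n + 1) * real ((2 * n) choose n) / real (Suc n)"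
    by (simp add: field_simps)
  have "4 ^ Suc n \<le> 4 * ((2 * real n + 1) * real ((2 * n) choose n))" using Suc by simp
  also have "\<dots> \<le> (2 * real (Suc n) + 1) * real ((2 * Suc n) choose Suc n)"
  proof -
    have "(2 * real (Suc n) + 1) * (2 / real (Suc n)) \<ge> 4" by (simp add: field_simps)
    then have "4 * ((2 * real n + 1) * real ((2 * n) choose n)) \<le> ((2 * real (Suc n) + 1) * (2 / real (Suc n))) * ((2 * real n + 1) * real ((2 * n) choose n))"
      by (intro mult_right_mono) auto
    also have "\<dots> = (2 * real (Suc n) + 1) * real ((2 * Suc n) choose Suc n)" unfolding e by (simp add: field_simps)
    finally show ?thesis .
  qed
  finally show ?case .
qed simp

text \<open>A termwise comparison with the series of sinh. At s = 2 T it has the right exponential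
  growth exp (2 T) and loses only a factor of order sqrt T against the true size.\<close>

lemma bes_lower:
  fixes s :: real
  assumes s: "s > 0"
  shows "2 * (sinh s - s) / s ^ 3 \<le> bes 2 (s\<^sup>2 / 4)"
proof -
  define f where "f n = s ^ (2 * n + 1) /\<^sub>R fact (2 * n + 1)" for n
  define g where "g n = (if even n then 0 else s ^ n /\<^sub>R fact n)" for n
  have "(\<lambda>n. g (2 * n + 1)) sums sinh s"
  proof (subst sums_mono_reindex)
    show "strict_mono (\<lambda>n::nat. 2 * n + 1)" by (simp add: strict_mono_def)
    show "g n = 0" if "n \<notin> range (\<lambda>n. 2 * n + 1)" for n
      using that by (cases "even n") (auto simp: g_def elim!: oddE)
    show "g sums sinh s" unfolding g_def by (rule sinh_converges)
  qed
  moreover have "g (2 * n + 1) = f n" for n unfolding g_def f_def by simp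
  ultimately have "f sums sinh s" by simp
  then have "(\<lambda>n. f (Suc n)) sums (sinh s - s)" by (simp add: sums_Suc_iff) (simp add: f_def)
  from sums_mult[OF this, of "2 / s ^ 3"]
  have 1: "(\<lambda>n. 2 / s ^ 3 * (s ^ (2 * Suc n + 1) /\<^sub>R fact (2 * Suc n + 1))) sums (2 * (sinh s - s) / s ^ 3)" unfolding f_def by simp
  have "2 / s ^ 3 * (s ^ (2 * Suc m + 1) /\<^sub>R fact (2 * Suc m + 1)) \<le> (s\<^sup>2 / 4) ^ m / (fact m * fact (m + 2))" for m
  proof -
    define B where "B = real ((2 * Suc m) choose Suc m)"
    have f: "fact (2 * Suc m) = B * (fact (Suc m) * fact (Suc m))"
    proof -
      have "2 * Suc m - Suc m = Suc m" "Suc m \<le> 2 * Suc m" by simp_all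
      then have "B = fact (2 * Suc m) / (fact (Suc m) * fact (Suc m))"
        unfolding B_def using binomial_fact[of "Suc m" "2 * Suc m", where 'a = real] by (simp only:)
      then show ?thesis by (simp del: fact_Suc)
    qed
    have "2 / s ^ 3 * (s ^ (2 * Suc m + 1) /\<^sub>R fact (2 * Suc m + 1)) = 2 * s ^ (2 * m) / fact (2 * Suc m + 1)"
      using s by (simp add: power3_eq_cube power_add field_simps)
    also have "\<dots> = 2 * s ^ (2 * m) / ((2 * real (Suc m) + 1) * B * (fact (Suc m) * fact (Suc m)))"
      unfolding Suc_eq_plus1[symmetric] fact_Suc[of "2 * Suc m"] f by (simp add: mult_ac)
    also have "\<dots> \<le> 2 * s ^ (2 * m) / (4 ^ Suc m * (fact (Suc m) * fact (Suc m)))"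
      using four_power_le_central_binomial[of "Suc m"] unfolding B_def
      by (intro divide_left_mono mult_right_mono mult_pos_pos) (use s in \<open>auto simp: zero_less_binomial_iff simp del: binomial_Suc_Suc\<close>)
    also have "\<dots> \<le> (s\<^sup>2 / 4) ^ m / (fact m * fact (m + 2))"
    proof -
      have e: "fact (m + 2) * fact m * (real m + 1) = fact (Suc m) * fact (Suc m) * (real m + (2::real))"
        by (simp add: algebra_simps)
      have "fact m * fact (m + 2) * ((real m + 1)) \<le> fact (Suc m) * fact (Suc m) * (2 * (real m + 1))"
        using e by (simp add: mult.commute mult_left_mono)
      then have "fact m * fact (m + 2) * ((real m + 1)) \<le> (2 * fact (Suc m) * fact (Suc m)) * (real m + 1)"
        by (simp add: mult_ac)
      then have "fact m * fact (m + 2) \<le> 2 * fact (Suc m) * (fact (Suc m) :: real)"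
        by (rule mult_right_le_imp_le) simp
      then have "s ^ (2 * m) / 4 ^ m * (1 / (2 * fact (Suc m) * fact (Suc m))) \<le> s ^ (2 * m) / 4 ^ m * (1 / (fact m * fact (m + 2)))"
        using s by (intro mult_left_mono divide_left_mono) (auto simp del: fact_Suc)
      then show ?thesis by (simp add: power_divide power_mult[symmetric] mult_ac del: fact_Suc)
    qed
    finally show ?thesis .
  qed
  from sums_le[OF this 1 bes_sums] show ?thesis .
qed

section \<open>The Riccati equation for the reciprocal logarithmic derivative\<close>

definition besv :: "real \<Rightarrow> real" where "besv t = bes 2 t / bes 3 t"
definition besv' :: "real \<Rightarrow> real" where "besv' t = 1 - bes 2 t * bes 4 t / (bes 3 t)\<^sup>2"

lemma besv_deriv: "t \<ge> 0 \<Longrightarrow> (besv has_field_derivative besv' t) (at t)"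
  unfolding besv_def besv'_def
  using bes_deriv[of 2 t] bes_deriv[of 3 t] bes_pos[of t 3]
  by (auto intro!: derivative_eq_intros simp: eval_nat_numeral field_simps)

lemma besv_ode: "t \<ge> 0 \<Longrightarrow> t * besv' t = t + 3 * besv t - (besv t)\<^sup>2"
proof -
  assume t: "t \<ge> 0"
  have r: "bes 2 t = 3 * bes 3 t + t * bes 4 t" using bes_recurrence[of 2 t] by (simp add: eval_nat_numeral)
  have p: "bes 3 t > 0" using bes_pos[OF t] .
  have "t * bes 4 t = bes 2 t - 3 * bes 3 t" using r by simp
  then have "t * (bes 2 t * bes 4 t / (bes 3 t)\<^sup>2) = bes 2 t * (bes 2 t - 3 * bes 3 t) / (bes 3 t)\<^sup>2"
    by (simp add: mult.left_commute)
  also have "\<dots> = (besv t)\<^sup>2 - 3 * besv t"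
    using p by (simp add: besv_def power2_eq_square field_simps)
  finally show ?thesis by (simp add: besv'_def right_diff_distrib)
qed

text \<open>The Riccati equation t v' = t + 3 v - v^2, differentiated once and solved for
  v''.\<close>

definition besv'' :: "real \<Rightarrow> real" where "besv'' t = (1 - (2 * besv t - 2) * besv' t) / t"

lemma besv'_deriv: 
  assumes t: "t > 0"
  shows "(besv' has_field_derivative besv'' t) (at t)"
proof -
  have "((\<lambda>t. (t + 3 * besv t - (besv t)\<^sup>2) / t) has_field_derivative besv'' t) (at t)"
  proof -
    have e: "(besv t)\<^sup>2 = t + 3 * besv t - t * besv' t" using besv_ode[of t] t by linarith
    have "((\<lambda>t. (t + 3 * besv t - (besv t)\<^sup>2) / t) has_field_derivative
        ((1 + 3 * besv' t - 2 * besv t * besv' t) * t - (t + 3 * besv t - (besv t)\<^sup>2)) / (t * t)) (at t)"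
      using besv_deriv[of t] t by (auto intro!: derivative_eq_intros)
    also have "((1 + 3 * besv' t - 2 * besv t * besv' t) * t - (t + 3 * besv t - (besv t)\<^sup>2)) / (t * t) = besv'' t"
      unfolding e besv''_def using t by (simp add: field_simps)
    finally show ?thesis .
  qed
  moreover have "\<forall>\<^sub>F x in nhds t. besv' x = (x + 3 * besv x - (besv x)\<^sup>2) / x"
    using eventually_nhds_in_open[of "{0<..}" t] t
    by (auto elim!: eventually_mono simp: besv_ode[symmetric])
  ultimately show ?thesis by (subst DERIV_cong_ev[OF refl _ refl]) auto
qed

lemma besv_ge_3: 
  assumes "t \<ge> 0" shows "besv t \<ge> 3"
proof -
  have "bes 2 t = 3 * bes 3 t + t * bes 4 t" using bes_recurrence[of 2 t] by (simp add: eval_nat_numeral)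
  then show ?thesis using bes_pos[OF assms, of 3] bes_pos[OF assms, of 4] assms by (simp add: besv_def field_simps)
qed

text \<open>
  By the formula for besv'' this is the concavity of besv. The difference p of the two sides vanishes at 0
  and satisfies p' = 2 v'^2 - (2 v - 2) p / t, so p' > 0 wherever p < 0; hence p has no negative minimum.
\<close>
lemma besv'_lower:
  assumes t: "t > 0"
  shows "(2 * besv t - 2) * besv' t \<ge> 1"
proof (rule ccontr)
  define p where "p t = (2 * besv t - 2) * besv' t - 1" for t
  assume "\<not> ?thesis"
  then have neg: "p t < 0" unfolding p_def by linarith
  have cont: "continuous_on {0..t} p"
  proof -
    have "continuous_on {0..t} (bes j)" for j
      by (intro DERIV_continuous_on[where D = "bes (Suc j)"]) (auto intro: has_field_derivative_at_within bes_deriv)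
    moreover have "bes 3 x \<noteq> 0" if "x \<in> {0..t}" for x using bes_pos[of x 3] that by auto
    ultimately show ?thesis unfolding p_def besv_def besv'_def by (intro continuous_intros) auto
  qed
  then obtain s where s: "s \<in> {0..t}" "\<And>u. u \<in> {0..t} \<Longrightarrow> p s \<le> p u"
    using continuous_attains_inf[of "{0..t}" p] t by auto
  have ps: "p s < 0" using s(2)[of t] t neg by auto
  have p0: "p 0 = 0"
  proof -
    have "bes j 0 = 1 / fact j" for j
      unfolding bes_def by (subst suminf_finite[of "{0}"]) auto
    then show ?thesis by (simp add: p_def besv_def besv'_def fact_numeral power2_eq_square)
  qed
  then have s0: "s > 0" using ps s(1) by (cases "s = 0") auto
  have d: "(p has_field_derivative (2 * besv' s * besv' s + (2 * besv s - 2) * besv'' s)) (at s)"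
    unfolding p_def using besv_deriv[of s] besv'_deriv[OF s0] s0 by (auto intro!: derivative_eq_intros)
  have "besv'' s = - p s / s" by (simp add: besv''_def p_def)
  then have "besv'' s > 0" using ps s0 by (simp add: divide_less_0_iff)
  then have "0 < 2 * besv' s * besv' s + (2 * besv s - 2) * besv'' s"
    using besv_ge_3[of s] s0 by (intro add_nonneg_pos mult_pos_pos) (auto simp: mult.assoc)
  from DERIV_pos_inc_left[OF d this] obtain e where e: "e > 0" "\<And>h. h > 0 \<Longrightarrow> h < e \<Longrightarrow> p (s - h) < p s"
    by blast
  \<comment> \<open>The minimum with s keeps s - h inside {0..t}, where p s is the least
    value.\<close>
  define h where "h = min (e / 2) s"
  have "p (s - h) < p s" using e s0 by (intro e(2)) (auto simp: h_def)
  moreover have "p s \<le> p (s - h)" using s e(1) s0 by (intro s(2)) (auto simp: h_def)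
  ultimately show False by simp
qed

text \<open>Since v' > 0, the Riccati equation gives v^2 - 3 v <= t; completing the square yields
  the bound.\<close>

lemma besv_upper:
  assumes t: "t > 0"
  shows "besv t \<le> 3 / 2 + sqrt (t + 9 / 4)"
proof -
  have "besv' t > 0"
  proof -
    have "(2 * besv t - 2) * besv' t > 0" using besv'_lower[OF t] by linarith
    then show ?thesis using besv_ge_3[of t] t by (simp add: zero_less_mult_iff)
  qed
  then have "t * besv' t \<ge> 0" using t by simp
  then have "(besv t - 3 / 2)\<^sup>2 \<le> t + 9 / 4"
    using besv_ode[of t] t by (simp add: power2_eq_square algebra_simps)
  then have "besv t - 3 / 2 \<le> sqrt (t + 9 / 4)" by (simp add: real_le_rsqrt)
  then show ?thesis by simp
qed

section \<open>Third derivative and third difference of ln (bes 2)\<close>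

lemma ln_bes_derivs:
  assumes t: "t > 0"
  shows "((\<lambda>t. ln (bes 2 t)) has_field_derivative 1 / besv t) (at t)"
    and "((\<lambda>t. 1 / besv t) has_field_derivative - besv' t / (besv t)\<^sup>2) (at t)"
    and "((\<lambda>t. - besv' t / (besv t)\<^sup>2) has_field_derivative (2 * (besv' t)\<^sup>2 - besv t * besv'' t) / besv t ^ 3) (at t)"
proof -
  show "((\<lambda>t. ln (bes 2 t)) has_field_derivative 1 / besv t) (at t)"
    using bes_deriv[of 2 t] bes_pos[of t 2] t by (auto intro!: derivative_eq_intros simp: besv_def eval_nat_numeral)
  have v: "besv t > 0" using besv_ge_3[of t] t by simp
  show "((\<lambda>t. 1 / besv t) has_field_derivative - besv' t / (besv t)\<^sup>2) (at t)"
    using besv_deriv[of t] t v by (auto intro!: derivative_eq_intros simp: power2_eq_square)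
  show "((\<lambda>t. - besv' t / (besv t)\<^sup>2) has_field_derivative (2 * (besv' t)\<^sup>2 - besv t * besv'' t) / besv t ^ 3) (at t)"
    using besv_deriv[of t] besv'_deriv[OF t] t v
    by (auto intro!: derivative_eq_intros simp: power2_eq_square power3_eq_cube field_simps)
qed

text \<open>Concavity makes - v v'' nonnegative, and v' >= 1 / (2 v - 2) >= 1 / (2 v) leaves 1 / (2
  v^5), which is of order t^(-5/2) by \<open>besv_upper\<close>.\<close>

lemma third_deriv_lower:
  assumes t: "t > 0"
  shows "(2 * (besv' t)\<^sup>2 - besv t * besv'' t) / besv t ^ 3 \<ge> 1 / (2 * (3 / 2 + sqrt (t + 9 / 4)) ^ 5)"
proof -
  define v where "v = besv t"
  have v: "v \<ge> 3" using besv_ge_3[of t] t by (simp add: v_def)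
  have w: "(2 * v - 2) * besv' t \<ge> 1" using besv'_lower[OF t] by (simp add: v_def)
  have "besv'' t \<le> 0" using w t by (simp add: besv''_def v_def divide_le_0_iff)
  then have 1: "v * besv'' t \<le> 0" using v by (simp add: mult_le_0_iff)
  have w': "besv' t \<ge> 1 / (2 * v - 2)" using w v by (simp add: field_simps)
  moreover have "1 / (2 * v - 2) \<ge> 1 / (2 * v)" using v by (intro divide_left_mono) auto
  ultimately have "besv' t \<ge> 1 / (2 * v)" by linarith
  then have "(besv' t)\<^sup>2 \<ge> (1 / (2 * v))\<^sup>2" using v by (intro power_mono) auto
  then have "2 * (besv' t)\<^sup>2 - v * besv'' t \<ge> 2 * (1 / (2 * v))\<^sup>2" using 1 by linarith
  then have "(2 * (besv' t)\<^sup>2 - v * besv'' t) / v ^ 3 \<ge> 2 * (1 / (2 * v))\<^sup>2 / v ^ 3"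
    using v by (intro divide_right_mono) auto
  moreover have "2 * (1 / (2 * v))\<^sup>2 / v ^ 3 = 1 / (2 * v ^ 5)" using v by (simp add: field_simps eval_nat_numeral)
  moreover have "1 / (2 * v ^ 5) \<ge> 1 / (2 * (3 / 2 + sqrt (t + 9 / 4)) ^ 5)"
    using v besv_upper[OF t] unfolding v_def by (intro divide_left_mono mult_left_mono power_mono) auto
  ultimately show ?thesis by (simp add: v_def)
qed

text \<open>One mean value theorem for each of the three differences; the final intermediate point
  stays in the interval of length 3.\<close>

lemma third_difference_ge:
  fixes f f1 f2 f3 :: "real \<Rightarrow> real"
  assumes d1: "\<And>x. a \<le> x \<Longrightarrow> x \<le> a + 3 \<Longrightarrow> (f has_field_derivative f1 x) (at x)"
    and d2: "\<And>x. a \<le> x \<Longrightarrow> x \<le> a + 3 \<Longrightarrow> (f1 has_field_derivative f2 x) (at x)"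
    and d3: "\<And>x. a \<le> x \<Longrightarrow> x \<le> a + 3 \<Longrightarrow> (f2 has_field_derivative f3 x) (at x)"
    and lb: "\<And>x. a \<le> x \<Longrightarrow> x \<le> a + 3 \<Longrightarrow> f3 x \<ge> c"
  shows "f (a + 3) - 3 * f (a + 2) + 3 * f (a + 1) - f a \<ge> c"
proof -
  define g where "g x = f (x + 2) - 2 * f (x + 1) + f x" for x
  have "\<exists>z>a. z < a + 1 \<and> g (a + 1) - g a = (a + 1 - a) * (f1 (z + 2) - 2 * f1 (z + 1) + f1 z)"
    unfolding g_def
    by (rule MVT2) (auto intro!: derivative_eq_intros DERIV_chain2[OF d1] d1)
  then obtain z where z: "a < z" "z < a + 1" "g (a + 1) - g a = f1 (z + 2) - 2 * f1 (z + 1) + f1 z" by auto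
  have "\<exists>y>z. y < z + 1 \<and> (f1 (z + 1 + 1) - f1 (z + 1)) - (f1 (z + 1) - f1 z) = (z + 1 - z) * (f2 (y + 1) - f2 y)"
    by (rule MVT2[of z "z + 1" "\<lambda>z. f1 (z + 1) - f1 z"]) (use z in \<open>auto intro!: derivative_eq_intros DERIV_chain2[OF d2] d2\<close>)
  then obtain y where y: "z < y" "y < z + 1" "f1 (z + 2) - 2 * f1 (z + 1) + f1 z = f2 (y + 1) - f2 y" 
    by (auto simp: add.assoc)
  have "\<exists>x>y. x < y + 1 \<and> f2 (y + 1) - f2 y = (y + 1 - y) * f3 x"
    by (rule MVT2) (use z y in \<open>auto intro!: d3\<close>)
  then obtain x where x: "y < x" "x < y + 1" "f2 (y + 1) - f2 y = f3 x" by auto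
  have "f (a + 3) - 3 * f (a + 2) + 3 * f (a + 1) - f a = g (a + 1) - g a"
    by (simp add: g_def add.assoc)
  also have "\<dots> = f3 x" using z y x by simp
  finally show ?thesis using lb[of x] x y z by simp
qed

theorem ln_bes_third_difference:
  assumes A: "A > 0" and \<nu>: "\<nu> > 0"
  shows "ln (bes 2 (A * (\<nu> + 3))) - 3 * ln (bes 2 (A * (\<nu> + 2))) + 3 * ln (bes 2 (A * (\<nu> + 1))) - ln (bes 2 (A * \<nu>))
    \<ge> A ^ 3 / (2 * (3 / 2 + sqrt (A * (\<nu> + 3) + 9 / 4)) ^ 5)"
proof (rule third_difference_ge[of \<nu> "\<lambda>x. ln (bes 2 (A * x))" "\<lambda>x. A * (1 / besv (A * x))" "\<lambda>x. A\<^sup>2 * (- besv' (A * x) / (besv (A * x))\<^sup>2)"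
    "\<lambda>x. A ^ 3 * ((2 * (besv' (A * x))\<^sup>2 - besv (A * x) * besv'' (A * x)) / besv (A * x) ^ 3)"])
  fix x assume x: "\<nu> \<le> x" "x \<le> \<nu> + 3"
  have t: "A * x > 0" using A \<nu> x by simp
  have m: "((\<lambda>x. A * x) has_field_derivative A) (at x)" by (auto intro!: derivative_eq_intros)
  show "((\<lambda>x. ln (bes 2 (A * x))) has_field_derivative A * (1 / besv (A * x))) (at x)"
    using DERIV_chain2[OF ln_bes_derivs(1)[OF t] m] by (simp add: mult.commute)
  show "((\<lambda>x. A * (1 / besv (A * x))) has_field_derivative A\<^sup>2 * (- besv' (A * x) / (besv (A * x))\<^sup>2)) (at x)"
    using DERIV_cmult[OF DERIV_chain2[OF ln_bes_derivs(2)[OF t] m], of A] by (simp add: power2_eq_square mult_ac)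
  show "((\<lambda>x. A\<^sup>2 * (- besv' (A * x) / (besv (A * x))\<^sup>2)) has_field_derivative A ^ 3 * ((2 * (besv' (A * x))\<^sup>2 - besv (A * x) * besv'' (A * x)) / besv (A * x) ^ 3)) (at x)"
    using DERIV_cmult[OF DERIV_chain2[OF ln_bes_derivs(3)[OF t] m], of "A\<^sup>2"] by (simp add: power2_eq_square power3_eq_cube mult_ac)
  \<comment> \<open>The lower bound decreases in t, so its value at the right end holds on the whole
    interval. The factor A^3 comes from the chain rule.\<close>
  have "1 / (2 * (3 / 2 + sqrt (A * (\<nu> + 3) + 9 / 4)) ^ 5) \<le> 1 / (2 * (3 / 2 + sqrt (A * x + 9 / 4)) ^ 5)"
    using t mult_left_mono[OF x(2), of A] A \<nu> by (intro divide_left_mono mult_left_mono power_mono mult_pos_pos zero_less_power) (auto intro!: add_pos_nonneg add_nonneg_nonneg mult_nonneg_nonneg simp del: distrib_left_numeral)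
  also have "\<dots> \<le> (2 * (besv' (A * x))\<^sup>2 - besv (A * x) * besv'' (A * x)) / besv (A * x) ^ 3"
    by (rule third_deriv_lower[OF t])
  finally have "A ^ 3 * (1 / (2 * (3 / 2 + sqrt (A * (\<nu> + 3) + 9 / 4)) ^ 5)) \<le> A ^ 3 * ((2 * (besv' (A * x))\<^sup>2 - besv (A * x) * besv'' (A * x)) / besv (A * x) ^ 3)"
    using A by (intro mult_left_mono) auto
  then show "A ^ 3 / (2 * (3 / 2 + sqrt (A * (\<nu> + 3) + 9 / 4)) ^ 5) \<le> A ^ 3 * ((2 * (besv' (A * x))\<^sup>2 - besv (A * x) * besv'' (A * x)) / besv (A * x) ^ 3)"
    by simp
qed

section \<open>The generating function and its coefficients\<close>

text \<open>The embedding of real into complex power series: \<open>Delta\<close> is defined over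
  the reals, but the Taylor coefficients to be compared with it belong to holomorphic
  functions.\<close>

definition cfps :: "real fps \<Rightarrow> complex fps" where
  "cfps f = Abs_fps (\<lambda>n. of_real (fps_nth f n))"

lemma cfps_nth [simp]: "fps_nth (cfps f) n = of_real (fps_nth f n)"
  by (simp add: cfps_def)

lemma cfps_hom: "cfps (f * g) = cfps f * cfps g" "cfps (f - g) = cfps f - cfps g" "cfps 1 = 1" "cfps fps_X = fps_X"
  by (auto simp: fps_eq_iff fps_mult_nth fps_X_def)

lemma cfps_power: "cfps (f ^ n) = cfps f ^ n"
  by (induction n) (auto simp: cfps_hom)

lemma cfps_prod: "cfps (\<Prod>i\<in>A. f i) = (\<Prod>i\<in>A. cfps (f i))"
  by (induction A rule: infinite_finite_induct) (auto simp: cfps_hom)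

definition diamond_factor :: "nat \<Rightarrow> nat \<Rightarrow> complex \<Rightarrow> complex" where
  "diamond_factor k n q = ((1 - q ^ (2 * n)) * (1 - q ^ ((2 * k + 1) * n))) / ((1 - q ^ n) ^ 3 * (1 - q ^ ((4 * k + 2) * n)))"

lemma diamond_factor_expansion:
  assumes "n > 0"
  shows "diamond_factor k n has_fps_expansion cfps (broken_diamond_factor k n)"
proof -
  define N D :: "real fps" where
    "N = (1 - fps_X ^ (2 * n)) * (1 - fps_X ^ ((2 * k + 1) * n))" and
    "D = (1 - fps_X ^ n) ^ 3 * (1 - fps_X ^ ((4 * k + 2) * n))"
  have D0: "fps_nth D 0 = 1"
    using assms by (simp add: D_def fps_mult_nth_0 fps_nth_power_0 power_0_left)
  then have "broken_diamond_factor k n * D = N"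
    unfolding broken_diamond_factor_def N_def[symmetric] D_def[symmetric]
    by (simp add: fps_divide_unit mult.assoc inverse_mult_eq_1)
  then have "cfps (broken_diamond_factor k n) * cfps D = cfps N"
    by (metis cfps_hom(1))
  moreover have cD0: "fps_nth (cfps D) 0 \<noteq> 0" using D0 by simp
  ultimately have eq: "cfps (broken_diamond_factor k n) = cfps N / cfps D"
    by (simp add: fps_divide_unit mult.assoc) (metis inverse_mult_eq_1' mult.assoc mult.right_neutral cD0)
  have cN: "cfps N = (1 - fps_X ^ (2 * n)) * (1 - fps_X ^ ((2 * k + 1) * n))"
    and cD: "cfps D = (1 - fps_X ^ n) ^ 3 * (1 - fps_X ^ ((4 * k + 2) * n))"
    by (simp_all only: N_def D_def cfps_hom cfps_power)
  show ?thesis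
    unfolding eq diamond_factor_def[abs_def] using cD0 unfolding cN cD
    by (intro has_fps_expansion_divide' fps_expansion_intros) auto
qed

lemma Delta_eventually:
  "eventually (\<lambda>N. fps_nth (\<Prod>i<N. broken_diamond_factor k (i + 1)) n = Delta k n) sequentially"
proof -
  have "(\<lambda>N. \<Prod>i<N. broken_diamond_factor k (i + 1)) \<longlonglongrightarrow> broken_diamond_gf k"
    by (rule has_prod_imp_tendsto'[OF broken_diamond_has_prod])
  then show ?thesis unfolding tendsto_fps_iff Delta_def by blast
qed

text \<open>A holomorphic logarithm of the generating function on the unit disc; each Euler product
  in it contributes one \<open>Lam\<close>, with its multiplicity.\<close>

definition logF :: "nat \<Rightarrow> complex \<Rightarrow> complex" where
  "logF k q = 3 * Lam q - Lam (q ^ 2) - Lam (q ^ (2 * k + 1)) + Lam (q ^ (4 * k + 2))"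

definition Fgf :: "nat \<Rightarrow> complex \<Rightarrow> complex" where
  "Fgf k q = exp (logF k q)"

definition Lam_part :: "nat \<Rightarrow> complex \<Rightarrow> complex" where
  "Lam_part N q = (\<Sum>n<N. - Ln (1 - q ^ Suc n))"

lemma norm_power_le_self:
  assumes "norm (q::complex) < 1" "d > 0"
  shows "norm (q ^ d) \<le> norm q"
proof -
  have "norm q ^ d \<le> norm q ^ 1" using assms by (intro power_decreasing) auto
  then show ?thesis by (simp add: norm_power)
qed

lemma logF_holomorphic: "logF k holomorphic_on ball 0 1"
proof -
  have "(\<lambda>q. Lam (q ^ d)) holomorphic_on ball 0 1" if "d > 0" for d
    by (rule holomorphic_on_compose_gen[OF _ Lam_holomorphic, unfolded o_def])
       (use norm_power_le_self[OF _ that] in \<open>force intro!: holomorphic_intros\<close>)+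
  from this[of 2] this[of "2 * k + 1"] this[of "4 * k + 2"]
  show ?thesis unfolding logF_def by (intro holomorphic_on_add holomorphic_on_diff holomorphic_on_mult holomorphic_on_const Lam_holomorphic) simp_all
qed

lemma Fgf_holomorphic: "Fgf k holomorphic_on ball 0 1"
  unfolding Fgf_def by (intro holomorphic_intros logF_holomorphic)

lemma exp_Lam_part:
  assumes "norm q < 1"
  shows "exp (Lam_part N q) = inverse (\<Prod>i<N. 1 - q ^ Suc i)"
proof -
  have "1 - q ^ Suc n \<noteq> 0" for n
  proof
    assume "1 - q ^ Suc n = 0"
    then have "norm (q ^ Suc n) = 1" by simp
    moreover have "norm (q ^ Suc n) \<le> norm q" by (rule norm_power_le_self) (use assms in auto)
    ultimately show False using assms by simp
  qed
  then show ?thesis unfolding Lam_part_def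
    by (simp add: exp_sum exp_minus prod_inversef[symmetric] o_def del: power_Suc)
qed

lemma Fgf_partial:
  assumes q: "norm q < 1"
  shows "(\<Prod>i<N. diamond_factor k (i + 1) q) = 
    exp (3 * Lam_part N q - Lam_part N (q ^ 2) - Lam_part N (q ^ (2 * k + 1)) + Lam_part N (q ^ (4 * k + 2)))"
proof -
  have *: "exp (Lam_part N (q ^ d)) = inverse (\<Prod>i<N. 1 - q ^ (d * Suc i))" if "d > 0" for d
    using norm_power_le_self[OF q that] q unfolding power_mult by (intro exp_Lam_part) auto
  have t: "exp (3 * Lam_part N q) = inverse (\<Prod>i<N. 1 - q ^ Suc i) ^ 3"
    using exp_Lam_part[OF q, of N] by (simp add: exp_of_nat_mult[of 3, simplified])
  define P where "P d = (\<Prod>i<N. 1 - q ^ (d * (i + 1)))" for d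
  have l: "(\<Prod>i<N. diamond_factor k (i + 1) q) = (P 2 * P (2 * k + 1)) / (P 1 ^ 3 * P (4 * k + 2))"
    unfolding diamond_factor_def P_def by (simp only: prod_dividef prod.distrib prod_power_distrib mult_1)
  have e: "exp (Lam_part N (q ^ d)) = inverse (P d)" if "d > 0" for d
    using *[OF that] unfolding P_def Suc_eq_plus1 .
  have t': "exp (3 * Lam_part N q) = inverse (P 1) ^ 3"
    using t unfolding P_def Suc_eq_plus1 mult_1 .
  have pos: "(2::nat) > 0" "2 * k + 1 > 0" "4 * k + 2 > 0" by simp_all
  show ?thesis
    unfolding exp_add exp_diff t' l e[OF pos(1)] e[OF pos(2)] e[OF pos(3)]
    by (simp only: divide_inverse inverse_inverse_eq inverse_mult_distrib power_inverse mult_ac)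
qed

text \<open>The link between the formal and the analytic product. The partial products converge to
  \<open>Fgf\<close> uniformly near 0, so their Taylor coefficients converge; by
  \<open>Delta_eventually\<close> the same coefficients are eventually constant.\<close>

lemma Delta_deriv: "of_real (Delta k n) = (deriv ^^ n) (Fgf k) 0 / fact n"
proof -
  define P where "P N q = (\<Prod>i<N. diamond_factor k (i + 1) q)" for N q
  have ul0: "uniform_limit (cball 0 (1/2)) (\<lambda>N q. Lam_part N q) Lam sequentially"
    unfolding Lam_part_def by (rule Lam_uniform_limit) auto
  have uld: "uniform_limit (cball 0 (1/2)) (\<lambda>N q. Lam_part N (q ^ d)) (\<lambda>q. Lam (q ^ d)) sequentially" if "d > 0" for d
  proof (rule uniform_limit_compose'[OF ul0])
    show "(\<lambda>q. q ^ d) \<in> cball 0 (1/2) \<rightarrow> cball (0::complex) (1/2)"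
    proof
      fix q :: complex assume "q \<in> cball 0 (1/2)"
      then show "q ^ d \<in> cball 0 (1/2)" using norm_power_le_self[OF _ that, of q] by auto
    qed
  qed
  define g where "g N q = 3 * Lam_part N q - Lam_part N (q ^ 2) - Lam_part N (q ^ (2 * k + 1)) + Lam_part N (q ^ (4 * k + 2))" for N q
  have ulg: "uniform_limit (cball 0 (1/2)) g (logF k) sequentially"
    unfolding g_def logF_def by (intro uniform_limit_intros ul0 uld) auto
  have bl: "norm (Lam_part N q) \<le> 2" if "q \<in> cball 0 (1/2)" for N q
  proof -
    have "norm (Lam_part N q) \<le> (\<Sum>n<N. (1/2) ^ Suc n / (1 - 1/2))"
      unfolding Lam_part_def by (rule sum_norm_le) (rule norm_Ln_power_bound, use that in auto)
    also have "\<dots> \<le> (\<Sum>n. (1/2) ^ Suc n / (1 - 1/2::real))"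
      by (intro sum_le_suminf summable_power_bound) auto
    also have "\<dots> = 2" using summable_power_bound(2)[of "1/2"] by (simp add: power2_eq_square)
    finally show ?thesis .
  qed
  have bd: "norm (Lam_part N (q ^ d)) \<le> 2" if "q \<in> cball 0 (1/2)" "d > 0" for N q d
    using norm_power_le_self[OF _ that(2), of q] that by (intro bl) auto
  have bg: "norm (g N q) \<le> 12" if "q \<in> cball 0 (1/2)" for N q
  proof -
    have "norm (g N q) \<le> norm (3 * Lam_part N q) + norm (Lam_part N (q ^ 2)) + norm (Lam_part N (q ^ (2 * k + 1))) + norm (Lam_part N (q ^ (4 * k + 2)))"
      unfolding g_def by norm
    also have "\<dots> \<le> 6 + 2 + 2 + 2"
    proof (intro add_mono)
      show "norm (3 * Lam_part N q) \<le> 6" using bl[OF that, of N] by (simp add: norm_mult)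
    qed (rule bd[OF that], simp)+
    finally show ?thesis by simp
  qed
  have eqP: "exp (g N q) = P N q" if "q \<in> ball 0 (1/2)" for N q
    unfolding P_def g_def by (rule Fgf_partial[symmetric]) (use that in auto)
  have "uniform_limit (cball 0 (1/2)) (\<lambda>N q. exp (g N q)) (\<lambda>q. exp (logF k q)) sequentially"
  proof (rule uniform_limit_compose_uniformly_continuous_on[OF ulg, of "cball 0 12"])
    show "uniformly_continuous_on (cball 0 12) (exp :: complex \<Rightarrow> complex)"
      by (intro compact_uniformly_continuous continuous_intros) auto
    show "\<forall>\<^sub>F N in sequentially. \<forall>q\<in>cball 0 (1/2). g N q \<in> cball 0 12"
      using bg by (intro always_eventually) (auto simp: dist_norm)
  qed auto
  then have "uniform_limit (ball 0 (1/2)) (\<lambda>N q. exp (g N q)) (Fgf k) sequentially"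
    unfolding Fgf_def[abs_def] by (rule uniform_limit_on_subset) auto
  also have "?this \<longleftrightarrow> uniform_limit (ball 0 (1/2)) P (Fgf k) sequentially"
    by (intro uniform_limit_cong' eqP) auto
  finally have ul: "uniform_limit (ball 0 (1/2)) P (Fgf k) sequentially" .
  have holP: "P N holomorphic_on ball 0 (1/2)" for N
  proof -
    have "(\<lambda>q. exp (g N q)) holomorphic_on ball 0 (1/2)"
    proof -
      have "Lam_part N holomorphic_on ball 0 1"
        unfolding Lam_part_def by (intro holomorphic_on_sum holomorphic_Ln_power)
      then have "(\<lambda>q. Lam_part N (q ^ d)) holomorphic_on ball 0 1" if "d > 0" for d
        by (rule holomorphic_on_compose_gen[unfolded o_def, rotated])
           (use norm_power_le_self[OF _ that] in \<open>force intro!: holomorphic_intros\<close>)+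
      from this[of 1] this[of 2] this[of "2 * k + 1"] this[of "4 * k + 2"]
      have "(\<lambda>q. exp (g N q)) holomorphic_on ball 0 1" unfolding g_def by (intro holomorphic_intros) auto
      then show ?thesis by (rule holomorphic_on_subset) auto
    qed
    then show ?thesis by (rule holomorphic_transform) (rule eqP)
  qed
  have "(\<lambda>N. (deriv ^^ n) (P N) 0) \<longlonglongrightarrow> (deriv ^^ n) (Fgf k) 0"
    by (rule higher_deriv_complex_uniform_limit[OF ul]) (use holP in auto)
  then have "(\<lambda>N. (deriv ^^ n) (P N) 0 / fact n) \<longlonglongrightarrow> (deriv ^^ n) (Fgf k) 0 / fact n"
    by (intro tendsto_intros) auto
  moreover have "(deriv ^^ n) (P N) 0 / fact n = of_real (fps_nth (\<Prod>i<N. broken_diamond_factor k (i + 1)) n)" for N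
  proof -
    have "P N has_fps_expansion cfps (\<Prod>i<N. broken_diamond_factor k (i + 1))"
      unfolding P_def[abs_def] cfps_prod by (intro has_fps_expansion_prod diamond_factor_expansion) auto
    from fps_nth_fps_expansion[OF this, of n] show ?thesis by simp
  qed
  ultimately have 1: "(\<lambda>N. of_real (fps_nth (\<Prod>i<N. broken_diamond_factor k (i + 1)) n)) \<longlonglongrightarrow> (deriv ^^ n) (Fgf k) 0 / fact n"
    by simp
  have "(\<lambda>N. of_real (fps_nth (\<Prod>i<N. broken_diamond_factor k (i + 1)) n) :: complex) \<longlonglongrightarrow> of_real (Delta k n)"
    by (rule tendsto_eventually) (use Delta_eventually[of k n] in \<open>auto elim!: eventually_mono\<close>)
  with 1 show ?thesis using LIMSEQ_unique by blast
qed

text \<open>Cauchy's formula on |q| = exp (- x), with q = exp (- z) as substitution.\<close>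

theorem Delta_integral:
  assumes x: "x > 0"
  shows "((\<lambda>z. Fgf k (exp (- z)) * exp (of_nat n * z)) has_contour_integral (2 * pi * \<i> * of_real (Delta k n)))
    (linepath (Complex x (- pi)) (Complex x pi))"
proof -
  define r where "r = exp (- x)"
  have r: "0 < r" "r < 1" using x by (auto simp: r_def)
  \<comment> \<open>\<open>circlepath\<close> starts at the positive real point, but the circle has
    to be cut at the opposite one, so that the dominant point z = x lies in the middle of the
    segment. Replacing q by - v rotates the circle by half a turn.\<close>
  define g where "g v = Fgf k (- v)" for v
  have holg: "g holomorphic_on ball 0 1"
    unfolding g_def by (rule holomorphic_on_compose_gen[OF _ Fgf_holomorphic, unfolded o_def]) (auto intro!: holomorphic_intros)
  have dg: "(deriv ^^ n) g 0 = (- 1) ^ n * (deriv ^^ n) (Fgf k) 0"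
  proof -
    have "(deriv ^^ n) (\<lambda>w. Fgf k (- 1 * w)) 0 = (- 1) ^ n * (deriv ^^ n) (Fgf k) (- 1 * 0)"
      by (rule higher_deriv_compose_linear[OF Fgf_holomorphic, where S = "ball 0 1"]) auto
    then show ?thesis by (simp add: g_def[abs_def])
  qed
  have "((\<lambda>u. g u / (u - 0) ^ Suc n) has_contour_integral ((2 * pi * \<i>) / fact n * (deriv ^^ n) g 0)) (circlepath 0 r)"
  proof (rule Cauchy_has_contour_integral_higher_derivative_circlepath)
    have "cball 0 r \<subseteq> ball (0::complex) 1" using r by auto
    then show "continuous_on (cball 0 r) g"
      using holg holomorphic_on_imp_continuous_on continuous_on_subset by blast
    show "g holomorphic_on ball 0 r" by (rule holomorphic_on_subset[OF holg]) (use r in auto)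
  qed (use r in auto)
  then have "((\<lambda>t. g (circlepath 0 r t) / circlepath 0 r t ^ Suc n * vector_derivative (circlepath 0 r) (at t within {0..1})) has_integral
      (2 * pi * \<i> * ((- 1) ^ n * of_real (Delta k n)))) {0..1}"
    by (simp add: has_contour_integral_def dg Delta_deriv)
  from has_integral_mult_right[OF this, of "(- 1) ^ n"]
  have I: "((\<lambda>t. (- 1) ^ n * (g (circlepath 0 r t) / circlepath 0 r t ^ Suc n * vector_derivative (circlepath 0 r) (at t within {0..1}))) has_integral
      (2 * pi * \<i> * of_real (Delta k n))) {0..1}"
    by (simp add: mult_ac power_mult_distrib[symmetric])
  define G where "G z = Fgf k (exp (- z)) * exp (of_nat n * z)" for z
  define a b where "a = Complex x pi" and "b = Complex x (- pi)"
  have "((\<lambda>t. - (G (linepath a b t) * (b - a))) has_integral (2 * pi * \<i> * of_real (Delta k n))) {0..1}"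
  proof (rule has_integral_eq[OF _ I])
    fix t :: real assume t: "t \<in> {0..1}"
    define v where "v = circlepath 0 r t"
    have v: "v = of_real r * exp (2 * of_real pi * \<i> * of_real t)" by (simp add: v_def circlepath)
    have lp: "linepath a b t = of_real x + \<i> * of_real pi - 2 * of_real pi * \<i> * of_real t"
      by (simp add: linepath_def a_def b_def complex_eq_iff algebra_simps)
    have e: "exp (- linepath a b t) = - v"
    proof -
      have "- linepath a b t = of_real (- x) + 2 * of_real pi * \<i> * of_real t - \<i> * of_real pi" by (simp add: lp)
      then have "exp (- linepath a b t) = exp (of_real (- x)) * exp (2 * of_real pi * \<i> * of_real t) / exp (\<i> * of_real pi)"
        by (simp only: exp_add exp_diff)
      then show ?thesis by (simp add: v r_def exp_of_real[symmetric])
    qed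
    have v0: "v \<noteq> 0" using r by (simp add: v)
    have e2: "exp (of_nat n * linepath a b t) = (- 1) ^ n / v ^ n"
    proof -
      have "exp (of_nat n * linepath a b t) = exp (linepath a b t) ^ n" by (simp add: exp_of_nat_mult)
      also have "exp (linepath a b t) = inverse (- v)" unfolding e[symmetric] by (simp add: exp_minus)
      finally show ?thesis using v0 by (simp add: power_inverse[symmetric] inverse_eq_divide power_divide power_minus')
    qed
    have vd: "vector_derivative (circlepath 0 r) (at t within {0..1}) = 2 * pi * \<i> * v"
      using vector_derivative_circlepath01[of t 0 r] t by (simp add: v)
    have ba: "b - a = - (2 * pi * \<i>)" by (simp add: a_def b_def complex_eq_iff)
    show "(- 1) ^ n * (g (circlepath 0 r t) / circlepath 0 r t ^ Suc n * vector_derivative (circlepath 0 r) (at t within {0..1})) = - (G (linepath a b t) * (b - a))"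
      unfolding vd v_def[symmetric] G_def e e2 ba g_def using v0 by (simp add: field_simps)
  qed
  from has_integral_neg[OF this]
  have "(G has_contour_integral (- (2 * pi * \<i> * of_real (Delta k n)))) (linepath a b)"
    by (simp add: has_contour_integral_linepath)
  from has_contour_integral_reversepath[OF _ this] show ?thesis
    by (simp add: G_def[abs_def] a_def b_def)
qed

section \<open>Transformation of the generating function\<close>

definition Aconst :: "nat \<Rightarrow> real" where
  "Aconst k = pi\<^sup>2 * (5 * real k + 2) / (6 * (2 * real k + 1))"

definition Eerr :: "nat \<Rightarrow> complex \<Rightarrow> complex" where
  "Eerr k z = 3 * Lam (exp (- (4 * of_real (pi\<^sup>2) / z))) - Lam (exp (- (4 * of_real (pi\<^sup>2) / (2 * z))))
     - Lam (exp (- (4 * of_real (pi\<^sup>2) / (of_nat (2 * k + 1) * z)))) + Lam (exp (- (4 * of_real (pi\<^sup>2) / (of_nat (4 * k + 2) * z))))"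

lemma Ln_of_nat_mult:
  assumes "d > 0" "Re z > 0"
  shows "Ln (of_nat d * z / (2 * of_real pi)) = of_real (ln (real d)) + Ln (z / (2 * of_real pi))"
proof -
  have z: "z / (2 * of_real pi) \<noteq> 0" using assms by auto
  have "Ln (of_real (real d) * (z / (2 * of_real pi))) = of_real (ln (real d)) + Ln (z / (2 * of_real pi))"
    using Ln_times_of_real[of "real d" "z / (2 * of_real pi)"] assms z by simp
  then show ?thesis by simp
qed

text \<open>\<open>Lam_transformation\<close> is applied at d z for d = 1, 2, 2 k + 1, 4 k + 2 with
  multiplicities 3, -1, -1, 1. The poles add up to \<open>Aconst\<close>, the linear terms to (k +
  1) / 12, the logarithm of z / (2 pi) receives (3 - 1 - 1 + 1) / 2 = 1, and the constants ln d
  cancel since 2 (2 k + 1) = 4 k + 2.\<close>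

theorem Fgf_transformation:
  assumes z: "Re z > 0"
  shows "Fgf k (exp (- z)) = z / (2 * of_real pi) * exp (of_real (Aconst k) / z - of_nat (k + 1) * z / 12) * exp (Eerr k z)"
proof -
  have T: "Lam (exp (- z) ^ d) = of_real (pi\<^sup>2) / (6 * (of_nat d * z)) - of_nat d * z / 24 + (of_real (ln (real d)) + Ln (z / (2 * of_real pi))) / 2 + Lam (exp (- (4 * of_real (pi\<^sup>2) / (of_nat d * z))))"
    if "d > 0" for d
  proof -
    have "exp (- z) ^ d = exp (- (of_nat d * z))" by (simp add: exp_of_nat_mult[symmetric])
    then show ?thesis using Lam_transformation[of "of_nat d * z"] that z by (simp add: Ln_of_nat_mult)
  qed
  have z0: "z \<noteq> 0" using z by auto
  have a0: "of_nat (2 * k + 1) \<noteq> (0::complex)" "of_nat (4 * k + 2) \<noteq> (0::complex)"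
    by (simp_all only: of_nat_eq_0_iff)
  define m where "m = (of_nat (2 * k + 1) :: complex)"
  have m: "m \<noteq> 0" "of_nat (4 * k + 2) = 2 * m" "m = 2 * of_nat k + 1" using a0 by (simp_all add: m_def)
  have p: "of_real (pi\<^sup>2) / (6 * z) * 3 - of_real (pi\<^sup>2) / (6 * (of_nat 2 * z)) - of_real (pi\<^sup>2) / (6 * (of_nat (2 * k + 1) * z)) + of_real (pi\<^sup>2) / (6 * (of_nat (4 * k + 2) * z)) = of_real (Aconst k) / z"
  proof -
    have A: "of_real (Aconst k) = of_real (pi\<^sup>2) * (5 * of_nat k + 2) / (6 * m)"
      by (simp add: Aconst_def m_def)
    have kk: "of_nat k = (m - 1) / 2" using m(3) by simp
    show ?thesis unfolding A m(2) m_def[symmetric] using z0 m(1) by (simp add: divide_simps kk) (simp add: algebra_simps)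
  qed
  have l: "ln (real (4 * k + 2)) = ln 2 + ln (real (2 * k + 1))"
    using ln_mult[of 2 "real (2 * k + 1)"] by simp
  have "logF k (exp (- z)) = of_real (Aconst k) / z - of_nat (k + 1) * z / 12 + Ln (z / (2 * of_real pi)) + Eerr k z"
  proof -
    have "logF k (exp (- z)) = 3 * Lam (exp (- z) ^ 1) - Lam (exp (- z) ^ 2) - Lam (exp (- z) ^ (2 * k + 1)) + Lam (exp (- z) ^ (4 * k + 2))"
      by (simp only: logF_def power_one_right)
    also have "\<dots> = (of_real (pi\<^sup>2) / (6 * z) * 3 - of_real (pi\<^sup>2) / (6 * (of_nat 2 * z)) - of_real (pi\<^sup>2) / (6 * (of_nat (2 * k + 1) * z)) + of_real (pi\<^sup>2) / (6 * (of_nat (4 * k + 2) * z)))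
       - of_nat (k + 1) * z / 12 + Ln (z / (2 * of_real pi)) + Eerr k z"
    proof -
      have gen: "3 * (p1 - z / 24 + L / 2 + E1) - (p2 - 2 * z / 24 + (l2 + L) / 2 + E2) - (p3 - m * z / 24 + (l3 + L) / 2 + E3) + (p4 - (2 * m) * z / 24 + (l2 + l3 + L) / 2 + E4) =
        (p1 * 3 - p2 - p3 + p4) - c * z / 12 + L + (3 * E1 - E2 - E3 + E4)" if "m = 2 * c - 1" for p1 p2 p3 p4 L l2 l3 E1 E2 E3 E4 m c :: complex
        unfolding that by (simp add: field_simps)
      have mc: "m = 2 * of_nat (k + 1) - 1" by (simp add: m(3))
      define L where "L = Ln (z / (2 * of_real pi))"
      define l2 l3 where "l2 = complex_of_real (ln 2)" and "l3 = complex_of_real (ln (real (2 * k + 1)))"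
      define E1 E2 E3 E4 where "E1 = Lam (exp (- (4 * of_real (pi\<^sup>2) / z)))" and "E2 = Lam (exp (- (4 * of_real (pi\<^sup>2) / (2 * z))))"
        and "E3 = Lam (exp (- (4 * of_real (pi\<^sup>2) / (of_nat (2 * k + 1) * z))))" and "E4 = Lam (exp (- (4 * of_real (pi\<^sup>2) / (of_nat (4 * k + 2) * z))))"
      have T1: "Lam (exp (- z) ^ 1) = of_real (pi\<^sup>2) / (6 * z) - z / 24 + L / 2 + E1"
        using T[of 1] by (simp add: L_def E1_def)
      have T2: "Lam (exp (- z) ^ 2) = of_real (pi\<^sup>2) / (6 * (of_nat 2 * z)) - 2 * z / 24 + (l2 + L) / 2 + E2"
        using T[of 2] by (simp add: L_def E2_def l2_def)
      have T3: "Lam (exp (- z) ^ (2 * k + 1)) = of_real (pi\<^sup>2) / (6 * (of_nat (2 * k + 1) * z)) - m * z / 24 + (l3 + L) / 2 + E3"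
        unfolding L_def E3_def l3_def m_def by (rule T) simp
      have T4: "Lam (exp (- z) ^ (4 * k + 2)) = of_real (pi\<^sup>2) / (6 * (of_nat (4 * k + 2) * z)) - (2 * m) * z / 24 + (l2 + l3 + L) / 2 + E4"
        unfolding L_def E4_def l2_def l3_def m(2)[symmetric] of_real_add[symmetric] l[symmetric] by (rule T) simp
      show ?thesis unfolding T1 T2 T3 T4 Eerr_def E1_def[symmetric] E2_def[symmetric] E3_def[symmetric] E4_def[symmetric] L_def[symmetric]
        by (rule gen[OF mc])
    qed
    finally show ?thesis unfolding p .
  qed
  then show ?thesis unfolding Fgf_def using z0 by (simp add: exp_add exp_diff exp_Ln mult_ac)
qed

lemma Re_complex_of_real_mult: "Re (of_real c * z) = c * Re z"
  by simp

text \<open>Of the four dual nomes exp (- 4 pi^2 / (d z)) the one with d = 4 k + 2 is the largest in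
  modulus; the 6 is 3 + 1 + 1 + 1.\<close>

lemma norm_Eerr_le:
  assumes y: "Re (1 / z) > 0"
  shows "norm (Eerr k z) \<le> 6 * lam (exp (- (4 * pi\<^sup>2 * Re (1 / z) / real (4 * k + 2))))"
proof -
  define u where "u = exp (- (4 * pi\<^sup>2 * Re (1 / z) / real (4 * k + 2)))"
  have u: "0 \<le> u" "u < 1" using y by (auto simp: u_def)
  have *: "norm (Lam (exp (- (4 * of_real (pi\<^sup>2) / (of_nat d * z))))) \<le> lam u" if "d > 0" "d \<le> 4 * k + 2" for d
  proof -
    have e: "4 * of_real (pi\<^sup>2) / (of_nat d * z) = of_real (4 * pi\<^sup>2 / real d) * (1 / z)" by simp
    have n: "norm (exp (- (4 * of_real (pi\<^sup>2) / (of_nat d * z)))) = exp (- (4 * pi\<^sup>2 / real d * Re (1 / z)))"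
      unfolding e norm_exp_eq_Re uminus_complex.sel Re_complex_of_real_mult ..
    have "4 * pi\<^sup>2 / real (4 * k + 2) \<le> 4 * pi\<^sup>2 / real d" using that by (intro divide_left_mono) auto
    then have "4 * pi\<^sup>2 / real (4 * k + 2) * Re (1 / z) \<le> 4 * pi\<^sup>2 / real d * Re (1 / z)" using y by (intro mult_right_mono) auto
    then have le: "norm (exp (- (4 * of_real (pi\<^sup>2) / (of_nat d * z)))) \<le> u" unfolding n u_def by (simp add: mult.commute)
    have "norm (Lam (exp (- (4 * of_real (pi\<^sup>2) / (of_nat d * z))))) \<le> lam (norm (exp (- (4 * of_real (pi\<^sup>2) / (of_nat d * z)))))"
      by (rule norm_Lam_le) (use le u in linarith)
    also have "\<dots> \<le> lam u" by (rule lam_mono[OF _ le u(2)]) simp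
    finally show ?thesis .
  qed
  have "norm (Eerr k z) \<le> norm (3 * Lam (exp (- (4 * of_real (pi\<^sup>2) / z)))) + norm (Lam (exp (- (4 * of_real (pi\<^sup>2) / (2 * z)))))
     + norm (Lam (exp (- (4 * of_real (pi\<^sup>2) / (of_nat (2 * k + 1) * z))))) + norm (Lam (exp (- (4 * of_real (pi\<^sup>2) / (of_nat (4 * k + 2) * z)))))"
    unfolding Eerr_def by norm
  also have "\<dots> \<le> 3 * lam u + lam u + lam u + lam u"
  proof (intro add_mono)
    show "norm (3 * Lam (exp (- (4 * of_real (pi\<^sup>2) / z)))) \<le> 3 * lam u" using *[of 1] by (simp add: norm_mult)
    show "norm (Lam (exp (- (4 * of_real (pi\<^sup>2) / (2 * z))))) \<le> lam u" using *[of 2] by simp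
  qed (rule *; simp)+
  finally show ?thesis by (simp add: u_def)
qed

section \<open>Comparison of logF with its value at |q|\<close>

lemma sums_multiples:
  fixes f :: "nat \<Rightarrow> 'a :: real_normed_vector"
  assumes "d > 0" and "(\<lambda>n. f (d * Suc n)) sums S"
  shows "(\<lambda>n. if d dvd Suc n then f (Suc n) else 0) sums S"
proof -
  define g where "g n = d * Suc n - 1" for n
  have sg: "Suc (g n) = d * Suc n" for n using assms(1) by (simp add: g_def)
  have "strict_mono g"
  proof (rule strict_monoI)
    fix m n :: nat assume "m < n"
    then have "d * Suc m < d * Suc n" using assms(1) by (simp del: mult_Suc_right)
    then show "g m < g n" using sg[of m] sg[of n] by linarith
  qed
  then have "(\<lambda>n. if d dvd Suc (g n) then f (Suc (g n)) else 0) sums S \<longleftrightarrow> (\<lambda>n. if d dvd Suc n then f (Suc n) else 0) sums S"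
  proof (rule sums_mono_reindex)
    fix n assume n: "n \<notin> range g"
    have "\<not> d dvd Suc n"
    proof
      assume "d dvd Suc n"
      then obtain e where e: "Suc n = d * e" by (elim dvdE)
      then obtain e' where "e = Suc e'" by (cases e) auto
      then have "n = g e'" using e sg[of e'] by simp
      then show False using n by auto
    qed
    then show "(if d dvd Suc n then f (Suc n) else 0) = 0" by simp
  qed
  moreover have "(\<lambda>n. if d dvd Suc (g n) then f (Suc (g n)) else 0) = (\<lambda>n. f (d * Suc n))"
    unfolding sg by auto
  ultimately show ?thesis using assms(2) by simp
qed

text \<open>After the first terms are removed, the remaining Taylor coefficients of - log (1 - w)
  are still positive, so the real part is at most the value at |w|.\<close>

lemma Re_neg_Ln_tail:
  assumes "norm w < 1"
  shows "Re (- Ln (1 - w) - w) \<le> - ln (1 - norm w) - norm w"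
    and "Re (- Ln (1 - w) - w - w\<^sup>2 / 2) \<le> - ln (1 - norm w) - norm w - (norm w)\<^sup>2 / 2"
proof -
  have s: "(\<lambda>n. w ^ Suc n / of_nat (Suc n)) sums (- Ln (1 - w))" by (rule neg_Ln_sums[OF assms])
  have t: "(\<lambda>n. norm w ^ Suc n / real (Suc n)) sums (- ln (1 - norm w))" by (rule neg_ln_sums) (use assms in auto)
  have le: "Re (w ^ Suc n / of_nat (Suc n)) \<le> norm w ^ Suc n / real (Suc n)" for n
  proof -
    have "Re (w ^ Suc n / of_nat (Suc n)) \<le> norm (w ^ Suc n / of_nat (Suc n))" by (rule complex_Re_le_cmod)
    also have "\<dots> = norm w ^ Suc n / real (Suc n)" unfolding norm_divide norm_power norm_of_nat ..
    finally show ?thesis .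
  qed
  show "Re (- Ln (1 - w) - w) \<le> - ln (1 - norm w) - norm w"
    using sums_le[OF le[of "_ + 1"] sums_Re[OF sums_split_initial_segment[OF s, of 1]] sums_split_initial_segment[OF t, of 1]] by simp
  have "{..<2::nat} = {0, 1}" by auto
  then show "Re (- Ln (1 - w) - w - w\<^sup>2 / 2) \<le> - ln (1 - norm w) - norm w - (norm w)\<^sup>2 / 2"
    using sums_le[OF le[of "_ + 2"] sums_Re[OF sums_split_initial_segment[OF s, of 2]] sums_split_initial_segment[OF t, of 2]]
    by (simp add: power2_eq_square)
qed

text \<open>
  With chi as below, logF k q is the sum of (2 + chi k n) (- ln (1 - q^n)), a power series with nonnegative
  coefficients. Its low order part 2 q^n + q^(2n) + chi k n q^n sums to lowF k q; the gain on the minor arcs is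
  read off from lowF, and the remainder is bounded by its value at |q|.
\<close>
definition lowF :: "nat \<Rightarrow> 'a :: {real_normed_field, banach} \<Rightarrow> 'a" where
  "lowF k q = 3 * (q / (1 - q)) - q ^ (2 * k + 1) / (1 - q ^ (4 * k + 2))"

definition chi :: "nat \<Rightarrow> nat \<Rightarrow> real" where
  "chi k n = (if even n \<or> (2 * k + 1) dvd n then 0 else 1)"

text \<open>Inclusion and exclusion for the coprime numbers 2 and 2 k + 1. It matches the four
  \<open>Lam\<close> terms that remain of \<open>logF\<close> when 2 Lam q is set aside.\<close>

lemma chi_eq: "chi k n = 1 - of_bool (even n) - of_bool ((2 * k + 1) dvd n) + of_bool ((4 * k + 2) dvd n)"
proof -
  have "coprime 2 (2 * k + 1)" by simp
  then have "(4 * k + 2) dvd n \<longleftrightarrow> even n \<and> (2 * k + 1) dvd n"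
  proof (intro iffI conjI)
    have *: "4 * k + 2 = 2 * (2 * k + 1)" by simp
    show "even n" "(2 * k + 1) dvd n" if "(4 * k + 2) dvd n"
      using that unfolding * by (auto dest: dvd_mult_left dvd_mult_right simp del: mult_Suc_right)
    show "(4 * k + 2) dvd n" if "even n \<and> (2 * k + 1) dvd n"
      using divides_mult[of 2 n "2 * k + 1"] that \<open>coprime 2 (2 * k + 1)\<close> unfolding * by blast
  qed
  then show ?thesis by (auto simp: chi_def)
qed

lemma sums_chi:
  fixes f :: "nat \<Rightarrow> 'a :: real_normed_field"
  assumes "(\<lambda>n. f (Suc n)) sums S1" "(\<lambda>n. f (2 * Suc n)) sums S2" "(\<lambda>n. f ((2 * k + 1) * Suc n)) sums S3" "(\<lambda>n. f ((4 * k + 2) * Suc n)) sums S4"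
  shows "(\<lambda>n. of_real (chi k (Suc n)) * f (Suc n)) sums (S1 - S2 - S3 + S4)"
proof -
  have "(\<lambda>n. f (Suc n) - (if 2 dvd Suc n then f (Suc n) else 0) - (if (2 * k + 1) dvd Suc n then f (Suc n) else 0) + (if (4 * k + 2) dvd Suc n then f (Suc n) else 0)) sums (S1 - S2 - S3 + S4)"
    by (intro sums_add sums_diff sums_multiples assms) simp_all
  moreover have "f (Suc n) - (if 2 dvd Suc n then f (Suc n) else 0) - (if (2 * k + 1) dvd Suc n then f (Suc n) else 0) + (if (4 * k + 2) dvd Suc n then f (Suc n) else 0) = of_real (chi k (Suc n)) * f (Suc n)" for n
    unfolding chi_eq by (simp add: algebra_simps)
  ultimately show ?thesis by (simp only:)
qed

lemma power_geometric_sums: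
  fixes q :: "'a :: {real_normed_field, banach}"
  assumes "norm q < 1" "d > 0"
  shows "(\<lambda>n. q ^ (d * Suc n)) sums (q ^ d / (1 - q ^ d))"
proof -
  have "norm (q ^ d) < 1" using assms by (simp add: norm_power power_less_one_iff)
  then have "(\<lambda>n. q ^ d * (q ^ d) ^ n) sums (q ^ d * (1 / (1 - q ^ d)))" by (intro sums_mult geometric_sums)
  then show ?thesis by (simp add: power_mult[symmetric] power_add)
qed

text \<open>The squares contribute q^2 / (1 - q^2), exactly what the even indices take away in
  \<open>chi\<close>. This is why the low order part contains a second order term: the full 3 q / (1
  - q) survives. With w = q^(2 k + 1) the other two terms merge into - w / (1 - w^2).\<close>

lemma lowF_sums:
  fixes q :: "'a :: {real_normed_field, banach}"
  assumes q: "norm q < 1"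
  shows "(\<lambda>n. 2 * q ^ Suc n + (q ^ Suc n)\<^sup>2 + of_real (chi k (Suc n)) * q ^ Suc n) sums lowF k q"
proof -
  note g = power_geometric_sums[OF q]
  have "(\<lambda>n. 2 * q ^ Suc n + (q ^ Suc n)\<^sup>2 + of_real (chi k (Suc n)) * q ^ Suc n) sums
     (2 * (q / (1 - q)) + q ^ 2 / (1 - q ^ 2) + (q / (1 - q) - q ^ 2 / (1 - q ^ 2) - q ^ (2 * k + 1) / (1 - q ^ (2 * k + 1)) + q ^ (4 * k + 2) / (1 - q ^ (4 * k + 2))))"
  proof (intro sums_add sums_mult sums_chi[where f = "\<lambda>n. q ^ n"])
    show "(\<lambda>n. q ^ Suc n) sums (q / (1 - q))" using g[of 1] by simp
    then show "(\<lambda>n. q ^ Suc n) sums (q / (1 - q))" .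
    show "(\<lambda>n. (q ^ Suc n)\<^sup>2) sums (q\<^sup>2 / (1 - q\<^sup>2))" using g[of 2] by (simp add: power_mult[symmetric] mult.commute del: power_Suc)
  qed (rule g, simp)+
  moreover have "2 * (q / (1 - q)) + q ^ 2 / (1 - q ^ 2) + (q / (1 - q) - q ^ 2 / (1 - q ^ 2) - q ^ (2 * k + 1) / (1 - q ^ (2 * k + 1)) + q ^ (4 * k + 2) / (1 - q ^ (4 * k + 2))) = lowF k q"
  proof -
    define w where "w = q ^ (2 * k + 1)"
    have "norm w < 1" using q by (simp add: w_def norm_power power_less_one_iff del: power_Suc)
    then have w: "1 - w \<noteq> 0" "1 + w \<noteq> 0" by (auto simp: add_eq_0_iff)
    have w2: "q ^ (4 * k + 2) = w ^ 2" by (simp add: w_def power_mult[symmetric] mult.commute del: power_Suc)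
    have "1 - w\<^sup>2 = (1 - w) * (1 + w)" by (simp add: power2_eq_square algebra_simps)
    then have "w / (1 - w) - w ^ 2 / (1 - w ^ 2) = w / (1 - w ^ 2)" using w by (simp add: divide_simps) (simp add: algebra_simps power2_eq_square)
    then show ?thesis unfolding lowF_def w_def[symmetric] w2 by (simp add: algebra_simps)
  qed
  ultimately show ?thesis by simp
qed

lemma Re_logF_le:
  assumes q: "norm q < 1"
  shows "Re (logF k q) - Re (lowF k q) \<le> Re (logF k (of_real (norm q))) - lowF k (norm q)"
proof -
  define r where "r = norm q"
  have r: "0 \<le> r" "r < 1" using q by (auto simp: r_def)
  have pw: "norm (q ^ d) < 1" if "d > 0" for d using q that by (simp add: norm_power power_less_one_iff)
  have L: "(\<lambda>n. - Ln (1 - v ^ (d * Suc n))) sums Lam (v ^ d)" if "d > 0" "norm v < 1" for d and v :: complex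
    using Lam_sums[of "v ^ d"] that unfolding power_mult by (simp add: norm_power power_less_one_iff)
  have S: "(\<lambda>n. 2 * (- Ln (1 - v ^ Suc n)) + of_real (chi k (Suc n)) * (- Ln (1 - v ^ Suc n))) sums logF k v" if v: "norm v < 1" for v
  proof -
    have "(\<lambda>n. 2 * (- Ln (1 - v ^ Suc n)) + of_real (chi k (Suc n)) * (- Ln (1 - v ^ Suc n))) sums
       (2 * Lam v + (Lam v - Lam (v ^ 2) - Lam (v ^ (2 * k + 1)) + Lam (v ^ (4 * k + 2))))"
      by (intro sums_add sums_mult sums_chi[where f = "\<lambda>n. - Ln (1 - v ^ n)"] Lam_sums[OF v] L v) simp_all
    moreover have "2 * Lam v + (Lam v - Lam (v ^ 2) - Lam (v ^ (2 * k + 1)) + Lam (v ^ (4 * k + 2))) = logF k v"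
      unfolding logF_def by (simp add: algebra_simps del: power_Suc)
    ultimately show ?thesis by (simp only:)
  qed
  have D1: "(\<lambda>n. 2 * (- Ln (1 - q ^ Suc n)) + of_real (chi k (Suc n)) * (- Ln (1 - q ^ Suc n)) - (2 * q ^ Suc n + (q ^ Suc n)\<^sup>2 + of_real (chi k (Suc n)) * q ^ Suc n)) sums (logF k q - lowF k q)"
    by (intro sums_diff S lowF_sums q)
  have nr: "norm (of_real r :: complex) < 1" "norm r < 1" using r by auto
  have D2: "(\<lambda>n. Re (2 * (- Ln (1 - of_real r ^ Suc n)) + of_real (chi k (Suc n)) * (- Ln (1 - of_real r ^ Suc n))) - (2 * r ^ Suc n + (r ^ Suc n)\<^sup>2 + of_real (chi k (Suc n)) * r ^ Suc n)) sums (Re (logF k (of_real r)) - lowF k r)"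
    by (intro sums_diff sums_Re S lowF_sums nr)
  have "Re (logF k q - lowF k q) \<le> Re (logF k (of_real r)) - lowF k r"
  proof (rule sums_le[OF _ sums_Re[OF D1] D2])
    fix n
    define w where "w = q ^ Suc n"
    have w: "norm w < 1" unfolding w_def by (rule pw) simp
    have rw: "r ^ Suc n = norm w" by (simp add: r_def w_def norm_power norm_mult)
    have Lr: "Ln (1 - of_real r ^ Suc n) = of_real (ln (1 - norm w))"
      using Ln_of_real[of "1 - norm w"] w unfolding rw[symmetric] by (simp del: power_Suc)
    define c where "c = chi k (Suc n)"
    have c: "c \<ge> 0" by (simp add: c_def chi_def)
    have e1: "Re (2 * (- Ln (1 - w)) + of_real c * (- Ln (1 - w)) - (2 * w + w\<^sup>2 + of_real c * w)) = 2 * Re (- Ln (1 - w) - w - w\<^sup>2 / 2) + c * Re (- Ln (1 - w) - w)"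
      by (simp add: algebra_simps)
    have e2: "Re (2 * (- Ln (1 - of_real r ^ Suc n)) + of_real c * (- Ln (1 - of_real r ^ Suc n))) - (2 * norm w + (norm w)\<^sup>2 + of_real c * norm w) =
       2 * (- ln (1 - norm w) - norm w - (norm w)\<^sup>2 / 2) + c * (- ln (1 - norm w) - norm w)"
      unfolding Lr by (simp add: algebra_simps)
    show "Re (2 * (- Ln (1 - q ^ Suc n)) + of_real (chi k (Suc n)) * (- Ln (1 - q ^ Suc n)) - (2 * q ^ Suc n + (q ^ Suc n)\<^sup>2 + of_real (chi k (Suc n)) * q ^ Suc n))
      \<le> Re (2 * (- Ln (1 - of_real r ^ Suc n)) + of_real (chi k (Suc n)) * (- Ln (1 - of_real r ^ Suc n))) - (2 * r ^ Suc n + (r ^ Suc n)\<^sup>2 + of_real (chi k (Suc n)) * r ^ Suc n)"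
      unfolding w_def[symmetric] c_def[symmetric] rw e1 e2
      using Re_neg_Ln_tail[OF w] c by (intro add_mono mult_left_mono) auto
  qed
  then show ?thesis by (simp add: r_def)
qed

section \<open>The main term as a contour integral\<close>

lemma exp_higher_deriv_0: "(deriv ^^ n) (\<lambda>z. exp (c * z)) (0::complex) = c ^ n"
  using fps_nth_fps_expansion[OF has_fps_expansion_exp[of c], of n] by simp

text \<open>The integrand of the Cauchy integral without the factor exp (\<open>Eerr\<close>), the
  linear exponents being merged into \<open>\<nu>\<close>.\<close>

definition besH :: "real \<Rightarrow> real \<Rightarrow> complex \<Rightarrow> complex" where
  "besH A \<nu> z = z / (2 * of_real pi) * exp (of_real A / z + of_real \<nu> * z)"

definition besM :: "real \<Rightarrow> real \<Rightarrow> real" where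
  "besM A \<nu> = A\<^sup>2 / (2 * pi) * bes 2 (A * \<nu>)"

text \<open>exp (A / z) is expanded and integrated termwise. Against exp (nu z) the power z^(1 - j)
  has a residue only for j >= 2, namely nu^(j - 2) / (j - 2)!; the shift j = m + 2 produces the
  index 2 of \<open>bes\<close>.\<close>

lemma besH_circle_integral:
  assumes \<rho>: "\<rho> > 0"
  shows "(besH A \<nu> has_contour_integral (2 * pi * \<i> * of_real (besM A \<nu>))) (circlepath 0 \<rho>)"
proof -
  define c :: "nat \<Rightarrow> complex" where "c j = (if j < 2 then 0 else 2 * pi * \<i> * of_real \<nu> ^ (j - 2) / fact (j - 2))" for j
  have pz: "z \<noteq> 0" if "z \<in> path_image (circlepath 0 \<rho>)" for z using that \<rho> by auto
  have cj: "((\<lambda>z. z * exp (of_real \<nu> * z) * (1 / z) ^ j) has_contour_integral c j) (circlepath 0 \<rho>)" for j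
  proof -
    consider "j = 0" | "j = 1" | m where "j = Suc (Suc m)" by (metis not0_implies_Suc One_nat_def)
    then show ?thesis
    proof cases
      case 1
      have "((\<lambda>z. z * exp (of_real \<nu> * z)) has_contour_integral 0) (circlepath 0 \<rho>)"
        by (rule Cauchy_theorem_convex_simple[of _ UNIV]) (auto intro!: holomorphic_intros)
      then show ?thesis by (simp add: 1 c_def)
    next
      case 2
      have "((\<lambda>z. exp (of_real \<nu> * z)) has_contour_integral 0) (circlepath 0 \<rho>)"
        by (rule Cauchy_theorem_convex_simple[of _ UNIV]) (auto intro!: holomorphic_intros)
      then have "((\<lambda>z. z * exp (of_real \<nu> * z) * (1 / z) ^ j) has_contour_integral 0) (circlepath 0 \<rho>)"
        by (rule has_contour_integral_eq) (use pz 2 in auto)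
      then show ?thesis by (simp add: 2 c_def)
    next
      case 3
      have "((\<lambda>u. exp (of_real \<nu> * u) / (u - 0) ^ Suc m) has_contour_integral ((2 * pi * \<i>) / fact m * (deriv ^^ m) (\<lambda>z. exp (of_real \<nu> * z)) 0)) (circlepath 0 \<rho>)"
        by (rule Cauchy_has_contour_integral_higher_derivative_circlepath) (use \<rho> in \<open>auto intro!: continuous_intros holomorphic_intros\<close>)
      then have "((\<lambda>u. exp (of_real \<nu> * u) / (u - 0) ^ Suc m) has_contour_integral c j) (circlepath 0 \<rho>)"
        unfolding exp_higher_deriv_0 by (simp add: 3 c_def)
      then show ?thesis
        by (rule has_contour_integral_eq) (use pz in \<open>auto simp: 3 field_simps\<close>)
    qed
  qed
  define f where "f N z = (\<Sum>j<N. of_real A ^ j / fact j / (2 * of_real pi) * (z * exp (of_real \<nu> * z) * (1 / z) ^ j))" for N and z :: complex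
  have fN: "(f N has_contour_integral (\<Sum>j<N. of_real A ^ j / fact j / (2 * of_real pi) * c j)) (circlepath 0 \<rho>)" for N
    unfolding f_def by (intro has_contour_integral_sum has_contour_integral_lmul cj) auto
  have ul: "uniform_limit (path_image (circlepath 0 \<rho>)) f (besH A \<nu>) sequentially"
  proof -
    define g where "g j z = of_real A ^ j / fact j / (2 * of_real pi) * (z * exp (of_real \<nu> * z) * (1 / z) ^ j)" for j and z :: complex
    have b: "norm (g j z) \<le> \<rho> * exp (\<bar>\<nu>\<bar> * \<rho>) / (2 * pi) * (inverse (fact j) * (\<bar>A\<bar> / \<rho>) ^ j)"
      if "z \<in> path_image (circlepath 0 \<rho>)" for j z
    proof -
      have z: "norm z = \<rho>" using that \<rho> by auto
      have "norm (exp (of_real \<nu> * z)) \<le> exp (norm (of_real \<nu> * z))" by (rule norm_exp)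
      also have "\<dots> = exp (\<bar>\<nu>\<bar> * \<rho>)" by (simp add: norm_mult z)
      finally have e: "norm (exp (of_real \<nu> * z)) \<le> exp (\<bar>\<nu>\<bar> * \<rho>)" .
      have "norm (g j z) = \<rho> / (2 * pi) * (inverse (fact j) * (\<bar>A\<bar> / \<rho>) ^ j) * norm (exp (of_real \<nu> * z))"
        unfolding g_def norm_mult norm_divide norm_power z by (simp add: field_simps power_divide)
      also have "\<dots> \<le> \<rho> / (2 * pi) * (inverse (fact j) * (\<bar>A\<bar> / \<rho>) ^ j) * exp (\<bar>\<nu>\<bar> * \<rho>)"
        using e \<rho> by (intro mult_left_mono) auto
      finally show ?thesis by (simp add: mult_ac)
    qed
    have "uniform_limit (path_image (circlepath 0 \<rho>)) (\<lambda>N z. \<Sum>j<N. g j z) (\<lambda>z. \<Sum>j. g j z) sequentially"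
      by (rule Weierstrass_m_test[OF b]) (auto intro!: summable_mult summable_exp)
    also have "?this \<longleftrightarrow> uniform_limit (path_image (circlepath 0 \<rho>)) f (besH A \<nu>) sequentially"
    proof (rule uniform_limit_cong')
      show "(\<Sum>j<N. g j z) = f N z" for N z by (simp add: f_def g_def)
      fix z assume "z \<in> path_image (circlepath 0 \<rho>)"
      then have z: "z \<noteq> 0" by (rule pz)
      have "(\<lambda>j. (z * exp (of_real \<nu> * z) / (2 * of_real pi)) * ((of_real A / z) ^ j /\<^sub>R fact j)) sums ((z * exp (of_real \<nu> * z) / (2 * of_real pi)) * exp (of_real A / z))"
        by (intro sums_mult exp_converges)
      moreover have "(z * exp (of_real \<nu> * z) / (2 * of_real pi)) * ((of_real A / z) ^ j /\<^sub>R fact j) = g j z" for j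
        by (simp add: g_def scaleR_conv_of_real field_simps power_divide)
      moreover have "(z * exp (of_real \<nu> * z) / (2 * of_real pi)) * exp (of_real A / z) = besH A \<nu> z"
        by (simp add: besH_def exp_add)
      ultimately show "(\<Sum>j. g j z) = besH A \<nu> z" by (simp add: sums_iff)
    qed
    finally show ?thesis .
  qed
  have vd: "norm (vector_derivative (circlepath 0 \<rho>) (at t)) \<le> 2 * pi * \<rho>" for t
    using \<rho> by (simp add: vector_derivative_circlepath norm_mult)
  have ev: "\<forall>\<^sub>F N in sequentially. f N contour_integrable_on circlepath 0 \<rho>"
    by (rule always_eventually) (use fN in \<open>unfold contour_integrable_on_def, blast\<close>)
  have lim: "(\<lambda>N. contour_integral (circlepath 0 \<rho>) (f N)) \<longlonglongrightarrow> contour_integral (circlepath 0 \<rho>) (besH A \<nu>)"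
    and int: "besH A \<nu> contour_integrable_on circlepath 0 \<rho>"
    using contour_integral_uniform_limit[OF ev ul vd] by auto
  have "(\<lambda>j. of_real A ^ j / fact j / (2 * of_real pi) * c j) sums (2 * pi * \<i> * of_real (besM A \<nu>))"
  proof -
    have "(\<lambda>m. of_real (A\<^sup>2 / (2 * pi) * ((A * \<nu>) ^ m / (fact m * fact (m + 2)))) :: complex) sums (of_real (besM A \<nu>))"
      unfolding besM_def by (intro sums_of_real sums_mult bes_sums)
    then have "(\<lambda>m. 2 * pi * \<i> * of_real (A\<^sup>2 / (2 * pi) * ((A * \<nu>) ^ m / (fact m * fact (m + 2)))) :: complex) sums (2 * pi * \<i> * of_real (besM A \<nu>))"
      by (rule sums_mult)
    moreover have "2 * pi * \<i> * of_real (A\<^sup>2 / (2 * pi) * ((A * \<nu>) ^ m / (fact m * fact (m + 2)))) = of_real A ^ (m + 2) / fact (m + 2) / (2 * of_real pi) * c (m + 2)" for m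
      by (simp add: c_def power_mult_distrib power_add power2_eq_square mult_ac del: fact_Suc)
    ultimately have "(\<lambda>m. of_real A ^ (m + 2) / fact (m + 2) / (2 * of_real pi) * c (m + 2)) sums (2 * pi * \<i> * of_real (besM A \<nu>))" by simp
    moreover have "(\<Sum>j<2. of_real A ^ j / fact j / (2 * of_real pi) * c j) = 0"
      by (rule sum.neutral) (auto simp: c_def)
    ultimately show ?thesis
      using sums_iff_shift[of "\<lambda>j. of_real A ^ j / fact j / (2 * of_real pi) * c j" 2] by simp
  qed
  then have "(\<lambda>N. \<Sum>j<N. of_real A ^ j / fact j / (2 * of_real pi) * c j) \<longlonglongrightarrow> (2 * pi * \<i> * of_real (besM A \<nu>))"
    by (simp add: sums_def)
  then have "contour_integral (circlepath 0 \<rho>) (besH A \<nu>) = 2 * pi * \<i> * of_real (besM A \<nu>)"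
    using lim contour_integral_unique[OF fN] LIMSEQ_unique by simp
  then show ?thesis using has_contour_integral_integral[OF int] by simp
qed

lemma norm_besH:
  assumes "z \<noteq> 0"
  shows "norm (besH A \<nu> z) = norm z / (2 * pi) * exp (A * Re z / (norm z)\<^sup>2 + \<nu> * Re z)"
proof -
  have "Re (of_real A / z) = A * Re z / (norm z)\<^sup>2"
    by (simp add: Re_divide cmod_power2)
  then show ?thesis by (simp add: besH_def norm_mult norm_divide norm_exp_eq_Re)
qed

text \<open>The segment is completed by the long arc of the circle |z| = \<open>\<rho>\<close>
  through its endpoints, on which Re z <= x bounds the integrand. The short arc can be traded for
  the segment because the integrand has a primitive on the right half-plane.\<close>

lemma besH_segment_integral:
  assumes x: "x > 0" and h: "h > 0" and A: "A \<ge> 0" and \<nu>: "\<nu> \<ge> 0"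
  defines "\<rho> \<equiv> sqrt (x\<^sup>2 + h\<^sup>2)"
  shows "\<exists>J. (besH A \<nu> has_contour_integral J) (linepath (Complex x (- h)) (Complex x h)) \<and>
    norm (2 * pi * \<i> * of_real (besM A \<nu>) - J) \<le> \<rho>\<^sup>2 * exp ((A / \<rho>\<^sup>2 + \<nu>) * x)"
proof -
  define H where "H = besH A \<nu>"
  have \<rho>: "\<rho> > 0" using x by (simp add: \<rho>_def add_pos_nonneg)
  define S where "S = {z. Re z > 0}"
  have "H holomorphic_on S" unfolding H_def besH_def by (intro holomorphic_intros) (auto simp: S_def)
  moreover have "convex S" "open S" unfolding S_def by (auto intro: convex_halfspace_Re_gt open_halfspace_Re_gt)
  ultimately obtain P where P: "\<And>z. z \<in> S \<Longrightarrow> (P has_field_derivative H z) (at z within S)"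
    using holomorphic_convex_primitive' by blast
  \<comment> \<open>The argument of the endpoint x + i h; the long arc runs from here to 2 pi minus
    this angle.\<close>
  define \<phi> where "\<phi> = arctan (h / x)"
  have \<phi>: "0 < \<phi>" "\<phi> < pi / 2" using x h arctan_ubound by (auto simp: \<phi>_def zero_less_arctan_iff)
  have c\<phi>: "\<rho> * cos \<phi> = x" "\<rho> * sin \<phi> = h"
  proof -
    have "1 + (h / x)\<^sup>2 = (\<rho> / x)\<^sup>2" using x by (simp add: \<rho>_def power_divide field_simps real_sqrt_pow2_iff)
    then have "sqrt (1 + (h / x)\<^sup>2) = \<rho> / x" using \<rho> x by simp
    then show "\<rho> * cos \<phi> = x" "\<rho> * sin \<phi> = h" using \<rho> x by (simp_all add: \<phi>_def cos_arctan sin_arctan)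
  qed
  define w where "w t = H (\<rho> * cis t) * \<rho> * \<i> * cis t" for t
  have arc: "(w has_integral I) {a..b} \<longleftrightarrow> (H has_contour_integral I) (part_circlepath 0 \<rho> a b)" if "a < b" for a b I
    using has_contour_integral_part_circlepath_iff[OF that, of H I 0 \<rho>] by (simp add: w_def[abs_def])
  have tot: "(w has_integral (2 * pi * \<i> * of_real (besM A \<nu>))) {0..2 * pi}"
    using besH_circle_integral[OF \<rho>, of A \<nu>] by (subst arc) (auto simp: circlepath_def H_def)
  have wint: "w integrable_on {0..2 * pi}" using tot by (auto simp: integrable_on_def)
  have prim: "integral {a..b} w = P (\<rho> * cis b) - P (\<rho> * cis a)" if "a < b" "\<And>t. t \<in> {a..b} \<Longrightarrow> cos t > 0" for a b
  proof -
    have "(H has_contour_integral (P (pathfinish (part_circlepath 0 \<rho> a b)) - P (pathstart (part_circlepath 0 \<rho> a b)))) (part_circlepath 0 \<rho> a b)"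
      by (rule contour_integral_primitive[OF P]) (use that \<rho> in \<open>auto simp: path_image_part_circlepath' S_def closed_segment_eq_real_ivl\<close>)
    then have "(w has_integral (P (\<rho> * cis b) - P (\<rho> * cis a))) {a..b}"
      using arc[OF that(1)] by (simp add: cis_conv_exp)
    then show ?thesis by (rule integral_unique)
  qed
  have c1: "cos t > 0" if "t \<in> {0..\<phi>}" for t using that \<phi> by (intro cos_gt_zero_pi) auto
  have c2: "cos t > 0" if "t \<in> {2 * pi - \<phi>..2 * pi}" for t
  proof -
    have "cos (t - 2 * pi) > 0" using that \<phi> by (intro cos_gt_zero_pi) auto
    then show ?thesis by (simp add: cos_diff)
  qed
  have ends: "\<rho> * cis \<phi> = Complex x h" "\<rho> * cis (2 * pi - \<phi>) = Complex x (- h)" "\<rho> * cis 0 = \<rho>" "\<rho> * cis (2 * pi) = \<rho>"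
    using c\<phi> by (auto simp: complex_eq_iff cos_diff sin_diff)
  define K where "K = integral {\<phi>..2 * pi - \<phi>} w"
  have wint2: "w integrable_on {\<phi>..2 * pi - \<phi>}" "w integrable_on {0..2 * pi - \<phi>}"
    by (rule integrable_on_subinterval[OF wint], use \<phi> in auto)+
  have "integral {0..2 * pi} w = integral {0..2 * pi - \<phi>} w + integral {2 * pi - \<phi>..2 * pi} w"
    by (rule Henstock_Kurzweil_Integration.integral_combine[symmetric]) (use \<phi> wint in auto)
  also have "integral {0..2 * pi - \<phi>} w = integral {0..\<phi>} w + K"
    unfolding K_def by (rule Henstock_Kurzweil_Integration.integral_combine[symmetric]) (use \<phi> wint2 in auto)
  also have "integral {0..\<phi>} w = P (Complex x h) - P \<rho>" using prim[OF \<phi>(1) c1] ends by simp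
  also have "integral {2 * pi - \<phi>..2 * pi} w = P \<rho> - P (Complex x (- h))" using prim[of "2 * pi - \<phi>" "2 * pi"] c2 \<phi> ends by simp
  finally have eq: "2 * pi * \<i> * of_real (besM A \<nu>) - (P (Complex x h) - P (Complex x (- h))) = K"
    using integral_unique[OF tot] by simp
  have J: "(H has_contour_integral (P (Complex x h) - P (Complex x (- h)))) (linepath (Complex x (- h)) (Complex x h))"
  proof -
    have "closed_segment (Complex x (- h)) (Complex x h) \<subseteq> S"
      by (rule closed_segment_subset) (use \<open>convex S\<close> x in \<open>auto simp: S_def\<close>)
    then have "(H has_contour_integral (P (pathfinish (linepath (Complex x (- h)) (Complex x h))) - P (pathstart (linepath (Complex x (- h)) (Complex x h))))) (linepath (Complex x (- h)) (Complex x h))"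
      by (intro contour_integral_primitive[OF P]) auto
    then show ?thesis by simp
  qed
  have "norm K \<le> (\<rho> / (2 * pi) * exp ((A / \<rho>\<^sup>2 + \<nu>) * x)) * \<rho> * (2 * pi - \<phi> - \<phi>)"
  proof (rule has_contour_integral_bound_part_circlepath)
    show "(H has_contour_integral K) (part_circlepath 0 \<rho> \<phi> (2 * pi - \<phi>))"
      using arc[of \<phi> "2 * pi - \<phi>" K] wint2(1) \<phi> by (auto simp: K_def)
    fix z assume "z \<in> path_image (part_circlepath 0 \<rho> \<phi> (2 * pi - \<phi>))"
    then obtain t where t: "t \<in> {\<phi>..2 * pi - \<phi>}" "z = \<rho> * cis t" 
      using \<phi> by (auto simp: path_image_part_circlepath' closed_segment_eq_real_ivl)
    have z: "norm z = \<rho>" "Re z = \<rho> * cos t" using \<rho> unfolding t(2) by (simp_all add: norm_mult)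
    have "cos t \<le> cos \<phi>"
    proof (cases "t \<le> pi")
      case True then show ?thesis using t \<phi> by (intro cos_monotone_0_pi_le) auto
    next
      case False
      have "cos (2 * pi - t) \<le> cos \<phi>" using t \<phi> False by (intro cos_monotone_0_pi_le) auto
      then show ?thesis by (simp add: cos_diff)
    qed
    then have le: "Re z \<le> x" using \<rho> c\<phi>(1) unfolding z(2) by (metis mult_le_cancel_left_pos)
    have "A * Re z / \<rho>\<^sup>2 + \<nu> * Re z = (A / \<rho>\<^sup>2 + \<nu>) * Re z" by (simp add: algebra_simps)
    also have "\<dots> \<le> (A / \<rho>\<^sup>2 + \<nu>) * x" using le A \<nu> by (intro mult_left_mono) auto
    finally have "exp (A * Re z / \<rho>\<^sup>2 + \<nu> * Re z) \<le> exp ((A / \<rho>\<^sup>2 + \<nu>) * x)" by simp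
    moreover have "z \<noteq> 0" using z \<rho> by auto
    ultimately show "norm (H z) \<le> \<rho> / (2 * pi) * exp ((A / \<rho>\<^sup>2 + \<nu>) * x)"
      unfolding H_def norm_besH[OF \<open>z \<noteq> 0\<close>] z(1) using \<rho> by (intro mult_left_mono) auto
  qed (use \<rho> \<phi> in auto)
  also have "\<dots> \<le> (\<rho> / (2 * pi) * exp ((A / \<rho>\<^sup>2 + \<nu>) * x)) * \<rho> * (2 * pi)"
    using \<rho> \<phi> by (intro mult_left_mono) auto
  also have "\<dots> = \<rho>\<^sup>2 * exp ((A / \<rho>\<^sup>2 + \<nu>) * x)" by (simp add: power2_eq_square)
  finally show ?thesis using J eq unfolding H_def by auto
qed

section \<open>Loss of the low order part off the real axis\<close>

lemma gap_identity:
  fixes x \<theta> :: real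
  defines "q \<equiv> exp (- Complex x \<theta>)" and "r \<equiv> exp (- x)" and "C \<equiv> 1 - cos \<theta>"
  assumes x: "x > 0"
  shows "r / (1 - r) - Re (q / (1 - q)) = r / (1 - r) * (C * (1 + r) / ((1 - r)\<^sup>2 + 2 * r * C))"
proof -
  have r: "0 < r" "r < 1" using x by (auto simp: r_def)
  have C: "C \<ge> 0" by (simp add: C_def)
  have q: "Re q = r * cos \<theta>" "Im q = - (r * sin \<theta>)" by (auto simp: q_def r_def Re_exp Im_exp)
  \<comment> \<open>D is |1 - q|^2.\<close>
  define D where "D = (1 - r)\<^sup>2 + 2 * r * C"
  have D: "D > 0" unfolding D_def using r C by (intro add_pos_nonneg) auto
  have s2: "(sin \<theta>)\<^sup>2 = 1 - (cos \<theta>)\<^sup>2" by (simp add: sin_squared_eq)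
  have n: "(1 - r * cos \<theta>)\<^sup>2 + (r * sin \<theta>)\<^sup>2 = D"
    unfolding D_def C_def power_mult_distrib s2 by (simp add: power2_eq_square algebra_simps)
  have "Re (q / (1 - q)) = (r * cos \<theta> * (1 - r * cos \<theta>) - (r * sin \<theta>)\<^sup>2) / D"
    unfolding Re_divide n[symmetric] by (simp add: q power2_eq_square)
  also have "r * cos \<theta> * (1 - r * cos \<theta>) - (r * sin \<theta>)\<^sup>2 = r * (1 - r) - r * C"
    unfolding C_def power_mult_distrib s2 by (simp add: power2_eq_square algebra_simps)
  finally have e: "Re (q / (1 - q)) = (r * (1 - r) - r * C) / D" .
  have "r / (1 - r) - (r * (1 - r) - r * C) / D = r / (1 - r) * (C * (1 + r) / D)"
  proof -
    have "r * D - (r * (1 - r) - r * C) * (1 - r) = r * (C * (1 + r))"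
      unfolding D_def by (simp add: power2_eq_square algebra_simps)
    then show ?thesis using r D by (simp add: divide_simps)
  qed
  then show ?thesis unfolding e D_def .
qed

text \<open>The relative loss is C (1 + r) / |1 - q|^2 with C = 1 - cos theta. From (1 - r)^2 <= x^2
  <= 2 d C it is at least (1 + r) / (2 (d + r)) >= 1 / (1 + d); a small d means that theta is large
  against x. The bound 1 / x - 1 / 2 for r / (1 - r) expresses that the series in
  \<open>exp_minus_1_expansion\<close> has positive terms.\<close>

lemma gap_lower:
  fixes x \<theta> d :: real
  assumes x: "x > 0" and d: "0 \<le> d" "d \<le> 1" and C: "x\<^sup>2 \<le> 2 * d * (1 - cos \<theta>)" and x2: "x \<le> 2"
  shows "exp (- x) / (1 - exp (- x)) - Re (exp (- Complex x \<theta>) / (1 - exp (- Complex x \<theta>))) \<ge> (1 / x - 1 / 2) / (1 + d)"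
proof -
  define r where "r = exp (- x)"
  define C where "C = 1 - cos \<theta>"
  have r: "0 < r" "r < 1" using x by (auto simp: r_def)
  have "x\<^sup>2 > 0" using x by simp
  then have "C \<noteq> 0" using C by (auto simp: C_def)
  moreover have "C \<ge> 0" by (simp add: C_def)
  ultimately have Cp: "C > 0" by simp
  have dp: "d > 0" using C x d by (cases "d = 0") auto
  have "1 - r \<le> x" unfolding r_def using exp_ge_add_one_self[of "- x"] by linarith
  then have "(1 - r)\<^sup>2 \<le> x\<^sup>2" using r by (intro power_mono) auto
  then have le: "(1 - r)\<^sup>2 \<le> 2 * d * C" using C by (simp add: C_def)
  have "C * (1 + r) / ((1 - r)\<^sup>2 + 2 * r * C) \<ge> C * (1 + r) / (2 * d * C + 2 * r * C)"
    using le r Cp dp by (intro divide_left_mono mult_pos_pos add_pos_pos add_nonneg_pos) (auto intro!: add_nonneg_pos)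
  moreover have "C * (1 + r) / (2 * d * C + 2 * r * C) = (1 + r) / (2 * (d + r))"
  proof -
    have "2 * d * C + 2 * r * C = C * (2 * (d + r))" by (simp add: algebra_simps)
    then show ?thesis using Cp by simp
  qed
  moreover have "(1 + r) / (2 * (d + r)) \<ge> 1 / (1 + d)"
  proof -
    have "(1 - r) * (1 - d) \<ge> 0" using r d by simp
    then have "d + r \<le> 1 + d * r" by (simp add: algebra_simps)
    then show ?thesis using r d by (simp add: divide_simps add_nonneg_pos) (simp add: algebra_simps)
  qed
  ultimately have f: "C * (1 + r) / ((1 - r)\<^sup>2 + 2 * r * C) \<ge> 1 / (1 + d)" by linarith
  have "(\<lambda>k. 2 * x / (x\<^sup>2 + (2 * pi * real (Suc k))\<^sup>2)) sums (1 / (exp x - 1) + 1 / 2 - 1 / x)"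
    by (rule exp_minus_1_expansion[OF x])
  from sums_le[OF _ sums_zero this] have "1 / (exp x - 1) + 1 / 2 - 1 / x \<ge> 0" using x by simp
  moreover have "1 / (exp x - 1) = r / (1 - r)"
  proof -
    have e: "exp x = 1 / r" by (simp add: r_def exp_minus field_simps)
    have "1 / (1 / r - 1) = r / (1 - r)" using r by (simp add: field_simps)
    then show ?thesis unfolding e .
  qed
  ultimately have g: "r / (1 - r) \<ge> 1 / x - 1 / 2" by linarith
  have "1 / x - 1 / 2 \<ge> 0" using x x2 by (simp add: field_simps)
  then have "(1 / x - 1 / 2) * (1 / (1 + d)) \<le> r / (1 - r) * (C * (1 + r) / ((1 - r)\<^sup>2 + 2 * r * C))"
    using g f d by (intro mult_mono) auto
  then show ?thesis unfolding r_def C_def gap_identity[OF x, symmetric] by simp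
qed

text \<open>For q = exp (- x) the quotient is 1 / (2 sinh (a x)), and sinh y >= y; the triangle
  inequality reduces the general case to this one.\<close>

lemma norm_odd_geometric_le:
  fixes q :: complex and x :: real
  assumes q: "norm q = exp (- x)" and x: "x > 0" and a: "a > 0"
  shows "norm (q ^ a / (1 - q ^ (2 * a))) \<le> 1 / (2 * real a * x)"
    and "exp (- x) ^ a / (1 - exp (- x) ^ (2 * a)) \<le> 1 / (2 * real a * x)"
proof -
  define s where "s = exp (- x) ^ a"
  have s: "0 < s" "s = exp (- (real a * x))" by (auto simp: s_def exp_of_nat_mult[symmetric])
  have ax: "real a * x > 0" using a x by simp
  then have s1: "s < 1" by (simp add: s)
  have s2: "exp (- x) ^ (2 * a) = s\<^sup>2" unfolding s_def by (simp only: power_mult[symmetric] mult.commute)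
  have s21: "s\<^sup>2 < 1" using s s1 by (simp add: power_less_one_iff)
  have "2 * (real a * x) \<le> 1 / s - s"
  proof -
    have "real a * x \<le> (exp (real a * x) - inverse (exp (real a * x))) / 2"
      using ax by (intro real_le_x_sinh) auto
    then show ?thesis by (simp add: s exp_minus inverse_eq_divide)
  qed
  moreover have "1 / s - s = (1 - s\<^sup>2) / s" using s by (simp add: power2_eq_square field_simps)
  ultimately have "2 * (real a * x) * s \<le> 1 - s\<^sup>2" using s by (simp add: field_simps)
  then show 1: "exp (- x) ^ a / (1 - exp (- x) ^ (2 * a)) \<le> 1 / (2 * real a * x)"
    unfolding s2 s_def[symmetric] using ax s21 a x by (simp add: field_simps)
  have "norm (1 - q ^ (2 * a)) \<ge> 1 - norm (q ^ (2 * a))" using norm_triangle_ineq2[of 1 "q ^ (2 * a)"] by simp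
  then have "norm (1 - q ^ (2 * a)) \<ge> 1 - s\<^sup>2" by (simp add: norm_power q s2)
  then have "norm (q ^ a / (1 - q ^ (2 * a))) \<le> exp (- x) ^ a / (1 - exp (- x) ^ (2 * a))"
    unfolding norm_divide norm_power q s_def[symmetric] s2 using s21 s(1)
    by (intro divide_left_mono mult_pos_pos) (auto simp: norm_power q s2)
  with 1 show "norm (q ^ a / (1 - q ^ (2 * a))) \<le> 1 / (2 * real a * x)" by linarith
qed

section \<open>Major and minor arcs\<close>

lemma exp_minus_one_le_mult_exp:
  fixes t :: real
  shows "exp t - 1 \<le> t * exp t"
proof -
  have "1 - t \<le> exp (- t)" using exp_ge_add_one_self[of "- t"] by simp
  then have "(1 - t) * exp t \<le> exp (- t) * exp t" by (intro mult_right_mono) auto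
  then show ?thesis by (simp add: exp_minus algebra_simps)
qed

lemma norm_exp_minus_one_le: "norm (exp w - 1) \<le> norm w * exp (norm w)" for w :: complex
proof -
  have "norm (exp w - 1) \<le> exp (norm w) - 1"
  proof -
    have s: "(\<lambda>n. w ^ Suc n /\<^sub>R fact (Suc n)) sums (exp w - 1)"
      using sums_split_initial_segment[OF exp_converges[of w], of 1] by simp
    have t: "(\<lambda>n. norm w ^ Suc n /\<^sub>R fact (Suc n)) sums (exp (norm w) - 1)"
      using sums_split_initial_segment[OF exp_converges[of "norm w"], of 1] by simp
    have "norm (\<Sum>n. w ^ Suc n /\<^sub>R fact (Suc n)) \<le> (\<Sum>n. norm w ^ Suc n /\<^sub>R fact (Suc n))"
      by (rule norm_suminf_le[OF _ sums_summable[OF t]]) (simp add: norm_power norm_mult del: fact_Suc)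
    then show ?thesis using s t by (simp only: sums_iff)
  qed
  then show ?thesis using exp_minus_one_le_mult_exp[of "norm w"] by linarith
qed

text \<open>
  The saddle point is x = A / T, the main term grows like exp (2 T), and the major arc is
  |theta| \<le> h = 6 x.
\<close>
locale major_arc =
  fixes k :: nat and T :: real
  assumes k: "k = 1 \<or> k = 2" and T: "T \<ge> 43"
begin

definition "A = Aconst k"
definition "x = A / T"
definition "h = 6 * x"
definition "\<rho> = sqrt (x\<^sup>2 + h\<^sup>2)"
definition "\<nu> = T\<^sup>2 / A"

lemma pi_bounds: "3.14159 < pi" "pi < 3.1416"
  using Complex_Transcendental.pi_approx by auto

lemma pi2_bounds: "9.8695 < pi\<^sup>2" "pi\<^sup>2 < 9.8697"
proof -
  have "3.14159\<^sup>2 < pi\<^sup>2" "pi\<^sup>2 < 3.1416\<^sup>2" using pi_bounds by (intro power_strict_mono; simp)+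
  then show "9.8695 < pi\<^sup>2" "pi\<^sup>2 < 9.8697" by (simp_all add: power2_eq_square)
qed

lemma A_eq: "k = 1 \<Longrightarrow> A = 7 * pi\<^sup>2 / 18" "k = 2 \<Longrightarrow> A = 2 * pi\<^sup>2 / 5"
  unfolding A_def Aconst_def by auto

lemma A_bounds: "3.838 < A" "A < 3.95" "k = 1 \<Longrightarrow> A < 3.8383" "k = 2 \<Longrightarrow> A < 3.948"
  using k pi2_bounds A_eq by auto

text \<open>The largest dual nome in \<open>Eerr\<close> has to cancel the growth exp (A Re (1 / z))
  of the main integrand. For k = 2 both sides are equal; for k = 3 the inequality would
  fail.\<close>

lemma A_le: "A \<le> 4 * pi\<^sup>2 / real (4 * k + 2)"
  using k unfolding A_def Aconst_def by auto

lemma x_bounds: "0 < x" "x < 0.0919"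
  using A_bounds T by (auto simp: x_def field_simps)

lemma h_pos: "0 < h" "h < pi" using x_bounds pi_bounds by (auto simp: h_def)

lemma rho2: "\<rho>\<^sup>2 = 37 * x\<^sup>2" "\<rho> > 0"
  using x_bounds by (auto simp: \<rho>_def h_def power2_eq_square)

lemma nu_x: "\<nu> * x = T" "A / x = T" "\<nu> > 0" "sqrt (A * \<nu>) = T" "A * \<nu> = T\<^sup>2"
  using A_bounds T by (auto simp: \<nu>_def x_def power2_eq_square field_simps)

text \<open>On the major arc |z|^2 <= 37 x^2 with 37 = 1 + 6^2, hence A Re (1 / z) >= T / 37; this
  puts the nome in \<open>Eerr\<close> below 1/3. The Taylor polynomial of degree 3 is the first
  that suffices at T = 43.\<close>

lemma exp_T37: "exp (- (T / 37)) \<le> 1 / 3"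
proof -
  have "3 \<le> 1 + T / 37 + (T / 37)\<^sup>2 / 2 + (T / 37) ^ 3 / 6"
  proof -
    have a: "T / 37 \<ge> 43 / 37" using T by simp
    have "(T / 37)\<^sup>2 \<ge> (43 / 37)\<^sup>2" "(T / 37) ^ 3 \<ge> (43 / 37) ^ 3" using a by (intro power_mono; simp)+
    then have "1 + T / 37 + (T / 37)\<^sup>2 / 2 + (T / 37) ^ 3 / 6 \<ge> 1 + 43 / 37 + (43 / 37)\<^sup>2 / 2 + (43 / 37) ^ 3 / (6::real)"
      using a by linarith
    then show ?thesis by (simp add: power2_eq_square power3_eq_cube)
  qed
  also have "\<dots> \<le> exp (T / 37)"
  proof -
    have "(\<Sum>i<4. (T / 37) ^ i /\<^sub>R fact i) \<le> exp (T / 37)"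
      unfolding exp_def using T by (intro sum_le_suminf summable_exp_generic) auto
    moreover have "(\<Sum>i<4. y ^ i /\<^sub>R fact i) = 1 + y + y\<^sup>2 / 2 + y ^ 3 / 6" for y :: real
    proof -
      have "{..<4::nat} = {0, 1, 2, 3}" by auto
      moreover have "fact 2 = (2::real)" "fact 3 = (6::real)" by (simp_all add: fact_numeral)
      ultimately show ?thesis by (simp add: field_simps)
    qed
    ultimately show ?thesis by simp
  qed
  finally have "3 \<le> exp (T / 37)" .
  then show ?thesis by (simp add: exp_minus field_simps)
qed

text \<open>The growth is absorbed by u <= exp (- A Re (1 / z)), a consequence of
  \<open>A_le\<close>. The constant comes from 27/2 * 3^5 = 3280.5, where 27/2 = 6 * 9/4 and exp 5
  <= 3^5.\<close>

lemma exp_Eerr_major: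
  assumes y: "1 / (37 * x) \<le> Re (1 / z)"
  shows "exp (A * Re (1 / z)) * norm (exp (Eerr k z) - 1) \<le> 3300"
proof -
  define y where "y = Re (1 / z)"
  have "1 / (37 * x) > 0" using x_bounds by simp
  then have y0: "y > 0" using y unfolding y_def by linarith
  define u where "u = exp (- (4 * pi\<^sup>2 * y / real (4 * k + 2)))"
  have "A * y \<le> 4 * pi\<^sup>2 / real (4 * k + 2) * y" using A_le y0 by (intro mult_right_mono) auto
  then have u1: "u \<le> exp (- (A * y))" by (simp add: u_def)
  have "A * (1 / (37 * x)) \<le> A * y" using y A_bounds unfolding y_def by (intro mult_left_mono) auto
  moreover have "A * (1 / (37 * x)) = T / 37" using nu_x(2) by simp
  ultimately have "exp (- (A * y)) \<le> exp (- (T / 37))" by simp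
  then have u3: "u \<le> 1 / 3" using u1 exp_T37 by linarith
  have u0: "u > 0" by (simp add: u_def)
  have "lam u \<le> u / (1 - u)\<^sup>2" by (rule lam_bounds) (use u0 u3 in auto)
  also have "\<dots> \<le> u / (1 - 1 / 3)\<^sup>2" using u3 u0 by (intro divide_left_mono power_mono mult_pos_pos zero_less_power) auto
  finally have l: "lam u \<le> 9 / 4 * u" by (simp add: power2_eq_square)
  have E: "norm (Eerr k z) \<le> 27 / 2 * u"
    using norm_Eerr_le[of z k] y0 l unfolding y_def[symmetric] u_def[symmetric] by linarith
  then have E5: "norm (Eerr k z) \<le> 5" using u3 by linarith
  have "exp (A * y) * norm (exp (Eerr k z) - 1) \<le> exp (A * y) * ((27 / 2 * u) * exp 5)"
    using norm_exp_minus_one_le[of "Eerr k z"] E E5 u0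
    by (intro mult_left_mono order.trans[OF norm_exp_minus_one_le] mult_mono) auto
  also have "\<dots> = (exp (A * y) * u) * (27 / 2 * exp 5)" by simp
  also have "\<dots> \<le> 1 * (27 / 2 * exp 5)"
  proof (rule mult_right_mono)
    have "exp (A * y) * u \<le> exp (A * y) * exp (- (A * y))" using u1 by (intro mult_left_mono) auto
    then show "exp (A * y) * u \<le> 1" by (simp add: exp_minus)
  qed simp
  also have "exp (5::real) \<le> 3 ^ 5"
  proof -
    have "exp (5::real) = exp 1 ^ 5" by (simp add: exp_of_nat_mult[symmetric])
    then show ?thesis using power_mono[OF exp_le, of 5] by simp
  qed
  finally show ?thesis by (simp add: y_def)
qed

text \<open>On the minor arcs |F (q)| is compared with F (|q|), whose size follows from the
  transformation at the real point z = x; this is the correction factor there.\<close>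

lemma norm_exp_Eerr_real: "norm (exp (Eerr k (of_real x))) \<le> 51 / 50"
proof -
  define u where "u = exp (- (4 * pi\<^sup>2 * (1 / x) / real (4 * k + 2)))"
  have "A * (1 / x) \<le> 4 * pi\<^sup>2 / real (4 * k + 2) * (1 / x)" using A_le x_bounds by (intro mult_right_mono) auto
  then have "u \<le> exp (- T)" using nu_x(2) by (simp add: u_def mult.commute)
  also have "\<dots> \<le> exp (- 43)" using T by simp
  also have "exp (-43) = 1 / exp (1::real) ^ 43" by (simp add: exp_of_nat_mult[symmetric] exp_minus inverse_eq_divide)
  also have "\<dots> \<le> 1 / 2 ^ 43" using exp_ge_add_one_self[of "1::real"] by (intro divide_left_mono power_mono) auto
  finally have u: "u \<le> 1 / 1000" by simp
  have u0: "u > 0" by (simp add: u_def)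
  have "lam u \<le> u / (1 - u)\<^sup>2" by (rule lam_bounds) (use u0 u in auto)
  also have "\<dots> \<le> u / (1 - 1 / 1000)\<^sup>2" using u u0 by (intro divide_left_mono power_mono mult_pos_pos zero_less_power) auto
  finally have l: "lam u \<le> 1 / 900" using u by (simp add: power2_eq_square)
  have "norm (Eerr k (of_real x)) \<le> 6 * lam u"
    using norm_Eerr_le[of "of_real x" k] x_bounds by (simp add: u_def)
  then have E: "norm (Eerr k (of_real x)) \<le> 1 / 100" using l by linarith
  have "norm (exp (Eerr k (of_real x))) \<le> exp (norm (Eerr k (of_real x)))" by (rule norm_exp)
  also have "\<dots> \<le> exp (1 / 100)" using E by simp
  also have "exp (1 / 100 :: real) \<le> 51 / 50" using exp_bound[of "1 / 100 :: real"] by (simp add: power2_eq_square)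
  finally show ?thesis .
qed

text \<open>The index n in terms of T. The locale is parametrised by T, and
  \<open>Delta_approx\<close> concerns those T for which this value is a natural number.\<close>

definition "n0 = \<nu> + real (k + 1) / 12"

lemma minor_arc:
  assumes z: "z = Complex x \<theta>" and th: "h \<le> \<bar>\<theta>\<bar>" "\<bar>\<theta>\<bar> \<le> pi"
  shows "norm (Fgf k (exp (- z)) * exp (of_real n0 * z)) \<le> x / (2 * pi) * (51 / 50) * exp (2 * T) * exp (3 / 2 - 67 / 100 * T)"
proof -
  define q where "q = exp (- z)"
  define r where "r = exp (- x)"
  have nq: "norm q = r" by (simp add: q_def r_def z)
  have r: "0 < r" "r < 1" using x_bounds by (auto simp: r_def)
  have gap: "lowF k r - Re (lowF k q) \<ge> 67 / 100 * T - 3 / 2"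
  proof -
    \<comment> \<open>Needed is d >= x^2 / (2 (1 - cos theta)). From |theta| >= 6 x and x < 0.0919
      follows 1 - cos theta >= 18 x^2 * 0.9746, and 1 / (36 * 0.9746) lies just below this
      d.\<close>
    define d where "d = (2851 / 100000 :: real)"
    have C: "x\<^sup>2 \<le> 2 * d * (1 - cos \<theta>)"
    proof -
      have "cos \<bar>\<theta>\<bar> \<le> cos h" using th h_pos by (intro cos_monotone_0_pi_le) auto
      moreover have "cos h \<le> 1 - h\<^sup>2 / 2 + h ^ 4 / 24"
      proof -
        obtain t where "cos h = (\<Sum>m<4. cos_coeff m * h ^ m) + cos (t + 1 / 2 * real 4 * pi) / fact 4 * h ^ 4"
          using Maclaurin_cos_expansion[of h 4] by auto
        moreover have "cos (t + 1 / 2 * real 4 * pi) / fact 4 * h ^ 4 \<le> 1 / 24 * h ^ 4"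
          by (intro mult_right_mono) (auto simp: fact_numeral)
        moreover have "(\<Sum>m<4. cos_coeff m * h ^ m) = 1 - h\<^sup>2 / 2"
        proof -
          have "{..<4::nat} = {0, 1, 2, 3}" by auto
          then show ?thesis by (simp add: cos_coeff_def fact_numeral)
        qed
        ultimately show ?thesis by simp
      qed
      ultimately have "1 - cos \<theta> \<ge> h\<^sup>2 / 2 - h ^ 4 / 24" by simp
      moreover have "h\<^sup>2 / 2 - h ^ 4 / 24 = 18 * x\<^sup>2 * (1 - 3 * x\<^sup>2)" by (simp add: h_def power_mult_distrib algebra_simps eval_nat_numeral)
      moreover have "18 * x\<^sup>2 * (1 - 3 * x\<^sup>2) \<ge> 18 * x\<^sup>2 * (9746 / 10000)"
      proof (rule mult_left_mono)
        have "x\<^sup>2 \<le> 0.0919\<^sup>2" using x_bounds by (intro power_mono) auto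
        then show "9746 / 10000 \<le> 1 - 3 * x\<^sup>2" by (simp add: power2_eq_square)
      qed simp
      ultimately have "18 * x\<^sup>2 * (9746 / 10000) \<le> 1 - cos \<theta>" by linarith
      then have "2 * d * (18 * x\<^sup>2 * (9746 / 10000)) \<le> 2 * d * (1 - cos \<theta>)" by (intro mult_left_mono) (auto simp: d_def)
      moreover have "x\<^sup>2 \<le> 2 * d * (18 * x\<^sup>2 * (9746 / 10000))" by (simp add: d_def)
      ultimately show ?thesis by linarith
    qed
    have g: "r / (1 - r) - Re (q / (1 - q)) \<ge> (1 / x - 1 / 2) / (1 + d)"
    proof -
      have "0 \<le> d" "d \<le> 1" "x \<le> 2" using x_bounds by (simp_all add: d_def)
      from gap_lower[OF x_bounds(1) this(1,2) C this(3)] show ?thesis unfolding r_def q_def z .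
    qed
    define a where "a = 2 * k + 1"
    have a2: "4 * k + 2 = 2 * a" "a > 0" by (auto simp: a_def)
    have Re: "Re (q ^ a / (1 - q ^ (2 * a))) \<ge> - (1 / (2 * real a * x))"
      using norm_odd_geometric_le(1)[of q x a] nq[unfolded r_def] x_bounds(1) a2(2) abs_Re_le_cmod[of "q ^ a / (1 - q ^ (2 * a))"] by linarith
    have le: "r ^ a / (1 - r ^ (2 * a)) \<le> 1 / (2 * real a * x)"
      unfolding r_def using norm_odd_geometric_le(2)[OF nq[unfolded r_def] x_bounds(1) a2(2)] .
    have "lowF k r - Re (lowF k q) \<ge> 3 * ((1 / x - 1 / 2) / (1 + d)) - 1 / (real a * x)"
    proof -
      have l: "lowF k v = 3 * (v / (1 - v)) - v ^ a / (1 - v ^ (2 * a))" for v :: "'b :: {real_normed_field, banach}"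
        by (simp only: lowF_def a_def[symmetric] a2)
      have R3: "Re (3 * w) = 3 * Re w" for w by simp
      have lq: "Re (lowF k q) = 3 * Re (q / (1 - q)) - Re (q ^ a / (1 - q ^ (2 * a)))"
        unfolding l minus_complex.sel R3 ..
      have fin: "3 * X - Y \<le> (3 * G - P) - (3 * G' - P')" if "X \<le> G - G'" "- Z \<le> P'" "P \<le> Z" "Z + Z = Y" for X Y Z G G' P P' :: real
        using that by linarith
      have "1 / (2 * real a * x) + 1 / (2 * real a * x) = 1 / (real a * x)" by simp
      from fin[OF g Re le this] show ?thesis unfolding lq l[of r] .
    qed
    moreover have "3 * ((1 / x - 1 / 2) / (1 + d)) - 1 / (real a * x) \<ge> 67 / 100 * T - 3 / 2"
    proof -
      have X: "1 / x = T / A" using A_bounds T by (simp add: x_def)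
      have "3 * ((1 / x - 1 / 2) / (1 + d)) - 1 / (real a * x) = (T / A) * (3 / (1 + d) - 1 / real a) - 3 / 2 / (1 + d)"
      proof -
        have "3 * ((u - 1 / 2) / (1 + d)) - u * (1 / real a) = u * (3 / (1 + d) - 1 / real a) - 3 / 2 / (1 + d)" for u
          by (simp add: algebra_simps diff_divide_distrib)
        moreover have "1 / (real a * x) = 1 / x * (1 / real a)" by simp
        ultimately show ?thesis by (simp only: X)
      qed
      moreover have "3 / 2 / (1 + d) \<le> 3 / 2" by (simp add: d_def)
      moreover have "(T / A) * (3 / (1 + d) - 1 / real a) \<ge> 67 / 100 * T"
      proof -
        \<comment> \<open>The origin of 0.67: the left-hand side divided by A is about 0.673 for k =
          1 and 0.688 for k = 2.\<close>
        have "3 / (1 + d) - 1 / real a \<ge> 67 / 100 * A"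
          using k A_bounds by (auto simp: a_def d_def)
        then have "(T / A) * (67 / 100 * A) \<le> (T / A) * (3 / (1 + d) - 1 / real a)" using T A_bounds by (intro mult_left_mono) auto
        then show ?thesis using A_bounds by simp
      qed
      ultimately show ?thesis by linarith
    qed
    ultimately show ?thesis by linarith
  qed
  have "norm (Fgf k q) = exp (Re (logF k q))" by (simp add: Fgf_def norm_exp_eq_Re)
  also have "\<dots> \<le> exp (Re (logF k (of_real r)) - (lowF k r - Re (lowF k q)))"
    using Re_logF_le[of q k] nq r by simp
  also have "\<dots> \<le> exp (Re (logF k (of_real r)) + (3 / 2 - 67 / 100 * T))" using gap by simp
  also have "\<dots> = norm (Fgf k (exp (- of_real x))) * exp (3 / 2 - 67 / 100 * T)"
    by (simp add: Fgf_def norm_exp_eq_Re exp_add r_def exp_of_real[symmetric])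
  also have "norm (Fgf k (exp (- of_real x))) = x / (2 * pi) * exp (T - real (k + 1) * x / 12) * norm (exp (Eerr k (of_real x)))"
  proof -
    have "of_real (Aconst k / x - real (k + 1) * x / 12) = (of_real (T - real (k + 1) * x / 12) :: complex)"
      using nu_x(2) unfolding A_def by simp
    then have e: "of_real (Aconst k) / of_real x - of_nat (k + 1) * of_real x / 12 = (of_real (T - real (k + 1) * x / 12) :: complex)"
      by (simp only: of_real_diff of_real_divide of_real_mult of_real_of_nat_eq of_real_numeral)
    have e2: "complex_of_real x / (2 * of_real pi) = of_real (x / (2 * pi))" by simp
    have "Re (complex_of_real x) > 0" using x_bounds by simp
    from Fgf_transformation[OF this, of k] show ?thesis
      unfolding e e2 exp_of_real using x_bounds by (simp only: norm_mult norm_of_real) (simp add: abs_of_pos)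
  qed
  also have "\<dots> * exp (3 / 2 - 67 / 100 * T) \<le> (x / (2 * pi) * exp (T - real (k + 1) * x / 12) * (51 / 50)) * exp (3 / 2 - 67 / 100 * T)"
    using norm_exp_Eerr_real x_bounds by (intro mult_right_mono mult_left_mono) auto
  finally have F: "norm (Fgf k q) \<le> x / (2 * pi) * exp (T - real (k + 1) * x / 12) * (51 / 50) * exp (3 / 2 - 67 / 100 * T)" .
  have n: "norm (exp (of_real n0 * z)) = exp (T + real (k + 1) * x / 12)"
    using nu_x(1) by (simp add: norm_exp_eq_Re z n0_def distrib_right)
  have "norm (Fgf k q * exp (of_real n0 * z)) \<le> (x / (2 * pi) * exp (T - real (k + 1) * x / 12) * (51 / 50) * exp (3 / 2 - 67 / 100 * T)) * exp (T + real (k + 1) * x / 12)"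
    unfolding norm_mult n using F by (intro mult_right_mono) auto
  also have "\<dots> = x / (2 * pi) * (51 / 50) * (exp (T - real (k + 1) * x / 12) * exp (T + real (k + 1) * x / 12)) * exp (3 / 2 - 67 / 100 * T)"
    by simp
  also have "exp (T - real (k + 1) * x / 12) * exp (T + real (k + 1) * x / 12) = exp (2 * T)"
    by (simp add: exp_add[symmetric])
  finally show ?thesis by (simp add: q_def)
qed

text \<open>The difference is besH (exp Eerr - 1), and |besH| contains exp (T + A Re (1 / z)).
  \<open>exp_Eerr_major\<close> absorbs the second part of the exponent, so that only exp T remains,
  the square root of the size of the main term up to powers of T.\<close>

lemma major_arc:
  assumes z: "z = Complex x \<theta>" and th: "\<bar>\<theta>\<bar> \<le> h"
  shows "norm (Fgf k (exp (- z)) * exp (of_real n0 * z) - besH A \<nu> z) \<le> \<rho> / (2 * pi) * exp T * 3300"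
proof -
  have Rz: "Re z > 0" using x_bounds z by simp
  then have z0: "z \<noteq> 0" by auto
  have nz: "norm z \<le> \<rho>"
  proof -
    have "(norm z)\<^sup>2 = x\<^sup>2 + \<theta>\<^sup>2" by (simp add: z cmod_power2)
    also have "\<dots> \<le> x\<^sup>2 + h\<^sup>2" using abs_le_square_iff[of \<theta> h] th h_pos by simp
    finally show ?thesis unfolding \<rho>_def by (rule real_le_rsqrt)
  qed
  have Re1: "Re (1 / z) = x / (norm z)\<^sup>2" by (simp add: Re_divide z cmod_power2)
  have y: "1 / (37 * x) \<le> Re (1 / z)"
  proof -
    have "(norm z)\<^sup>2 \<le> 37 * x\<^sup>2" using nz rho2 by (metis norm_ge_zero power_mono)
    then have "x / (37 * x\<^sup>2) \<le> Re (1 / z)" unfolding Re1 using x_bounds z0 by (intro divide_left_mono) auto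
    then show ?thesis using x_bounds by (simp add: power2_eq_square)
  qed
  have "Fgf k (exp (- z)) * exp (of_real n0 * z) = z / (2 * of_real pi) * (exp (of_real (Aconst k) / z - of_nat (k + 1) * z / 12) * exp (of_real n0 * z)) * exp (Eerr k z)"
    by (simp only: Fgf_transformation[OF Rz] mult_ac)
  also have "exp (of_real (Aconst k) / z - of_nat (k + 1) * z / 12) * exp (of_real n0 * z) = exp (of_real A / z + of_real \<nu> * z)"
    unfolding exp_add[symmetric] by (rule arg_cong[of _ _ exp]) (simp add: A_def n0_def algebra_simps)
  also have "z / (2 * of_real pi) * exp (of_real A / z + of_real \<nu> * z) = besH A \<nu> z" by (simp add: besH_def)
  finally have "Fgf k (exp (- z)) * exp (of_real n0 * z) - besH A \<nu> z = besH A \<nu> z * (exp (Eerr k z) - 1)" by (simp add: algebra_simps)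
  then have "norm (Fgf k (exp (- z)) * exp (of_real n0 * z) - besH A \<nu> z) = norm z / (2 * pi) * exp (A * Re z / (norm z)\<^sup>2 + \<nu> * Re z) * norm (exp (Eerr k z) - 1)"
    by (simp only: norm_mult norm_besH[OF z0])
  also have "A * Re z / (norm z)\<^sup>2 + \<nu> * Re z = T + A * Re (1 / z)" unfolding Re1 using nu_x(1) by (simp add: z)
  also have "norm z / (2 * pi) * exp (T + A * Re (1 / z)) * norm (exp (Eerr k z) - 1) = norm z / (2 * pi) * exp T * (exp (A * Re (1 / z)) * norm (exp (Eerr k z) - 1))"
    by (simp add: exp_add)
  also have "\<dots> \<le> \<rho> / (2 * pi) * exp T * 3300"
    using nz exp_Eerr_major[OF y] rho2 by (intro mult_mono divide_right_mono) auto
  finally show ?thesis .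
qed

end

section \<open>Total error of the circle method\<close>

lemma closed_segment_vertical:
  assumes "z \<in> closed_segment (Complex x u) (Complex x v)" "u \<le> v"
  obtains \<theta> where "z = Complex x \<theta>" "u \<le> \<theta>" "\<theta> \<le> v"
proof -
  obtain t where t: "0 \<le> t" "t \<le> 1" "z = (1 - t) *\<^sub>R Complex x u + t *\<^sub>R Complex x v"
    using assms(1) by (auto simp: closed_segment_def)
  have z: "z = Complex x ((1 - t) * u + t * v)" by (simp add: t(3) complex_eq_iff algebra_simps)
  have "t * u \<le> t * v" "(1 - t) * u \<le> (1 - t) * v" using t assms(2) by (auto intro: mult_left_mono)
  then show ?thesis using that[OF z] by (simp add: algebra_simps)
qed

lemma exp_1_lower: "exp (1::real) > 2.718"
proof -
  have "(\<Sum>i<9. (1::real) ^ i /\<^sub>R fact i) \<le> exp 1"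
    unfolding exp_def by (intro sum_le_suminf summable_exp_generic) auto
  moreover have "(\<Sum>i<9. (1::real) ^ i /\<^sub>R fact i) > 2.718"
  proof -
    have "{..<9::nat} = {0, 1, 2, 3, 4, 5, 6, 7, 8}" by auto
    then show ?thesis by (simp add: fact_numeral)
  qed
  ultimately show ?thesis by linarith
qed

lemma exp_three_halves: "exp (3 / 2 :: real) \<le> 4.49"
proof -
  have "exp (3 / 2 :: real) ^ 2 = exp 1 ^ 3" by (simp add: exp_of_nat_mult[symmetric])
  also have "\<dots> \<le> (272 / 100) ^ 3" using e_less_272 by (intro power_mono) auto
  also have "\<dots> \<le> 4.49 ^ 2" by (simp add: power2_eq_square power3_eq_cube)
  finally show ?thesis by (rule power2_le_imp_le) simp
qed

context major_arc
begin

text \<open>\<open>bes_lower\<close> at s = 2 T, where s^2 / 4 = T^2 = A nu. Taking 0.49 instead of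
  1/2 absorbs exp (- 2 T) and the linear term of sinh s - s.\<close>

lemma besM_lower: "2 * pi * besM A \<nu> \<ge> 49 / 400 * x\<^sup>2 * exp (2 * T) / T"
proof -
  have "2 * (sinh (2 * T) - 2 * T) / (2 * T) ^ 3 \<le> bes 2 ((2 * T)\<^sup>2 / 4)" by (rule bes_lower) (use T in simp)
  also have "(2 * T)\<^sup>2 / 4 = A * \<nu>" using nu_x(5) by (simp add: power2_eq_square)
  finally have b: "2 * (sinh (2 * T) - 2 * T) / (2 * T) ^ 3 \<le> bes 2 (A * \<nu>)" .
  have s: "sinh (2 * T) - 2 * T \<ge> 49 / 100 * exp (2 * T)"
  proof -
    have e: "sinh (2 * T) = (exp (2 * T) - exp (- (2 * T))) / 2" by (simp add: sinh_field_def)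
    have "exp (- (2 * T)) \<le> 1" using T by simp
    moreover have "exp (2 * T) \<ge> 100 * (2 * T + 1 / 2)"
    proof -
      have "exp (2 * T) = exp T * exp T" by (simp add: exp_add[symmetric])
      moreover have "exp T \<ge> 1 + T + T\<^sup>2 / 2" by (rule exp_lower_Taylor_quadratic) (use T in simp)
      moreover have "T\<^sup>2 \<ge> 43 * T" using T by (simp add: power2_eq_square)
      ultimately have "exp (2 * T) \<ge> (1 + T + 43 * T / 2) * (1 + T + 43 * T / 2)" using T
        by (simp only:) (intro mult_mono; simp)
      also have "(1 + T + 43 * T / 2) * (1 + T + 43 * T / 2) \<ge> 900 * (1 + T + 43 * T / 2)"
        using T by (intro mult_right_mono) auto
      finally show ?thesis using T by simp
    qed
    moreover have "49 / 100 * E \<le> (E - F) / 2 - 2 * T" if "F \<le> 1" "100 * (2 * T + 1 / 2) \<le> E" for E F :: real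
      using that by (simp add: field_simps)
    ultimately show ?thesis unfolding e by blast
  qed
  have "49 / 400 * exp (2 * T) / T ^ 3 = 2 * (49 / 100 * exp (2 * T)) / (2 * T) ^ 3"
    by (simp add: power_mult_distrib)
  also have "\<dots> \<le> 2 * (sinh (2 * T) - 2 * T) / (2 * T) ^ 3" using s T by (intro divide_right_mono mult_left_mono) auto
  finally have "A\<^sup>2 * (49 / 400 * exp (2 * T) / T ^ 3) \<le> A\<^sup>2 * bes 2 (A * \<nu>)" using b by (intro mult_left_mono) auto
  also have "A\<^sup>2 * bes 2 (A * \<nu>) = 2 * pi * besM A \<nu>" by (simp add: besM_def)
  also have "A\<^sup>2 * (49 / 400 * exp (2 * T) / T ^ 3) = 49 / 400 * x\<^sup>2 * exp (2 * T) / T"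
    using T by (simp add: x_def power2_eq_square power3_eq_cube)
  finally show ?thesis .
qed

text \<open>The summands are the minor arcs, the major arc, and the arc completing the main term. In
  units of w the first costs 1.195 and the other two together 0.150, which is less than 11 * 49 /
  400 = 1.3475; this is the origin of the 11.\<close>

lemma total_error:
  "x * (51 / 50) * exp (2 * T) * exp (3 / 2 - 67 / 100 * T) + 2 * h * (\<rho> / (2 * pi) * exp T * 3300) + \<rho>\<^sup>2 * exp (38 / 37 * T)
    \<le> 11 * T\<^sup>2 * exp (- (67 / 100 * T)) * (2 * pi * besM A \<nu>)"
proof -
  define w where "w = x\<^sup>2 * T * exp (2 * T) * exp (- (67 / 100 * T))"
  have xT: "x = x\<^sup>2 * T / A" using A_bounds T by (simp add: x_def power2_eq_square)
  have 1: "x * (51 / 50) * exp (2 * T) * exp (3 / 2 - 67 / 100 * T) \<le> 1195 / 1000 * w"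
  proof -
    have "exp (3 / 2) / A * (51 / 50) \<le> 1195 / (1000::real)"
    proof -
      have "exp (3 / 2) * (51 / 50) \<le> 4.49 * (51 / 50 :: real)" using exp_three_halves by simp
      also have "\<dots> \<le> 1195 / 1000 * A" using A_bounds by simp
      finally show ?thesis using A_bounds by (simp add: field_simps)
    qed
    then have "exp (3 / 2) / A * (51 / 50) * w \<le> 1195 / 1000 * w" unfolding w_def using T by (intro mult_right_mono) auto
    moreover have "x * (51 / 50) * exp (2 * T) * exp (3 / 2 - 67 / 100 * T) = exp (3 / 2) / A * (51 / 50) * w"
    proof -
      have "exp (3 / 2 - 67 / 100 * T) = exp (3 / 2) * exp (- (67 / 100 * T))" by (simp add: exp_add[symmetric])
      then have "x * (51 / 50) * exp (2 * T) * exp (3 / 2 - 67 / 100 * T) = x * ((51 / 50) * exp (2 * T) * (exp (3 / 2) * exp (- (67 / 100 * T))))"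
        by (simp only: mult.assoc)
      also have "\<dots> = (x\<^sup>2 * T / A) * ((51 / 50) * exp (2 * T) * (exp (3 / 2) * exp (- (67 / 100 * T))))"
        by (subst xT) (rule refl)
      finally show ?thesis by (simp add: w_def mult_ac)
    qed
    ultimately show ?thesis by simp
  qed
  have \<rho>x: "\<rho> \<le> 61 / 10 * x"
  proof (rule power2_le_imp_le)
    show "\<rho>\<^sup>2 \<le> (61 / 10 * x)\<^sup>2" unfolding rho2(1) power_mult_distrib by (intro mult_right_mono) (auto simp: power2_eq_square)
  qed (use x_bounds in auto)
  have 2: "2 * h * (\<rho> / (2 * pi) * exp T * 3300) + \<rho>\<^sup>2 * exp (38 / 37 * T) \<le> 150 / 1000 * w"
  proof -
    have "2 * h * (\<rho> / (2 * pi) * exp T * 3300) \<le> 2 * h * ((61 / 10 * x) / (2 * 3.1) * exp (38 / 37 * T) * 3300)"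
      using \<rho>x rho2 h_pos x_bounds T pi_bounds by (intro mult_mono mult_left_mono frac_le) auto
    moreover have "2 * h * ((61 / 10 * x) / (2 * 3.1) * exp (38 / 37 * T) * 3300) = 2415600 / 62 * (x\<^sup>2 * exp (38 / 37 * T))"
      by (simp add: h_def power2_eq_square)
    moreover have "\<rho>\<^sup>2 * exp (38 / 37 * T) = 37 * (x\<^sup>2 * exp (38 / 37 * T))" unfolding rho2(1) by simp
    moreover have "x\<^sup>2 * exp (38 / 37 * T) \<ge> 0" by simp
    ultimately have "2 * h * (\<rho> / (2 * pi) * exp T * 3300) + \<rho>\<^sup>2 * exp (38 / 37 * T) \<le> 39100 * (x\<^sup>2 * exp (38 / 37 * T))"
      by linarith
    also have "\<dots> \<le> 150 / 1000 * w"
    proof -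
      \<comment> \<open>38/37 + 3/10 < 133/100 = 2 - 67/100, so a factor exp (0.3 T) >= 100000 is
        available to beat the constant 39100.\<close>
      have "exp (3 / 10 * T) \<ge> exp 12" using T by simp
      also have "exp (12::real) = exp 1 ^ 12" by (simp add: exp_of_nat_mult[symmetric])
      also have "exp 1 ^ 12 \<ge> (2.7::real) ^ 12" using exp_1_lower by (intro power_mono) auto
      also have "(2.7::real) ^ 12 \<ge> 100000" by (simp add: power_divide)
      finally have e: "exp (3 / 10 * T) \<ge> 100000" .
      have "39100 * exp (38 / 37 * T) \<le> 150 / 1000 * (T * exp (133 / 100 * T))"
      proof -
        have "exp (38 / 37 * T) * 100000 \<le> exp (38 / 37 * T) * exp (3 / 10 * T)" using e by (intro mult_left_mono) auto
        also have "\<dots> = exp (38 / 37 * T + 3 / 10 * T)" by (simp only: exp_add)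
        also have "\<dots> \<le> exp (133 / 100 * T)" using T by simp
        finally have "exp (38 / 37 * T) * 100000 \<le> exp (133 / 100 * T)" .
        moreover have "43 * exp (133 / 100 * T) \<le> T * exp (133 / 100 * T)" using T by (intro mult_right_mono) auto
        moreover have "exp (38 / 37 * T) > 0" by simp
        ultimately show ?thesis by linarith
      qed
      then have "x\<^sup>2 * (39100 * exp (38 / 37 * T)) \<le> x\<^sup>2 * (150 / 1000 * (T * exp (133 / 100 * T)))" by (intro mult_left_mono) auto
      moreover have "exp (133 / 100 * T) = exp (2 * T) * exp (- (67 / 100 * T))" by (simp add: exp_add[symmetric])
      ultimately show ?thesis by (simp add: w_def mult_ac)
    qed
    finally show ?thesis .
  qed
  have 3: "11 * T\<^sup>2 * exp (- (67 / 100 * T)) * (2 * pi * besM A \<nu>) \<ge> 1347 / 1000 * w"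
  proof -
    have "11 * T\<^sup>2 * exp (- (67 / 100 * T)) * (49 / 400 * x\<^sup>2 * exp (2 * T) / T) \<le> 11 * T\<^sup>2 * exp (- (67 / 100 * T)) * (2 * pi * besM A \<nu>)"
      using besM_lower by (intro mult_left_mono) auto
    moreover have "11 * T\<^sup>2 * exp (- (67 / 100 * T)) * (49 / 400 * x\<^sup>2 * exp (2 * T) / T) = 539 / 400 * w"
      using T by (simp add: w_def power2_eq_square)
    moreover have "w \<ge> 0" using T by (simp add: w_def)
    ultimately show ?thesis by linarith
  qed
  have "w \<ge> 0" using T by (simp add: w_def)
  with 1 2 3 show ?thesis by linarith
qed

theorem Delta_approx:
  assumes n: "n0 = real n"
  shows "\<bar>Delta k n - besM A \<nu>\<bar> \<le> 11 * T\<^sup>2 * exp (- (67 / 100 * T)) * besM A \<nu>"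
proof -
  define G where "G z = Fgf k (exp (- z)) * exp (of_nat n * z)" for z
  have G': "G z = Fgf k (exp (- z)) * exp (of_real n0 * z)" for z by (simp add: G_def n)
  define p where "p u = Complex x u" for u
  define Bm where "Bm = x / (2 * pi) * (51 / 50) * exp (2 * T) * exp (3 / 2 - 67 / 100 * T)"
  define BM where "BM = \<rho> / (2 * pi) * exp T * 3300"
  have B0: "Bm \<ge> 0" "BM \<ge> 0" using x_bounds rho2 by (auto simp: Bm_def BM_def)
  have tot: "(G has_contour_integral (2 * pi * \<i> * of_real (Delta k n))) (linepath (p (- pi)) (p pi))"
    unfolding G_def p_def by (rule Delta_integral[OF x_bounds(1)])
  have holG: "G holomorphic_on {z. Re z > 0}"
    unfolding G_def
    by (intro holomorphic_intros holomorphic_on_compose_gen[OF _ Fgf_holomorphic, unfolded o_def]) auto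
  have cont: "continuous_on (closed_segment (p u) (p v)) G" for u v
  proof (rule continuous_on_subset[OF holomorphic_on_imp_continuous_on[OF holG]])
    show "closed_segment (p u) (p v) \<subseteq> {z. Re z > 0}"
      by (rule closed_segment_subset) (use x_bounds in \<open>auto simp: p_def convex_halfspace_Re_gt\<close>)
  qed
  have int: "(G has_contour_integral (contour_integral (linepath (p u) (p v)) G)) (linepath (p u) (p v))" for u v
    by (intro has_contour_integral_integral contour_integrable_continuous_linepath cont)
  have mem: "p v \<in> closed_segment (p u) (p w)" if "u \<le> v" "v \<le> w" for u v w
  proof (cases "u = w")
    case True then show ?thesis using that by (simp add: p_def)
  next
    case False
    define t where "t = (v - u) / (w - u)"
    have "t * (w - u) = v - u" using False by (simp add: t_def)
    then have "v = (1 - t) * u + t * w" by (simp add: algebra_simps)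
    then have "p v = (1 - t) *\<^sub>R p u + t *\<^sub>R p w"
      by (simp add: p_def complex_eq_iff algebra_simps)
    moreover have "0 \<le> t" "t \<le> 1" using that False by (auto simp: t_def field_simps)
    ultimately show ?thesis unfolding in_segment by blast
  qed
  define I1 I2 I3 where "I1 = contour_integral (linepath (p (- pi)) (p (- h))) G"
    and "I2 = contour_integral (linepath (p (- h)) (p h)) G" and "I3 = contour_integral (linepath (p h) (p pi)) G"
  have split: "2 * pi * \<i> * of_real (Delta k n) = I1 + (I2 + I3)"
  proof -
    have "contour_integral (linepath (p (- pi)) (p pi)) G = I1 + contour_integral (linepath (p (- h)) (p pi)) G"
      unfolding I1_def by (rule contour_integral_split_linepath[OF cont mem]) (use h_pos in auto)
    also have "contour_integral (linepath (p (- h)) (p pi)) G = I2 + I3"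
      unfolding I2_def I3_def by (rule contour_integral_split_linepath[OF cont mem]) (use h_pos in auto)
    finally show ?thesis using contour_integral_unique[OF tot] by simp
  qed
  have npp: "norm (p v - p u) = v - u" if "u \<le> v" for u v
  proof -
    have "p v - p u = \<i> * of_real (v - u)" by (simp add: p_def complex_eq_iff)
    then have "norm (p v - p u) = norm \<i> * norm (complex_of_real (v - u))" by (simp only: norm_mult)
    then show ?thesis using that by (simp del: of_real_diff)
  qed
  have n1: "norm I1 \<le> Bm * (pi - h)"
  proof -
    have "norm I1 \<le> Bm * norm (p (- h) - p (- pi))"
      unfolding I1_def
    proof (rule has_contour_integral_bound_linepath[OF int B0(1)])
      fix z assume "z \<in> closed_segment (p (- pi)) (p (- h))"
      then obtain \<theta> where "z = Complex x \<theta>" "- pi \<le> \<theta>" "\<theta> \<le> - h"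
        using h_pos unfolding p_def by (elim closed_segment_vertical) auto
      then show "norm (G z) \<le> Bm" unfolding G' Bm_def using h_pos by (intro minor_arc) auto
    qed
    then show ?thesis using npp[of "- pi" "- h"] h_pos by simp
  qed
  have n3: "norm I3 \<le> Bm * (pi - h)"
  proof -
    have "norm I3 \<le> Bm * norm (p pi - p h)"
      unfolding I3_def
    proof (rule has_contour_integral_bound_linepath[OF int B0(1)])
      fix z assume "z \<in> closed_segment (p h) (p pi)"
      then obtain \<theta> where "z = Complex x \<theta>" "h \<le> \<theta>" "\<theta> \<le> pi"
        using h_pos unfolding p_def by (elim closed_segment_vertical) auto
      then show "norm (G z) \<le> Bm" unfolding G' Bm_def using h_pos by (intro minor_arc) auto
    qed
    then show ?thesis using npp[of h pi] h_pos by simp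
  qed
  obtain J where J: "(besH A \<nu> has_contour_integral J) (linepath (p (- h)) (p h))"
    and Jb: "norm (2 * pi * \<i> * of_real (besM A \<nu>) - J) \<le> \<rho>\<^sup>2 * exp ((A / \<rho>\<^sup>2 + \<nu>) * x)"
    using besH_segment_integral[OF x_bounds(1) h_pos(1), of A \<nu>] A_bounds nu_x(3) unfolding p_def \<rho>_def by auto
  have n2: "norm (I2 - J) \<le> BM * (2 * h)"
  proof -
    have "((\<lambda>z. G z - besH A \<nu> z) has_contour_integral (I2 - J)) (linepath (p (- h)) (p h))"
      unfolding I2_def by (intro has_contour_integral_diff int J)
    then have "norm (I2 - J) \<le> BM * norm (p h - p (- h))"
    proof (rule has_contour_integral_bound_linepath[OF _ B0(2)])
      fix z assume "z \<in> closed_segment (p (- h)) (p h)"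
      then obtain \<theta> where "z = Complex x \<theta>" "- h \<le> \<theta>" "\<theta> \<le> h"
        using h_pos unfolding p_def by (elim closed_segment_vertical) auto
      then show "norm (G z - besH A \<nu> z) \<le> BM" unfolding G' BM_def by (intro major_arc) auto
    qed
    then show ?thesis using npp[of "- h" h] h_pos by simp
  qed
  \<comment> \<open>On the completing circle |z|^2 = 37 x^2, so the two parts of the exponent are T
    / 37 and T.\<close>
  have ex: "(A / \<rho>\<^sup>2 + \<nu>) * x = 38 / 37 * T"
  proof -
    have "(A / \<rho>\<^sup>2 + \<nu>) * x = A / x / 37 + \<nu> * x" unfolding rho2(1) using x_bounds by (simp add: field_simps power2_eq_square)
    then show ?thesis unfolding nu_x by simp
  qed
  have "2 * pi * \<bar>Delta k n - besM A \<nu>\<bar> = norm (2 * pi * \<i> * of_real (Delta k n - besM A \<nu>))"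
    by (simp only: norm_mult norm_of_real norm_ii) simp
  also have "2 * pi * \<i> * of_real (Delta k n - besM A \<nu>) = I1 + I3 + (I2 - J) - (2 * pi * \<i> * of_real (besM A \<nu>) - J)"
    using split by (simp only: of_real_diff right_diff_distrib) simp
  also have "norm \<dots> \<le> norm I1 + norm I3 + norm (I2 - J) + norm (2 * pi * \<i> * of_real (besM A \<nu>) - J)"
    by norm
  also have "\<dots> \<le> Bm * (pi - h) + Bm * (pi - h) + BM * (2 * h) + \<rho>\<^sup>2 * exp (38 / 37 * T)"
    using n1 n2 n3 Jb unfolding ex by linarith
  also have "\<dots> \<le> Bm * (2 * pi) + 2 * h * BM + \<rho>\<^sup>2 * exp (38 / 37 * T)"
    using B0 h_pos by (simp add: algebra_simps)
  also have "Bm * (2 * pi) = x * (51 / 50) * exp (2 * T) * exp (3 / 2 - 67 / 100 * T)"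
    by (simp add: Bm_def)
  also have "x * (51 / 50) * exp (2 * T) * exp (3 / 2 - 67 / 100 * T) + 2 * h * BM + \<rho>\<^sup>2 * exp (38 / 37 * T) \<le> 11 * T\<^sup>2 * exp (- (67 / 100 * T)) * (2 * pi * besM A \<nu>)"
    unfolding BM_def by (rule total_error)
  finally have "2 * pi * \<bar>Delta k n - besM A \<nu>\<bar> \<le> 2 * pi * (11 * T\<^sup>2 * exp (- (67 / 100 * T)) * besM A \<nu>)"
    by (simp add: mult_ac)
  then show ?thesis by (rule mult_left_le_imp_le) simp
qed

end

section \<open>The inequality for large arguments\<close>

text \<open>Lets one error bound, taken at the smallest of four values of T, serve for all of them.
  With delta = T' - T, it suffices that T' <= T exp (delta / T) and delta / T <= delta / 43 <= 0.335
  delta.\<close>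

lemma square_mult_exp_decreasing:
  fixes T T' :: real
  assumes "43 \<le> T" "T \<le> T'"
  shows "T'\<^sup>2 * exp (- (67 / 100 * T')) \<le> T\<^sup>2 * exp (- (67 / 100 * T))"
proof -
  define \<delta> where "\<delta> = T' - T"
  have \<delta>: "\<delta> \<ge> 0" "T' = T + \<delta>" using assms by (auto simp: \<delta>_def)
  have "T' \<le> T * exp (\<delta> / T)"
  proof -
    have "T * (1 + \<delta> / T) \<le> T * exp (\<delta> / T)" using assms by (intro mult_left_mono) auto
    then show ?thesis using assms by (simp add: \<delta>(2) distrib_left)
  qed
  also have "\<dots> \<le> T * exp (67 / 200 * \<delta>)"
  proof -
    have "\<delta> / T \<le> \<delta> / 43" using assms \<delta> by (intro divide_left_mono) auto
    then have "\<delta> / T \<le> 67 / 200 * \<delta>" using \<delta> by simp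
    then show ?thesis using assms by simp
  qed
  finally have "T'\<^sup>2 \<le> (T * exp (67 / 200 * \<delta>))\<^sup>2" using assms by (intro power_mono) auto
  also have "\<dots> = T\<^sup>2 * exp (67 / 100 * \<delta>)" by (simp add: power_mult_distrib exp_double[symmetric])
  finally have "T'\<^sup>2 * exp (- (67 / 100 * T')) \<le> T\<^sup>2 * exp (67 / 100 * \<delta>) * exp (- (67 / 100 * T'))"
    by (intro mult_right_mono) auto
  also have "\<dots> = T\<^sup>2 * (exp (67 / 100 * \<delta>) * exp (- (67 / 100 * T')))" by simp
  also have "exp (67 / 100 * \<delta>) * exp (- (67 / 100 * T')) = exp (- (67 / 100 * T))"
    by (simp add: \<delta>(2) exp_add[symmetric] algebra_simps)
  finally show ?thesis .
qed

text \<open>The form in which the error loses against the third difference; 57/10 exceeds 132 /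
  23.2. The seventh root leaves a linear function against an exponential, for which a tangent line
  at T = 43 suffices; 1.3^7 exceeds 5.7.\<close>

lemma power7_less_exp:
  fixes T :: real
  assumes T: "43 \<le> T"
  shows "57 / 10 * T ^ 7 < exp (67 / 100 * T)"
proof -
  have e: "exp (67 / 700 * 43 :: real) \<ge> 60"
  proof -
    have "exp (67 / 700 * 43 :: real) = exp 1 ^ 4 * exp (67 / 700 * 43 - 4)"
      by (simp add: exp_of_nat_mult[symmetric] exp_add[symmetric])
    moreover have "exp (67 / 700 * 43 - 4) \<ge> 1 + (67 / 700 * 43 - 4 :: real)" by (rule exp_ge_add_one_self)
    moreover have "exp 1 ^ 4 \<ge> (2.718 :: real) ^ 4" using exp_1_lower by (intro power_mono) auto
    ultimately have "exp (67 / 700 * 43 :: real) \<ge> 2.718 ^ 4 * (1 + (67 / 700 * 43 - 4))"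
      by (simp only:) (intro mult_mono; simp)
    then show ?thesis by (simp add: eval_nat_numeral)
  qed
  have "13 / 10 * T < 60 * (1 + 67 / 700 * (T - 43))" using T by (simp add: field_simps)
  also have "\<dots> \<le> exp (67 / 700 * 43) * exp (67 / 700 * (T - 43))"
    using e T by (intro mult_mono exp_ge_add_one_self) auto
  also have "\<dots> = exp (67 / 700 * T)" unfolding exp_add[symmetric] by (rule arg_cong[of _ _ exp]) (simp add: field_simps)
  finally have "(13 / 10 * T) ^ 7 < exp (67 / 700 * T) ^ 7" using T by (intro power_strict_mono) auto
  also have "\<dots> = exp (67 / 100 * T)" by (simp add: exp_of_nat_mult[symmetric])
  finally have "(13 / 10) ^ 7 * T ^ 7 < exp (67 / 100 * T)" by (simp only: power_mult_distrib)
  moreover have "57 / 10 * T ^ 7 \<le> (13 / 10) ^ 7 * T ^ 7" using T by (intro mult_right_mono) (auto simp: eval_nat_numeral)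
  ultimately show ?thesis by linarith
qed

lemma ln_error_bounds:
  fixes \<epsilon> D M :: real
  assumes "0 \<le> \<epsilon>" "\<epsilon> \<le> 1 / 2" "M > 0" "\<bar>D - M\<bar> \<le> \<epsilon> * M"
  shows "D > 0" "ln M - 2 * \<epsilon> \<le> ln D" "ln D \<le> ln M + \<epsilon>"
proof -
  have lo: "(1 - \<epsilon>) * M \<le> D" and hi: "D \<le> (1 + \<epsilon>) * M" using assms(4) by (auto simp: algebra_simps abs_le_iff)
  have p: "(1 - \<epsilon>) * M > 0" using assms by simp
  then show D: "D > 0" using lo by linarith
  have "1 / (1 - \<epsilon>) \<le> 1 + 2 * \<epsilon>"
  proof -
    have "0 \<le> \<epsilon> * (1 - 2 * \<epsilon>)" using assms by simp
    then have "1 \<le> (1 + 2 * \<epsilon>) * (1 - \<epsilon>)" by (simp add: algebra_simps)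
    then show ?thesis using assms by (simp add: divide_le_eq)
  qed
  moreover have "ln (1 / (1 - \<epsilon>)) \<le> 1 / (1 - \<epsilon>) - 1" using assms by (intro ln_le_minus_one) auto
  ultimately have "- ln (1 - \<epsilon>) \<le> 2 * \<epsilon>" using assms by (simp add: ln_div)
  moreover have "ln ((1 - \<epsilon>) * M) \<le> ln D" using lo p by simp
  moreover have "ln ((1 - \<epsilon>) * M) = ln (1 - \<epsilon>) + ln M" using assms by (simp add: ln_mult)
  ultimately show "ln M - 2 * \<epsilon> \<le> ln D" by linarith
  have "ln D \<le> ln ((1 + \<epsilon>) * M)" using hi D by (subst ln_le_cancel_iff) auto
  also have "\<dots> = ln (1 + \<epsilon>) + ln M" using assms by (simp add: ln_mult)
  also have "ln (1 + \<epsilon>) \<le> \<epsilon>" using assms by (intro ln_add_one_self_le_self) auto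
  finally show "ln D \<le> ln M + \<epsilon>" by simp
qed

theorem Theta_increasing_large:
  assumes k: "k = 1 \<or> k = 2" and n: "n \<ge> 484"
  shows "Theta k n < Theta k (n + 1)"
proof -
  define A where "A = Aconst k"
  \<comment> \<open>The parameter of index n - 1, the smallest of the indices n - 1, ..., n + 2 on
    which the two values of \<open>Theta\<close> depend.\<close>
  define \<nu> where "\<nu> = real n - 1 - real (k + 1) / 12"
  have pi2: "9.8695 < pi\<^sup>2" "pi\<^sup>2 < 9.8697"
  proof -
    interpret major_arc k 43 by unfold_locales (use k in auto)
    show "9.8695 < pi\<^sup>2" "pi\<^sup>2 < 9.8697" using pi2_bounds by auto
  qed
  have A: "3.838 < A" "A < 3.95" using k pi2 by (auto simp: A_def Aconst_def)
  have \<nu>: "\<nu> \<ge> 482.75" using k n by (auto simp: \<nu>_def)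
  define T where "T i = sqrt (A * (\<nu> + real i))" for i :: nat
  have T2: "(T i)\<^sup>2 = A * (\<nu> + real i)" for i unfolding T_def using A \<nu> by simp
  have T0: "T 0 \<ge> 43" unfolding T_def
  proof (rule real_le_rsqrt)
    have "3.838 * 482.75 \<le> A * \<nu>" using A \<nu> by (intro mult_mono) auto
    then show "43\<^sup>2 \<le> A * (\<nu> + real 0)" by simp
  qed
  have Tm: "T 0 \<le> T i" for i unfolding T_def using A by (intro real_sqrt_le_mono mult_left_mono) auto
  define \<epsilon> where "\<epsilon> = 11 * ((T 0)\<^sup>2 * exp (- (67 / 100 * T 0)))"
  define M where "M i = besM A (\<nu> + real i)" for i :: nat
  have Mpos: "M i > 0" for i
    unfolding M_def besM_def using A \<nu> by (intro mult_pos_pos divide_pos_pos bes_pos) auto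
  have approx: "\<bar>Delta k (n - 1 + i) - M i\<bar> \<le> \<epsilon> * M i" for i
  proof -
    interpret m: major_arc k "T i" by unfold_locales (use k T0 Tm[of i] in auto)
    have Ai: "m.A = A" by (simp add: m.A_def A_def)
    have \<nu>i: "m.\<nu> = \<nu> + real i" unfolding m.\<nu>_def Ai T2 using A by simp
    have "m.n0 = real (n - 1 + i)" unfolding m.n0_def \<nu>i \<nu>_def using n by (simp add: of_nat_diff)
    from m.Delta_approx[OF this] have "\<bar>Delta k (n - 1 + i) - M i\<bar> \<le> 11 * (T i)\<^sup>2 * exp (- (67 / 100 * T i)) * M i"
      unfolding Ai \<nu>i M_def .
    also have "\<dots> \<le> \<epsilon> * M i"
      using square_mult_exp_decreasing[OF T0 Tm[of i]] Mpos[of i] unfolding \<epsilon>_def by (intro mult_right_mono) auto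
    finally show ?thesis .
  qed
  have T00: "T 0 > 0" using T0 by simp
  \<comment> \<open>132 = 12 * 11. With coefficients 1, -3, 3, -1, a lower error 2 eps and an upper
    error eps, the logarithms lose 2 + 3 + 6 + 1 = 12 times eps.\<close>
  have \<epsilon>b: "132 * ((T 0)\<^sup>2 * exp (- (67 / 100 * T 0))) < 232 / 10 / (T 0) ^ 5"
  proof -
    have "132 * ((T 0)\<^sup>2 * exp (- (67 / 100 * T 0))) * (T 0) ^ 5 = 132 * (T 0) ^ 7 * exp (- (67 / 100 * T 0))"
      by (simp add: eval_nat_numeral)
    also have "\<dots> < 232 / 10"
    proof -
      have "132 * (T 0) ^ 7 < 232 / 10 * exp (67 / 100 * T 0)" using power7_less_exp[OF T0] T00 zero_less_power[OF T00, of 7] by linarith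
      then have "132 * (T 0) ^ 7 * exp (- (67 / 100 * T 0)) < 232 / 10 * exp (67 / 100 * T 0) * exp (- (67 / 100 * T 0))"
        by (intro mult_strict_right_mono) auto
      also have "232 / 10 * exp (67 / 100 * T 0) * exp (- (67 / 100 * T 0)) = 232 / 10 * (exp (67 / 100 * T 0) * exp (- (67 / 100 * T 0)))" by simp
      also have "exp (67 / 100 * T 0) * exp (- (67 / 100 * T 0)) = 1" by (simp add: exp_add[symmetric])
      finally show ?thesis by simp
    qed
    finally show ?thesis using T00 by (simp add: pos_less_divide_eq)
  qed
  have "(T 0) ^ 5 \<ge> 43 ^ 5" using T0 by (intro power_mono) auto
  then have "232 / 10 / (T 0) ^ 5 \<le> 232 / 10 / 43 ^ 5" using T00 by (intro divide_left_mono) auto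
  moreover have "(232 / 10 / 43 ^ 5 :: real) \<le> 1" by simp
  ultimately have \<epsilon>: "0 \<le> \<epsilon>" "\<epsilon> \<le> 1 / 2" using \<epsilon>b by (auto simp: \<epsilon>_def)
  note ln = ln_error_bounds[OF \<epsilon> Mpos approx]
  have L: "ln (M i) = ln (A\<^sup>2 / (2 * pi)) + ln (bes 2 (A * (\<nu> + real i)))" for i
    unfolding M_def besM_def using A \<nu> bes_pos[of "A * (\<nu> + real i)" 2] by (intro ln_mult_pos) auto
  \<comment> \<open>For T >= 43 the base of the fifth power is at most T + 1.7 <= 1.04 T, and 1.04^5
    < 1.217; 23.2 is just below 56.5 / (2 * 1.217), where A^3 >= 56.5.\<close>
  have third: "ln (M 3) - 3 * ln (M 2) + 3 * ln (M 1) - ln (M 0) \<ge> 232 / 10 / (T 0) ^ 5"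
  proof -
    have "232 / 10 / (T 0) ^ 5 \<le> A ^ 3 / (2 * (3 / 2 + sqrt (A * (\<nu> + 3) + 9 / 4)) ^ 5)"
    proof -
      have "sqrt (A * (\<nu> + 3) + 9 / 4) \<le> T 0 + 1 / 5"
      proof (rule real_le_lsqrt)
        have "A * (\<nu> + 3) + 9 / 4 = (T 0)\<^sup>2 + 3 * A + 9 / 4" unfolding T2 by (simp add: algebra_simps)
        also have "\<dots> \<le> (T 0)\<^sup>2 + 2 / 5 * T 0 + 1 / 25" using A T0 by simp
        also have "\<dots> = (T 0 + 1 / 5)\<^sup>2" by (simp add: power2_eq_square algebra_simps)
        finally show "A * (\<nu> + 3) + 9 / 4 \<le> (T 0 + 1 / 5)\<^sup>2" .
      qed (use T0 in auto)
      then have "3 / 2 + sqrt (A * (\<nu> + 3) + 9 / 4) \<le> 104 / 100 * T 0" using T0 by linarith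
      moreover have s0: "0 < 3 / 2 + sqrt (A * (\<nu> + 3) + 9 / 4)" using A \<nu> by (intro add_pos_nonneg) auto
      ultimately have "(3 / 2 + sqrt (A * (\<nu> + 3) + 9 / 4)) ^ 5 \<le> (104 / 100 * T 0) ^ 5" by (intro power_mono) auto
      also have "\<dots> \<le> 1217 / 1000 * (T 0) ^ 5" unfolding power_mult_distrib using T00 by (intro mult_right_mono) (auto simp: eval_nat_numeral)
      finally have b: "(3 / 2 + sqrt (A * (\<nu> + 3) + 9 / 4)) ^ 5 \<le> 1217 / 1000 * (T 0) ^ 5" .
      have "3.838 ^ 3 \<le> A ^ 3" using A by (intro power_mono) auto
      then have a3: "56.5 \<le> A ^ 3" by (simp add: power3_eq_cube)
      have "232 / 10 / (T 0) ^ 5 \<le> 56.5 / (2 * (1217 / 1000 * (T 0) ^ 5))" using T00 by (simp add: field_simps)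
      also have "\<dots> \<le> A ^ 3 / (2 * (3 / 2 + sqrt (A * (\<nu> + 3) + 9 / 4)) ^ 5)"
        using a3 b s0 A by (intro frac_le) auto
      finally show ?thesis .
    qed
    also have "\<dots> \<le> ln (bes 2 (A * (\<nu> + 3))) - 3 * ln (bes 2 (A * (\<nu> + 2))) + 3 * ln (bes 2 (A * (\<nu> + 1))) - ln (bes 2 (A * \<nu>))"
      by (rule ln_bes_third_difference) (use A \<nu> in auto)
    finally show ?thesis unfolding L by simp
  qed
  define D where "D i = Delta k (n - 1 + i)" for i
  have Dp: "D i > 0" for i using ln(1)[of i] by (simp add: D_def)
  have "12 * \<epsilon> < 232 / 10 / (T 0) ^ 5" using \<epsilon>b by (simp add: \<epsilon>_def)
  then have main: "ln (D 3) - 3 * ln (D 2) + 3 * ln (D 1) - ln (D 0) > 0"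
    using third ln(2)[of 3] ln(3)[of 2] ln(2)[of 1] ln(3)[of 0] unfolding D_def[symmetric] by linarith
  have "ln (D 0 * D 2 / (D 1)\<^sup>2) = ln (D 0) + ln (D 2) - 2 * ln (D 1)"
    using Dp[of 0] Dp[of 1] Dp[of 2] by (simp add: ln_div ln_mult ln_realpow)
  moreover have "ln (D 1 * D 3 / (D 2)\<^sup>2) = ln (D 1) + ln (D 3) - 2 * ln (D 2)"
    using Dp[of 1] Dp[of 2] Dp[of 3] by (simp add: ln_div ln_mult ln_realpow)
  ultimately have "ln (D 0 * D 2 / (D 1)\<^sup>2) < ln (D 1 * D 3 / (D 2)\<^sup>2)" using main by linarith
  then have "D 0 * D 2 / (D 1)\<^sup>2 < D 1 * D 3 / (D 2)\<^sup>2"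
    using Dp[of 0] Dp[of 1] Dp[of 2] Dp[of 3] by (subst (asm) ln_less_cancel_iff) (auto intro!: divide_pos_pos)
  moreover have "n - 1 + 0 = n - 1" "n - 1 + 1 = n" "n - 1 + 2 = n + 1" "n - 1 + 3 = n + 2" using n by auto
  ultimately show ?thesis unfolding Theta_def D_def by simp
qed

section \<open>Computing the coefficients\<close>

text \<open>
  A mask lists the coefficients in {0, 1, -1} of (1 - E(q)) / q, where E is an Euler product in powers
  of q; MZ8 stands for eight zeros. In mask_dot, positive and negative contributions are accumulated
  separately because addition of integers is much cheaper than subtraction when evaluated by rewriting.
  The lists of previous coefficients are kept in reverse order.
\<close>
datatype mask = MEnd | MP mask | MM mask | MZ mask | MZ8 mask

fun zeros :: "nat \<Rightarrow> mask \<Rightarrow> mask" where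
  "zeros (Suc (Suc (Suc (Suc (Suc (Suc (Suc (Suc n)))))))) m = MZ8 (zeros n m)"
| "zeros (Suc n) m = MZ (zeros n m)"
| "zeros 0 m = m"

text \<open>The generalised pentagonal numbers s (3 s - 1) / 2, s (3 s + 1) / 2, (s + 1) (3 s + 2) /
  2 have gaps s and 2 s + 1. Multiplied by d these are the distances between nonzero coefficients,
  and one place less is filled with zeros.\<close>

fun pent_mask :: "nat \<Rightarrow> nat \<Rightarrow> nat \<Rightarrow> bool \<Rightarrow> mask" where
  "pent_mask d 0 s b = MEnd"
| "pent_mask d (Suc n) s b = (let c = (if b then MP else MM) in
     c (zeros (d * s - 1) (c (zeros (d * (2 * s + 1) - 1) (pent_mask d n (Suc s) (\<not> b))))))"

text \<open>The first exponent is d and one power of q has been divided out, hence d - 1 leading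
  zeros. The 19 pairs reach beyond the 488 coefficients that are computed.\<close>

definition euler_mask :: "nat \<Rightarrow> mask" where
  "euler_mask d = zeros (d - 1) (pent_mask d 19 1 True)"

fun drop8 :: "int list \<Rightarrow> int list" where
  "drop8 (a # b # c # d # e # f # g # h # xs) = xs"
| "drop8 _ = []"

fun mask_dot :: "mask \<Rightarrow> int list \<Rightarrow> int \<Rightarrow> int \<Rightarrow> int \<times> int" where
  "mask_dot (MP ms) (h # hs) p m = mask_dot ms hs (p + h) m"
| "mask_dot (MM ms) (h # hs) p m = mask_dot ms hs p (m + h)"
| "mask_dot (MZ ms) (h # hs) p m = mask_dot ms hs p m"
| "mask_dot (MZ8 ms) hs p m = mask_dot ms (drop8 hs) p m"
| "mask_dot _ _ p m = (p, m)"

text \<open>Here hs holds earlier coefficients of the input, in \<open>mask_div\<close> those of the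
  output. The product subtracts the dot product from a, so a starts in the negative accumulator and
  m - p is taken.\<close>

fun mask_mult :: "mask \<Rightarrow> int list \<Rightarrow> int list \<Rightarrow> int list" where
  "mask_mult W [] hs = []"
| "mask_mult W (a # as) hs = (case mask_dot W hs 0 a of (p, m) \<Rightarrow> m - p) # mask_mult W as (a # hs)"

text \<open>Solves (1 - q W) b = a: the n-th coefficient of b is that of a plus the dot product of W
  with the earlier coefficients of b.\<close>

fun mask_div :: "mask \<Rightarrow> int list \<Rightarrow> int list \<Rightarrow> int list" where
  "mask_div W [] hs = rev hs"
| "mask_div W (a # as) hs = mask_div W as ((case mask_dot W hs a 0 of (p, m) \<Rightarrow> p - m) # hs)"

definition Delta_list :: "nat \<Rightarrow> nat \<Rightarrow> int list" where
  "Delta_list k L =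
    (let E = euler_mask 1; a = mask_mult (euler_mask 2) (1 # replicate L 0) [];
         b = mask_mult (euler_mask (2 * k + 1)) a []; c = mask_div (euler_mask (4 * k + 2)) b []
     in mask_div E (mask_div E (mask_div E c []) []) [])"

text \<open>For positive entries this certifies, without division, that l is the integer part of
  2^24 times the ratio of consecutive entries.\<close>

fun ratio_bounds :: "int list \<Rightarrow> int list \<Rightarrow> bool" where
  "ratio_bounds (d # ds) (l # ls) =
     (case ds of [] \<Rightarrow> False | e # es \<Rightarrow>
       (let v = l * d; w = 16777216 * e in v \<le> w \<and> w < v + d \<and> ratio_bounds ds ls))"
| "ratio_bounds ds [] = True"
| "ratio_bounds [] (l # ls) = False"

text \<open>If each l is the integer part of r, the test implies r1^2 < r0 r2. The scale 2^24 is
  fine enough: among the last entries of both lists the second differences are 4 to 6, and there the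
  test asks for at least 3.\<close>

fun ratios_log_convex :: "int list \<Rightarrow> bool" where
  "ratios_log_convex (l0 # l1 # l2 # ls) = ((l1 + 1) * (l1 + 1) < l0 * l2 \<and> ratios_log_convex (l1 # l2 # ls))"
| "ratios_log_convex _ = True"

text \<open>
  Shanks' finite form of the pentagonal number theorem: passing from n to n + 1, the increments of the
  left-hand side telescope.
\<close>
definition shanks_tail :: "'a :: comm_ring_1 \<Rightarrow> nat \<Rightarrow> nat \<Rightarrow> 'a" where
  "shanks_tail Q n s = (\<Prod>j\<in>{s<..n}. 1 - Q ^ j)"

lemma pent_exponents:
  "s * (3 * s - 1) div 2 + s = s * (3 * s + 1) div (2::nat)"
  "s * (3 * s + 1) div 2 + (2 * s + 1) = Suc s * (3 * Suc s - 1) div (2::nat)"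
proof -
  have 1: "s * (3 * s + 1) = s * (3 * s - 1) + s * 2" by (cases s) (auto simp: algebra_simps)
  show "s * (3 * s - 1) div 2 + s = s * (3 * s + 1) div (2::nat)" unfolding 1 by simp
  have 2: "Suc s * (3 * Suc s - 1) = s * (3 * s + 1) + (2 * s + 1) * 2" by (simp add: algebra_simps)
  show "s * (3 * s + 1) div 2 + (2 * s + 1) = Suc s * (3 * Suc s - 1) div (2::nat)" unfolding 2 by simp
qed

lemma triangle_step: "Suc s * Suc (Suc s) div 2 = s * Suc s div 2 + Suc s"
proof -
  have "Suc s * Suc (Suc s) = s * Suc s + Suc s * 2" by (simp add: algebra_simps)
  then show ?thesis by simp
qed

lemma shanks_exponents:
  "n * n + n * Suc n div 2 = n * (3 * n + 1) div (2::nat)"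
  "Suc n * n + Suc n * Suc (Suc n) div 2 = Suc n * (3 * Suc n - 1) div (2::nat)"
proof -
  have 1: "n * (3 * n + 1) = n * Suc n + (n * n) * 2" by (simp add: algebra_simps)
  show "n * n + n * Suc n div 2 = n * (3 * n + 1) div (2::nat)" unfolding 1 by simp
  have 2: "Suc n * (3 * Suc n - 1) = Suc n * Suc (Suc n) + (Suc n * n) * 2" by (simp add: algebra_simps)
  show "Suc n * n + Suc n * Suc (Suc n) div 2 = Suc n * (3 * Suc n - 1) div (2::nat)" unfolding 2 div_mult_self1[OF zero_neq_numeral[symmetric]] by (rule refl)
qed

lemma alternating_telescope:
  fixes B :: "nat \<Rightarrow> 'a :: comm_ring_1"
  shows "(\<Sum>s<n. (- 1) ^ s * (- B s - B (Suc s))) = (- 1) ^ n * B n - B 0"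
  by (induction n) (auto simp: algebra_simps)

theorem shanks_pentagonal:
  fixes Q :: "'a :: comm_ring_1"
  shows "(\<Sum>s\<le>n. (- 1) ^ s * (shanks_tail Q n s * Q ^ (s * n + s * Suc s div 2))) =
    1 + (\<Sum>s=1..n. (- 1) ^ s * (Q ^ (s * (3 * s - 1) div 2) + Q ^ (s * (3 * s + 1) div 2)))"
proof (induction n)
  case 0
  then show ?case by (simp add: shanks_tail_def)
next
  case (Suc n)
  define A where "A m s = shanks_tail Q m s * Q ^ (s * m + s * Suc s div 2)" for m s
  \<comment> \<open>The boundary term of the telescoping. Its value 0 at s = 0 agrees with the
    general form, which contains the factor 1 - Q^s.\<close>
  define B where "B s = (if s = 0 then 0 else shanks_tail Q n (s - 1) * Q ^ (s * n + s * Suc s div 2))" for s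
  have step: "A (Suc n) s - A n s = - B s - B (Suc s)" if s: "s \<le> n" for s
  proof -
    have t: "shanks_tail Q (Suc n) s = shanks_tail Q n s * (1 - Q ^ Suc n)"
    proof -
      have "{s<..Suc n} = insert (Suc n) {s<..n}" using s by auto
      then show ?thesis by (simp add: shanks_tail_def mult.commute)
    qed
    define e where "e = s * n + s * Suc s div 2"
    have e1: "s * Suc n + s * Suc s div 2 = e + s" by (simp add: e_def)
    have e2: "Suc s * n + Suc s * Suc (Suc s) div 2 = e + s + Suc n"
      unfolding triangle_step by (simp add: e_def)
    have b: "B s = shanks_tail Q n s * (1 - Q ^ s) * Q ^ e"
    proof (cases "s = 0")
      case False
      have "{s - 1<..n} = insert s {s<..n}" using s False by auto
      then have "shanks_tail Q n (s - 1) = (1 - Q ^ s) * shanks_tail Q n s" by (simp add: shanks_tail_def)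
      then show ?thesis using False by (simp add: B_def e_def mult_ac)
    qed (simp add: B_def)
    have b2: "B (Suc s) = shanks_tail Q n s * Q ^ (e + s + Suc n)" unfolding e2[symmetric] by (simp add: B_def)
    have "A (Suc n) s = shanks_tail Q n s * (1 - Q ^ Suc n) * Q ^ (e + s)" unfolding A_def t e1 ..
    moreover have "A n s = shanks_tail Q n s * Q ^ e" by (simp add: A_def e_def)
    ultimately show ?thesis unfolding b b2 by (simp add: algebra_simps power_add)
  qed
  have "(\<Sum>s\<le>Suc n. (- 1) ^ s * A (Suc n) s) = (\<Sum>s\<le>n. (- 1) ^ s * A (Suc n) s) + (- 1) ^ Suc n * A (Suc n) (Suc n)"
    by simp
  also have "(\<Sum>s\<le>n. (- 1) ^ s * A (Suc n) s) = (\<Sum>s\<le>n. (- 1) ^ s * A n s) + (\<Sum>s<Suc n. (- 1) ^ s * (- B s - B (Suc s)))"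
    unfolding lessThan_Suc_atMost sum.distrib[symmetric] 
  proof (intro sum.cong refl)
    fix s assume "s \<in> {..n}"
    then have "A (Suc n) s = A n s + (- B s - B (Suc s))" using step[of s] by (simp add: algebra_simps)
    then show "(- 1) ^ s * A (Suc n) s = (- 1) ^ s * A n s + (- 1) ^ s * (- B s - B (Suc s))"
      by (simp only: distrib_left)
  qed
  also have "(\<Sum>s<Suc n. (- 1) ^ s * (- B s - B (Suc s))) = (- 1) ^ Suc n * B (Suc n)"
    unfolding alternating_telescope by (simp add: B_def)
  also have "B (Suc n) = Q ^ (Suc n * (3 * Suc n - 1) div 2)"
    unfolding shanks_exponents(2)[symmetric] by (simp add: B_def shanks_tail_def)
  also have "A (Suc n) (Suc n) = Q ^ (Suc n * (3 * Suc n + 1) div 2)"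
    unfolding shanks_exponents(1)[symmetric] by (simp add: A_def shanks_tail_def)
  also have "(\<Sum>s\<le>n. (- 1) ^ s * A n s) = 1 + (\<Sum>s=1..n. (- 1) ^ s * (Q ^ (s * (3 * s - 1) div 2) + Q ^ (s * (3 * s + 1) div 2)))"
    unfolding A_def by (rule Suc.IH)
  finally have R: "(\<Sum>s\<le>Suc n. (- 1) ^ s * A (Suc n) s) = 1 + (\<Sum>s=1..n. (- 1) ^ s * (Q ^ (s * (3 * s - 1) div 2) + Q ^ (s * (3 * s + 1) div 2)))
     + (- 1) ^ Suc n * Q ^ (Suc n * (3 * Suc n - 1) div 2) + (- 1) ^ Suc n * Q ^ (Suc n * (3 * Suc n + 1) div 2)" .
  have cl: "{1..Suc n} = insert (Suc n) {1..n}" by auto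
  have "(\<Sum>s\<in>insert (Suc n) {1..n}. f s) = f (Suc n) + (\<Sum>s=1..n. f s)" for f :: "nat \<Rightarrow> 'a"
    by (rule sum.insert) auto
  then show ?case unfolding A_def[symmetric] R cl by (simp only: distrib_left add_ac)
qed

definition euler_prod :: "nat \<Rightarrow> nat \<Rightarrow> real fps" where
  "euler_prod d N = (\<Prod>i<N. 1 - fps_X ^ (d * (i + 1)))"

definition pent_sum :: "nat \<Rightarrow> nat \<Rightarrow> real fps" where
  "pent_sum d n = (\<Sum>s=1..n. (- 1) ^ s * (fps_X ^ (d * (s * (3 * s - 1) div 2)) + fps_X ^ (d * (s * (3 * s + 1) div 2))))"

lemma nth_signed_X_power: "fps_nth ((- 1) ^ s * f :: real fps) i = (- 1) ^ s * fps_nth f i"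
  by (cases "even s") auto

text \<open>For s >= 1 the terms of Shanks' identity start at exponent s N + s (s + 1) / 2 > N, so
  up to N only the term s = 0, the Euler product itself, is visible.\<close>

lemma euler_prod_pentagonal:
  assumes d: "d > 0" and i: "i \<le> N"
  shows "fps_nth (euler_prod d N) i = fps_nth (1 + pent_sum d N) i"
proof -
  define Q where "Q = (fps_X ^ d :: real fps)"
  have Q: "Q ^ j = fps_X ^ (d * j)" for j by (simp add: Q_def power_mult)
  have t: "shanks_tail Q N 0 = euler_prod d N"
    unfolding shanks_tail_def euler_prod_def Q
    by (rule prod.reindex_bij_witness[of _ Suc "\<lambda>j. j - 1"]) auto
  have z: "fps_nth ((- 1) ^ s * (shanks_tail Q N s * Q ^ (s * N + s * Suc s div 2))) i = 0" if "s \<in> {..N} - {0}" for s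
  proof -
    have "s * Suc s div 2 \<ge> 1" using that by (cases s) auto
    moreover have "s * N \<ge> 1 * N" using that by (intro mult_right_mono) auto
    ultimately have "i < s * N + s * Suc s div 2" using i by linarith
    also have "\<dots> \<le> d * (s * N + s * Suc s div 2)" using d by simp
    finally show ?thesis unfolding nth_signed_X_power Q by (simp add: fps_X_power_mult_right_nth)
  qed
  have "1 + pent_sum d N = (\<Sum>s\<le>N. (- 1) ^ s * (shanks_tail Q N s * Q ^ (s * N + s * Suc s div 2)))"
    unfolding shanks_pentagonal by (simp only: pent_sum_def Q)
  then have "fps_nth (1 + pent_sum d N) i = fps_nth (\<Sum>s\<le>N. (- 1) ^ s * (shanks_tail Q N s * Q ^ (s * N + s * Suc s div 2))) i"
    by (rule arg_cong)
  also have "\<dots> = fps_nth ((- 1) ^ 0 * (shanks_tail Q N 0 * Q ^ (0 * N + 0 * Suc 0 div 2))) i"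
    unfolding fps_sum_nth using z by (subst sum.remove[of _ 0]) (auto simp del: mult_Suc_right)
  finally show ?thesis by (simp add: t)
qed

text \<open>The first omitted exponent is 20 * 59 / 2 = 590.\<close>
lemma pent_sum_truncate:
  assumes d: "d > 0" and i: "i < 590" and N: "N \<ge> 19"
  shows "fps_nth (pent_sum d N) i = fps_nth (pent_sum d 19) i"
proof -
  have z: "fps_nth ((- 1) ^ s * (fps_X ^ (d * (s * (3 * s - 1) div 2)) + fps_X ^ (d * (s * (3 * s + 1) div 2))) :: real fps) i = 0"
    if "s \<in> {1..N} - {1..19}" for s
  proof -
    have s: "s \<ge> 20" using that by auto
    have "s * (3 * s - 1) \<ge> 20 * 59" using s by (intro mult_mono) auto
    then have "s * (3 * s - 1) div 2 \<ge> 590" by simp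
    then have "590 \<le> d * (s * (3 * s - 1) div 2)" using d by (metis One_nat_def Suc_leI le_trans mult_le_mono1 nat_mult_1)
    moreover have "s * (3 * s + 1) \<ge> 20 * 61" using s by (intro mult_mono) auto
    then have "s * (3 * s + 1) div 2 \<ge> 590" by simp
    then have "590 \<le> d * (s * (3 * s + 1) div 2)" using d by (metis One_nat_def Suc_leI le_trans mult_le_mono1 nat_mult_1)
    ultimately show ?thesis using i unfolding nth_signed_X_power by (simp add: fps_X_power_nth)
  qed
  show ?thesis unfolding pent_sum_def fps_sum_nth
    by (rule sum.mono_neutral_right) (use z N in auto)
qed

section \<open>Correctness of the coefficient computation\<close>

primrec mask_fps :: "mask \<Rightarrow> real fps" where
  "mask_fps MEnd = 0"
| "mask_fps (MP m) = 1 + fps_X * mask_fps m"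
| "mask_fps (MM m) = - 1 + fps_X * mask_fps m"
| "mask_fps (MZ m) = fps_X * mask_fps m"
| "mask_fps (MZ8 m) = fps_X ^ 8 * mask_fps m"

lemma mask_fps_zeros: "mask_fps (zeros n m) = fps_X ^ n * mask_fps m"
proof (induction n m rule: zeros.induct)
  case (1 n m)
  have e: "Suc (Suc (Suc (Suc (Suc (Suc (Suc (Suc n))))))) = 8 + n" by simp
  have "mask_fps (zeros (Suc (Suc (Suc (Suc (Suc (Suc (Suc (Suc n)))))))) m) = fps_X ^ (8 + n) * mask_fps m"
    by (simp only: zeros.simps(1) mask_fps.simps 1 power_add mult.assoc)
  then show ?case unfolding e .
qed (simp_all add: mult_ac)

text \<open>A mask knows only relative distances. Multiplication by the power with the first
  exponent makes the exponents absolute, the form that passes from s to s + 1 in the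
  induction.\<close>

lemma mask_fps_pent:
  assumes "d > 0" "s > 0"
  shows "fps_X ^ (d * (s * (3 * s - 1) div 2)) * mask_fps (pent_mask d n s b) =
    (if b then 1 else - 1) * (\<Sum>j<n. (- 1) ^ j * (fps_X ^ (d * ((s + j) * (3 * (s + j) - 1) div 2)) + fps_X ^ (d * ((s + j) * (3 * (s + j) + 1) div 2))))"
  using assms(2)
proof (induction n arbitrary: s b)
  case (Suc n)
  define w where "w s = s * (3 * s - 1) div (2::nat)" for s
  define w' where "w' s = s * (3 * s + 1) div (2::nat)" for s
  define g where "g = (if b then 1 else - 1 :: real fps)"
  define R where "R = mask_fps (pent_mask d n (Suc s) (\<not> b))"
  have cfps: "mask_fps ((if b then MP else MM) m) = g + fps_X * mask_fps m" for m by (simp add: g_def)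
  have ds: "d * s > 0" "d * (2 * s + 1) > 0" using assms(1) Suc.prems by auto
  have w1: "d * w' s = d * w s + d * s" unfolding w_def w'_def pent_exponents(1)[symmetric] by (simp add: algebra_simps)
  have w2: "d * w (Suc s) = d * w' s + d * (2 * s + 1)" unfolding w_def w'_def pent_exponents(2)[symmetric] by (simp add: algebra_simps)
  have "mask_fps (pent_mask d (Suc n) s b) = g + fps_X * (fps_X ^ (d * s - 1) * (g + fps_X * (fps_X ^ (d * (2 * s + 1) - 1) * R)))"
    by (simp only: pent_mask.simps Let_def cfps mask_fps_zeros R_def)
  also have "\<dots> = g + fps_X ^ (d * s) * (g + fps_X ^ (d * (2 * s + 1)) * R)"
    using ds by (simp only: mult.assoc[symmetric] power_Suc[symmetric] Suc_diff_1)
  finally have "fps_X ^ (d * w s) * mask_fps (pent_mask d (Suc n) s b) = g * fps_X ^ (d * w s) + g * fps_X ^ (d * w' s) + fps_X ^ (d * w (Suc s)) * R"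
    unfolding w2 w1 by (simp only: power_add distrib_left mult_ac)  (simp add: algebra_simps)
  also have "fps_X ^ (d * w (Suc s)) * R = - g * (\<Sum>j<n. (- 1) ^ j * (fps_X ^ (d * w (Suc s + j)) + fps_X ^ (d * w' (Suc s + j))))"
    using Suc.IH[of "Suc s" "\<not> b"] unfolding R_def w_def w'_def g_def by (cases b) simp_all
  also have "g * fps_X ^ (d * w s) + g * fps_X ^ (d * w' s) + - g * (\<Sum>j<n. (- 1) ^ j * (fps_X ^ (d * w (Suc s + j)) + fps_X ^ (d * w' (Suc s + j)))) =
     g * (\<Sum>j<Suc n. (- 1) ^ j * (fps_X ^ (d * w (s + j)) + fps_X ^ (d * w' (s + j))))"
  proof -
    define f where "f j = fps_X ^ (d * w (s + j)) + (fps_X ^ (d * w' (s + j)) :: real fps)" for j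
    have "(\<Sum>j<Suc n. (- 1) ^ j * f j) = f 0 - (\<Sum>j<n. (- 1) ^ j * f (Suc j))"
      by (simp add: sum.lessThan_Suc_shift sum_negf del: sum.lessThan_Suc)
    moreover have "(\<Sum>j<n. (- 1) ^ j * (fps_X ^ (d * w (Suc s + j)) + fps_X ^ (d * w' (Suc s + j)))) = (\<Sum>j<n. (- 1) ^ j * f (Suc j))"
      by (simp add: f_def)
    moreover have "(\<Sum>j<Suc n. (- 1) ^ j * (fps_X ^ (d * w (s + j)) + fps_X ^ (d * w' (s + j)))) = (\<Sum>j<Suc n. (- 1) ^ j * f j)"
      by (simp only: f_def)
    moreover have "g * fps_X ^ (d * w s) + g * fps_X ^ (d * w' s) + - g * S = g * (f 0 - S)" for S
      by (simp add: f_def algebra_simps)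
    ultimately show ?thesis by simp
  qed
  finally show ?case unfolding w_def w'_def g_def .
qed simp

lemma mask_fps_euler:
  assumes "d > 0"
  shows "1 - fps_X * mask_fps (euler_mask d) = 1 + pent_sum d 19"
proof -
  have "fps_X * mask_fps (euler_mask d) = fps_X ^ (d * (1 * (3 * 1 - 1) div 2)) * mask_fps (pent_mask d 19 1 True)"
  proof -
    have "fps_X * (fps_X ^ (d - 1) * f) = fps_X ^ d * f" for f :: "real fps"
      using assms by (simp only: mult.assoc[symmetric] power_Suc[symmetric] Suc_diff_1)
    then show ?thesis by (simp add: euler_mask_def mask_fps_zeros)
  qed
  also have "\<dots> = (\<Sum>j<19. (- 1) ^ j * (fps_X ^ (d * ((1 + j) * (3 * (1 + j) - 1) div 2)) + fps_X ^ (d * ((1 + j) * (3 * (1 + j) + 1) div 2))))"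
    using mask_fps_pent[OF assms, of 1 19 True] by simp
  also have "\<dots> = - pent_sum d 19"
    unfolding pent_sum_def sum_negf[symmetric]
    by (rule sum.reindex_bij_witness[of _ "\<lambda>s. s - 1" Suc]) (auto simp: algebra_simps)
  finally show ?thesis by simp
qed

lemma drop8: "drop8 xs = drop 8 xs"
  by (cases xs rule: drop8.cases) simp_all

text \<open>Only the difference of the accumulators has a meaning. The sum ends with the list, so
  nothing is lost when \<open>drop8\<close> runs past its end.\<close>

lemma mask_dot_correct:
  "mask_dot W hs p m = (p', m') \<Longrightarrow>
    real_of_int p' - real_of_int m' = real_of_int p - real_of_int m + (\<Sum>j<length hs. fps_nth (mask_fps W) j * real_of_int (hs ! j))"
proof (induction W hs p m rule: mask_dot.induct)
  case (4 ms hs p m)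
  have IH: "real_of_int p' - real_of_int m' = real_of_int p - real_of_int m + (\<Sum>j<length (drop 8 hs). fps_nth (mask_fps ms) j * real_of_int (drop 8 hs ! j))"
    using 4 by (simp add: drop8)
  have "(\<Sum>j<length hs. fps_nth (mask_fps (MZ8 ms)) j * real_of_int (hs ! j)) = (\<Sum>j\<in>{8..<length hs}. fps_nth (mask_fps ms) (j - 8) * real_of_int (hs ! j))"
    by (rule sum.mono_neutral_cong_right) (auto simp: fps_X_power_mult_nth)
  also have "\<dots> = (\<Sum>j<length (drop 8 hs). fps_nth (mask_fps ms) j * real_of_int (drop 8 hs ! j))"
    by (rule sum.reindex_bij_witness[of _ "\<lambda>j. j + 8" "\<lambda>j. j - 8"]) auto
  finally show ?case using IH by simp
next
  case (1 ms h hs p m)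
  then show ?case by (simp add: sum.lessThan_Suc_shift del: sum.lessThan_Suc)
next
  case (2 ms h hs p m)
  then show ?case by (simp add: sum.lessThan_Suc_shift del: sum.lessThan_Suc)
next
  case (3 ms h hs p m)
  then show ?case by (simp add: sum.lessThan_Suc_shift del: sum.lessThan_Suc)
qed auto

definition represents :: "int list \<Rightarrow> real fps \<Rightarrow> bool" where
  "represents xs f \<longleftrightarrow> (\<forall>i<length xs. real_of_int (xs ! i) = fps_nth f i)"

text \<open>As hs is reversed, its entry j is the coefficient n - 1 - j, and the dot product is a
  Cauchy product at n - 1; the factor \<open>fps_X\<close> makes n = 0 fit in.\<close>

lemma dot_history:
  assumes hs: "represents (rev hs) B" and n: "n = length hs"
    and dot: "mask_dot W hs p m = (p', m')"
  shows "real_of_int p' - real_of_int m' = real_of_int p - real_of_int m + fps_nth (fps_X * (mask_fps W * B)) n"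
proof (cases n)
  case 0
  then show ?thesis using mask_dot_correct[OF dot] n by simp
next
  case (Suc n')
  have "(\<Sum>j<length hs. fps_nth (mask_fps W) j * real_of_int (hs ! j)) = (\<Sum>j=0..n'. fps_nth (mask_fps W) j * fps_nth B (n' - j))"
  proof (rule sum.cong)
    show "{..<length hs} = {0..n'}" using n Suc by auto
    fix j assume "j \<in> {0..n'}"
    then have j: "n' - j < length hs" "length hs - Suc (n' - j) = j" using n Suc by auto
    then have "real_of_int (rev hs ! (n' - j)) = fps_nth B (n' - j)" "rev hs ! (n' - j) = hs ! j"
      using hs rev_nth[OF j(1)] by (auto simp: represents_def)
    then show "fps_nth (mask_fps W) j * real_of_int (hs ! j) = fps_nth (mask_fps W) j * fps_nth B (n' - j)" by simp
  qed
  also have "\<dots> = fps_nth (mask_fps W * B) n'" by (simp only: fps_mult_nth)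
  also have "\<dots> = fps_nth (fps_X * (mask_fps W * B)) n" by (simp add: Suc)
  finally show ?thesis using mask_dot_correct[OF dot] by simp
qed

lemma represents_snoc:
  "represents (xs @ [a]) f \<longleftrightarrow> represents xs f \<and> real_of_int a = fps_nth f (length xs)"
  by (auto simp: represents_def nth_append less_Suc_eq)

lemma mask_mult_correct:
  assumes "represents (rev hs @ as) A"
  shows "length (mask_mult W as hs) = length as" 
    and "i < length as \<Longrightarrow> real_of_int (mask_mult W as hs ! i) = fps_nth ((1 - fps_X * mask_fps W) * A) (length hs + i)"
  using assms
proof (induction as arbitrary: hs i)
  case (Cons a as)
  {
    case 1
    then show ?case using Cons.IH(1)[of "a # hs"] by simp
  next
    case 2
    have r: "represents (rev (a # hs) @ as) A" using 2(2) by simp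
    have rh: "represents (rev hs) A" "real_of_int a = fps_nth A (length hs)"
      using 2(2) by (auto simp: represents_def nth_append split: if_splits dest: spec[of _ "length hs"])
    show ?case
    proof (cases i)
      case 0
      obtain p m where pm: "mask_dot W hs 0 a = (p, m)" by fastforce
      have "real_of_int p - real_of_int m = 0 - real_of_int a + fps_nth (fps_X * (mask_fps W * A)) (length hs)"
        using dot_history[OF rh(1) refl pm] by simp
      then show ?thesis using 0 pm rh(2) by (simp add: left_diff_distrib mult.assoc)
    next
      case (Suc j)
      then show ?thesis using Cons.IH(2)[of j "a # hs"] r 2(1) by simp
    qed
  }
qed auto

lemma mask_div_correct:
  assumes "\<forall>i<length as. real_of_int (as ! i) = fps_nth ((1 - fps_X * mask_fps W) * B) (length hs + i)" "represents (rev hs) B"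
  shows "represents (mask_div W as hs) B \<and> length (mask_div W as hs) = length hs + length as"
  using assms
proof (induction as arbitrary: hs)
  case (Cons a as)
  obtain p m where pm: "mask_dot W hs a 0 = (p, m)" by fastforce
  have a: "real_of_int a = fps_nth ((1 - fps_X * mask_fps W) * B) (length hs)" "represents (rev hs) B"
    and rest: "\<forall>i<length as. real_of_int (as ! i) = fps_nth ((1 - fps_X * mask_fps W) * B) (length (b # hs) + i)" for b
    using Cons.prems by (auto dest: spec[of _ 0] spec[of _ "Suc _"])
  have "real_of_int (p - m) = fps_nth B (length hs)"
    using dot_history[OF a(2) refl pm] a(1) by (simp add: left_diff_distrib mult.assoc)
  then have "represents (rev ((p - m) # hs)) B" using a(2) by (simp add: represents_snoc)
  then show ?case
    using Cons.IH[OF rest[of "p - m"]] pm by auto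
qed auto

lemma fps_nth_mult_cong:
  assumes "\<And>j. j \<le> n \<Longrightarrow> fps_nth f j = fps_nth g j"
  shows "fps_nth (f * h) n = fps_nth (g * h) n"
  unfolding fps_mult_nth using assms by (intro sum.cong) auto

context
  fixes L N :: nat
  assumes L: "L \<le> 590" and N: "N \<ge> 590"
begin

text \<open>Two truncations are invisible below 590: that of the product to N factors and that of
  the pentagonal series to 19 pairs.\<close>

lemma euler_mask_nth: "d > 0 \<Longrightarrow> i < L \<Longrightarrow> fps_nth (1 - fps_X * mask_fps (euler_mask d)) i = fps_nth (euler_prod d N) i"
  using L N euler_prod_pentagonal[of d i N] pent_sum_truncate[of d i N] by (simp only: mask_fps_euler) simp

lemma mask_mult_euler:
  assumes "represents as A" "length as = L" "d > 0"
  shows "represents (mask_mult (euler_mask d) as []) (euler_prod d N * A)" "length (mask_mult (euler_mask d) as []) = L"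
proof -
  show l: "length (mask_mult (euler_mask d) as []) = L" using mask_mult_correct(1)[of "[]" as A] assms by simp
  show "represents (mask_mult (euler_mask d) as []) (euler_prod d N * A)"
    unfolding represents_def l
  proof (intro allI impI)
    fix i assume i: "i < L"
    have "fps_nth ((1 - fps_X * mask_fps (euler_mask d)) * A) i = fps_nth (euler_prod d N * A) i"
      by (rule fps_nth_mult_cong) (use euler_mask_nth assms i in auto)
    then show "real_of_int (mask_mult (euler_mask d) as [] ! i) = fps_nth (euler_prod d N * A) i"
      using mask_mult_correct(2)[of "[]" as A i] assms i by simp
  qed
qed

lemma mask_div_euler:
  assumes "represents as (euler_prod d N * B)" "length as = L" "d > 0"
  shows "represents (mask_div (euler_mask d) as []) B" "length (mask_div (euler_mask d) as []) = L"
proof -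
  have *: "\<forall>i<length as. real_of_int (as ! i) = fps_nth ((1 - fps_X * mask_fps (euler_mask d)) * B) (length [] + i)"
  proof (intro allI impI)
    fix i assume i: "i < length as"
    have "fps_nth ((1 - fps_X * mask_fps (euler_mask d)) * B) i = fps_nth (euler_prod d N * B) i"
      by (rule fps_nth_mult_cong) (use euler_mask_nth assms i in auto)
    then show "real_of_int (as ! i) = fps_nth ((1 - fps_X * mask_fps (euler_mask d)) * B) (length [] + i)"
      using assms i by (simp add: represents_def)
  qed
  show "represents (mask_div (euler_mask d) as []) B" "length (mask_div (euler_mask d) as []) = L"
    using mask_div_correct[OF *] assms(2) by (auto simp: represents_def)
qed

end

lemma euler_prod_factor:
  "(\<Prod>i<N. broken_diamond_factor k (i + 1)) * (euler_prod 1 N ^ 3 * euler_prod (4 * k + 2) N) = euler_prod 2 N * euler_prod (2 * k + 1) N"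
proof -
  have f: "broken_diamond_factor k (i + 1) * ((1 - fps_X ^ (i + 1)) ^ 3 * (1 - fps_X ^ ((4 * k + 2) * (i + 1)))) =
    (1 - fps_X ^ (2 * (i + 1))) * (1 - fps_X ^ ((2 * k + 1) * (i + 1)))" for i
  proof -
    define D :: "real fps" where "D = (1 - fps_X ^ (i + 1)) ^ 3 * (1 - fps_X ^ ((4 * k + 2) * (i + 1)))"
    have "fps_nth D 0 \<noteq> 0" by (simp add: D_def fps_mult_nth_0 fps_nth_power_0 power_0_left)
    then show ?thesis unfolding broken_diamond_factor_def D_def[symmetric]
      by (simp add: fps_divide_unit mult.assoc inverse_mult_eq_1 del: power_Suc)
  qed
  have "(\<Prod>i<N. broken_diamond_factor k (i + 1)) * (euler_prod 1 N ^ 3 * euler_prod (4 * k + 2) N) =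
    (\<Prod>i<N. broken_diamond_factor k (i + 1) * ((1 - fps_X ^ (i + 1)) ^ 3 * (1 - fps_X ^ ((4 * k + 2) * (i + 1)))))"
    by (simp only: euler_prod_def prod.distrib prod_power_distrib mult_1)
  also have "\<dots> = euler_prod 2 N * euler_prod (2 * k + 1) N"
    by (simp only: f euler_prod_def prod.distrib)
  finally show ?thesis .
qed

theorem Delta_list_correct:
  assumes L: "L < 590" and n: "n \<le> L"
  shows "real_of_int (Delta_list k L ! n) = Delta k n" "length (Delta_list k L) = L + 1"
proof -
  have "eventually (\<lambda>N. fps_nth (\<Prod>i<N. broken_diamond_factor k (i + 1)) n = Delta k n) sequentially"
    using has_prod_imp_tendsto'[OF broken_diamond_has_prod, of k] unfolding tendsto_fps_iff Delta_def by blast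
  then obtain N where N: "N \<ge> 590" "fps_nth (\<Prod>i<N. broken_diamond_factor k (i + 1)) n = Delta k n"
    unfolding eventually_sequentially by (metis nat_le_linear)
  define F where "F = (\<Prod>i<N. broken_diamond_factor k (i + 1))"
  define E where "E d = euler_prod d N" for d
  \<comment> \<open>The product cleared of denominators, bracketed so that each multiplication adds
    the outermost factor on the left and each division strips the outermost factor on the
    right.\<close>
  have eq: "E (2 * k + 1) * (E 2 * 1) = E (4 * k + 2) * (E 1 * (E 1 * (E 1 * F)))"
    using euler_prod_factor[where N = N and k = k] by (simp add: E_def F_def power3_eq_cube mult_ac)
  have L': "L + 1 \<le> 590" using L by simp
  note mult = mask_mult_euler[OF L' N(1), folded E_def]
  note div = mask_div_euler[OF L' N(1), folded E_def]
  define a where "a = mask_mult (euler_mask 2) (1 # replicate L 0) []"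
  have u: "represents (1 # replicate L 0) 1" "length (1 # replicate L (0::int)) = L + 1"
    by (auto simp: represents_def nth_Cons split: nat.splits)
  have a: "represents a (E 2 * 1)" "length a = L + 1" unfolding a_def using mult[OF u] by auto
  define b where "b = mask_mult (euler_mask (2 * k + 1)) a []"
  have b: "represents b (E (4 * k + 2) * (E 1 * (E 1 * (E 1 * F))))" "length b = L + 1"
    unfolding b_def eq[symmetric] using mult[OF a] by auto
  define c where "c = mask_div (euler_mask (4 * k + 2)) b []"
  have c: "represents c (E 1 * (E 1 * (E 1 * F)))" "length c = L + 1" unfolding c_def using div[OF b] by auto
  define c1 where "c1 = mask_div (euler_mask 1) c []"
  have c1: "represents c1 (E 1 * (E 1 * F))" "length c1 = L + 1" unfolding c1_def using div[OF c] by auto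
  define c2 where "c2 = mask_div (euler_mask 1) c1 []"
  have c2: "represents c2 (E 1 * F)" "length c2 = L + 1" unfolding c2_def using div[OF c1] by auto
  have D: "Delta_list k L = mask_div (euler_mask 1) c2 []"
    by (simp add: Delta_list_def Let_def a_def b_def c_def c1_def c2_def)
  show "length (Delta_list k L) = L + 1" unfolding D using div(2)[OF c2] by simp
  have "represents (Delta_list k L) F" unfolding D using div(1)[OF c2] by simp
  then show "real_of_int (Delta_list k L ! n) = Delta k n"
    using n N(2) \<open>length (Delta_list k L) = L + 1\<close> by (simp add: represents_def F_def)
qed

lemma ratio_bounds_nth:
  assumes "ratio_bounds ds ls" "i < length ls"
  shows "Suc i < length ds \<and> ls ! i * ds ! i \<le> 16777216 * ds ! Suc i \<and> 16777216 * ds ! Suc i < (ls ! i + 1) * ds ! i"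
  using assms
proof (induction ds ls arbitrary: i rule: ratio_bounds.induct)
  case (1 d ds l ls)
  then obtain e es where ds: "ds = e # es" by (cases ds) auto
  then have b: "l * d \<le> 16777216 * e" "16777216 * e < l * d + d" "ratio_bounds ds ls"
    using 1(2) by (auto simp: Let_def)
  show ?case
  proof (cases i)
    case 0
    then show ?thesis using b ds by (simp add: algebra_simps)
  next
    case (Suc j)
    then have "j < length ls" using 1(3) by simp
    from 1(1)[OF ds refl refl b(3) this] show ?thesis using Suc by simp
  qed
qed auto

lemma ratios_log_convex_nth:
  assumes "ratios_log_convex ls" "i + 2 < length ls"
  shows "(ls ! (i + 1) + 1) * (ls ! (i + 1) + 1) < ls ! i * ls ! (i + 2)"
  using assms
proof (induction ls arbitrary: i rule: ratios_log_convex.induct)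
  case (1 l0 l1 l2 ls)
  then show ?case by (cases i) (auto simp: numeral_2_eq_2)
qed auto

section \<open>The inequality for small arguments\<close>

text \<open>The lists contain the integer parts of 2^24 Delta k n / Delta k (n - 1) for n = 1, ..., 487.\<close>
definition cert1 :: "int list" where
  "cert1 = [
    50331648, 44739242, 37748736, 35418567, 33112926, 31764862, 30482547, 29587725, 28760941, 28134100,
    27551574, 27079426, 26639334, 26264495, 25919221, 25614426, 25332960, 25079732, 24844408, 24629745,
    24429355, 24244422, 24071094, 23909794, 23757962, 23615648, 23481206, 23354495, 23234368, 23120637,
    23012461, 22909644, 22811573, 22718044, 22628605, 22543060, 22461060, 22382431, 22306899, 22234309,
    22164441, 22097159, 22032285, 21969699, 21909254, 21850845, 21794350, 21739676, 21686721, 21635402,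
    21585634, 21537344, 21490456, 21444909, 21400637, 21357584, 21315693, 21274916, 21235202, 21196508,
    21158790, 21122009, 21086126, 21051105, 21016913, 20983518, 20950889, 20918999, 20887818, 20857322,
    20827486, 20798287, 20769702, 20741711, 20714292, 20687428, 20661100, 20635289, 20609980, 20585157,
    20560804, 20536906, 20513451, 20490423, 20467812, 20445603, 20423786, 20402349, 20381281, 20360572,
    20340212, 20320191, 20300500, 20281130, 20262072, 20243319, 20224861, 20206692, 20188805, 20171191,
    20153844, 20136757, 20119925, 20103340, 20086997, 20070890, 20055013, 20039361, 20023930, 20008712,
    19993705, 19978902, 19964300, 19949893, 19935679, 19921651, 19907807, 19894143, 19880654, 19867337,
    19854188, 19841203, 19828381, 19815716, 19803206, 19790848, 19778638, 19766574, 19754654, 19742873,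
    19731229, 19719721, 19708344, 19697097, 19685978, 19674983, 19664111, 19653359, 19642725, 19632208,
    19621804, 19611512, 19601330, 19591255, 19581287, 19571423, 19561662, 19552001, 19542439, 19532974,
    19523605, 19514330, 19505148, 19496056, 19487054, 19478140, 19469313, 19460571, 19451912, 19443336,
    19434842, 19426427, 19418092, 19409833, 19401651, 19393544, 19385512, 19377552, 19369663, 19361846,
    19354098, 19346419, 19338808, 19331263, 19323784, 19316370, 19309020, 19301732, 19294507, 19287343,
    19280239, 19273194, 19266208, 19259280, 19252409, 19245595, 19238836, 19232131, 19225481, 19218884,
    19212340, 19205847, 19199406, 19193015, 19186675, 19180383, 19174140, 19167946, 19161798, 19155698,
    19149643, 19143634, 19137671, 19131751, 19125876, 19120044, 19114255, 19108509, 19102804, 19097141,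
    19091518, 19085936, 19080394, 19074891, 19069427, 19064002, 19058615, 19053265, 19047952, 19042676,
    19037437, 19032233, 19027065, 19021932, 19016834, 19011770, 19006740, 19001744, 18996781, 18991850,
    18986952, 18982086, 18977252, 18972450, 18967678, 18962937, 18958227, 18953547, 18948896, 18944275,
    18939683, 18935120, 18930586, 18926080, 18921602, 18917151, 18912728, 18908332, 18903963, 18899620,
    18895304, 18891014, 18886749, 18882510, 18878296, 18874108, 18869944, 18865805, 18861690, 18857599,
    18853531, 18849488, 18845468, 18841471, 18837496, 18833545, 18829616, 18825709, 18821825, 18817962,
    18814121, 18810301, 18806503, 18802726, 18798969, 18795234, 18791518, 18787823, 18784149, 18780494,
    18776859, 18773243, 18769647, 18766070, 18762512, 18758973, 18755453, 18751952, 18748468, 18745004,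
    18741557, 18738128, 18734717, 18731323, 18727947, 18724588, 18721247, 18717922, 18714614, 18711324,
    18708049, 18704791, 18701550, 18698325, 18695115, 18691922, 18688744, 18685583, 18682436, 18679305,
    18676190, 18673089, 18670004, 18666933, 18663878, 18660837, 18657810, 18654798, 18651800, 18648817,
    18645848, 18642892, 18639951, 18637023, 18634109, 18631209, 18628322, 18625448, 18622588, 18619741,
    18616906, 18614085, 18611277, 18608481, 18605698, 18602928, 18600170, 18597425, 18594692, 18591971,
    18589262, 18586565, 18583880, 18581207, 18578546, 18575896, 18573258, 18570631, 18568016, 18565413,
    18562820, 18560239, 18557668, 18555109, 18552561, 18550023, 18547497, 18544981, 18542475, 18539981,
    18537496, 18535023, 18532559, 18530106, 18527663, 18525230, 18522807, 18520394, 18517991, 18515598,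
    18513215, 18510841, 18508477, 18506123, 18503778, 18501442, 18499116, 18496800, 18494492, 18492194,
    18489905, 18487625, 18485354, 18483092, 18480839, 18478595, 18476360, 18474133, 18471915, 18469706,
    18467505, 18465313, 18463129, 18460954, 18458786, 18456628, 18454477, 18452335, 18450201, 18448075,
    18445957, 18443847, 18441744, 18439650, 18437564, 18435485, 18433414, 18431351, 18429296, 18427248,
    18425208, 18423175, 18421149, 18419131, 18417121, 18415118, 18413122, 18411133, 18409151, 18407177,
    18405210, 18403249, 18401296, 18399350, 18397411, 18395478, 18393553, 18391634, 18389722, 18387817,
    18385919, 18384027, 18382142, 18380263, 18378391, 18376525, 18374666, 18372814, 18370967, 18369128,
    18367294, 18365467, 18363646, 18361831, 18360022, 18358220, 18356423, 18354633, 18352849, 18351071,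
    18349298, 18347532, 18345772, 18344017, 18342268, 18340525, 18338788, 18337057, 18335331, 18333611,
    18331897, 18330188, 18328485, 18326788, 18325096, 18323409, 18321728, 18320053, 18318382, 18316718,
    18315058, 18313404, 18311755, 18310112, 18308474, 18306840, 18305213, 18303590, 18301972, 18300360,
    18298752, 18297150, 18295553, 18293960, 18292373, 18290790, 18289213]"

definition cert2 :: "int list" where
  "cert2 = [
    50331648, 44739242, 39845888, 36203466, 33554432, 32326830, 30899809, 29922251, 29125764, 28433750,
    27830182, 27341629, 26885000, 26491008, 26138404, 25819983, 25528915, 25267522, 25024486, 24802081,
    24596234, 24405015, 24226524, 24060376, 23904065, 23757446, 23619311, 23488882, 23365412, 23248519,
    23137388, 23031738, 22931076, 22835029, 22743240, 22655457, 22571337, 22490676, 22413230, 22338795,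
    22267175, 22198215, 22131736, 22067607, 22005688, 21945857, 21887999, 21832012, 21777793, 21725255,
    21674313, 21624887, 21576904, 21530297, 21485000, 21440954, 21398103, 21356394, 21315777, 21276206,
    21237637, 21200029, 21163342, 21127541, 21092589, 21058455, 21025106, 20992514, 20960650, 20929488,
    20899002, 20869169, 20839966, 20811370, 20783362, 20755922, 20729030, 20702669, 20676822, 20651472,
    20626604, 20602202, 20578253, 20554742, 20531656, 20508984, 20486712, 20464829, 20443324, 20422186,
    20401405, 20380972, 20360875, 20341108, 20321660, 20302523, 20283689, 20265150, 20246898, 20228927,
    20211229, 20193797, 20176625, 20159706, 20143034, 20126604, 20110409, 20094445, 20078704, 20063184,
    20047878, 20032781, 20017889, 20003197, 19988701, 19974397, 19960280, 19946346, 19932592, 19919013,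
    19905607, 19892368, 19879295, 19866383, 19853629, 19841030, 19828583, 19816285, 19804133, 19792124,
    19780255, 19768524, 19756928, 19745465, 19734131, 19722925, 19711844, 19700886, 19690048, 19679329,
    19668726, 19658238, 19647861, 19637595, 19627437, 19617386, 19607439, 19597594, 19587851, 19578207,
    19568661, 19559211, 19549855, 19540592, 19531420, 19522338, 19513345, 19504439, 19495618, 19486881,
    19478227, 19469655, 19461163, 19452751, 19444416, 19436158, 19427975, 19419867, 19411832, 19403870,
    19395978, 19388156, 19380404, 19372719, 19365102, 19357550, 19350064, 19342642, 19335283, 19327987,
    19320752, 19313578, 19306464, 19299408, 19292411, 19285471, 19278588, 19271761, 19264989, 19258271,
    19251607, 19244996, 19238437, 19231930, 19225473, 19219067, 19212710, 19206403, 19200143, 19193932,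
    19187767, 19181650, 19175578, 19169551, 19163569, 19157632, 19151738, 19145888, 19140080, 19134314,
    19128590, 19122907, 19117265, 19111663, 19106101, 19100578, 19095093, 19089647, 19084239, 19078869,
    19073535, 19068238, 19062977, 19057753, 19052563, 19047408, 19042288, 19037203, 19032151, 19027132,
    19022147, 19017194, 19012274, 19007385, 19002529, 18997704, 18992909, 18988146, 18983413, 18978710,
    18974036, 18969392, 18964777, 18960191, 18955633, 18951104, 18946602, 18942129, 18937682, 18933263,
    18928870, 18924504, 18920164, 18915850, 18911562, 18907300, 18903062, 18898850, 18894663, 18890499,
    18886361, 18882246, 18878155, 18874088, 18870044, 18866023, 18862025, 18858050, 18854097, 18850167,
    18846258, 18842372, 18838507, 18834663, 18830841, 18827040, 18823260, 18819500, 18815761, 18812043,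
    18808344, 18804665, 18801007, 18797367, 18793747, 18790147, 18786565, 18783003, 18779459, 18775934,
    18772427, 18768938, 18765468, 18762015, 18758581, 18755164, 18751764, 18748382, 18745017, 18741669,
    18738338, 18735023, 18731726, 18728445, 18725180, 18721931, 18718699, 18715482, 18712282, 18709097,
    18705927, 18702773, 18699634, 18696511, 18693402, 18690309, 18687230, 18684166, 18681117, 18678082,
    18675062, 18672056, 18669063, 18666085, 18663121, 18660171, 18657234, 18654311, 18651402, 18648506,
    18645623, 18642754, 18639897, 18637054, 18634223, 18631405, 18628600, 18625808, 18623028, 18620260,
    18617505, 18614762, 18612031, 18609312, 18606605, 18603910, 18601227, 18598556, 18595896, 18593248,
    18590611, 18587986, 18585372, 18582769, 18580177, 18577596, 18575027, 18572468, 18569920, 18567383,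
    18564856, 18562340, 18559835, 18557340, 18554855, 18552381, 18549917, 18547463, 18545019, 18542585,
    18540162, 18537748, 18535344, 18532949, 18530565, 18528190, 18525824, 18523468, 18521122, 18518785,
    18516457, 18514138, 18511829, 18509529, 18507238, 18504956, 18502682, 18500418, 18498163, 18495916,
    18493678, 18491449, 18489228, 18487016, 18484812, 18482617, 18480430, 18478252, 18476082, 18473920,
    18471766, 18469620, 18467483, 18465353, 18463232, 18461118, 18459013, 18456915, 18454825, 18452742,
    18450668, 18448601, 18446541, 18444489, 18442445, 18440408, 18438379, 18436356, 18434342, 18432334,
    18430334, 18428341, 18426355, 18424376, 18422404, 18420439, 18418481, 18416531, 18414587, 18412650,
    18410719, 18408796, 18406879, 18404969, 18403066, 18401169, 18399279, 18397395, 18395518, 18393647,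
    18391783, 18389925, 18388074, 18386229, 18384390, 18382557, 18380731, 18378911, 18377097, 18375289,
    18373487, 18371691, 18369901, 18368118, 18366340, 18364568, 18362802, 18361042, 18359287, 18357539,
    18355796, 18354059, 18352327, 18350601, 18348881, 18347167, 18345458, 18343754, 18342056, 18340364,
    18338677, 18336995, 18335319, 18333648, 18331983, 18330322, 18328668, 18327018, 18325373, 18323734,
    18322100, 18320471, 18318847, 18317229, 18315615, 18314006, 18312403]"

text \<open>With r(i) = 2^24 Delta k i / Delta k (i - 1), Theta k n is r(n + 1) / r(n), so
  monotonicity of \<open>Theta\<close> is log-convexity of r. The parameter s skips the initial
  ratios, so that n starts at s + 1.\<close>

lemma Theta_less_of_ratios:
  assumes bounds: "ratio_bounds (Delta_list k 487) ls" and conv: "ratios_log_convex (drop s ls)"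
    and len: "length ls = 487" and n: "s < n" "n \<le> 483"
  shows "Theta k n < Theta k (n + 1)"
proof -
  define d where "d i = Delta k i" for i
  define l where "l i = real_of_int (ls ! (i - 1))" for i
  have ds: "real_of_int (Delta_list k 487 ! i) = d i" if "i \<le> 487" for i
    unfolding d_def by (rule Delta_list_correct(1)) (use that in auto)
  have b: "l i * d (i - 1) \<le> 16777216 * d i" "16777216 * d i < (l i + 1) * d (i - 1)" if "1 \<le> i" "i \<le> 487" for i
  proof -
    define j where "j = i - 1"
    have j: "i = Suc j" "j < length ls" using that len by (auto simp: j_def)
    from ratio_bounds_nth[OF bounds j(2)] have
      "real_of_int (ls ! j * Delta_list k 487 ! j) \<le> real_of_int (16777216 * Delta_list k 487 ! Suc j)"
      "real_of_int (16777216 * Delta_list k 487 ! Suc j) < real_of_int ((ls ! j + 1) * Delta_list k 487 ! j)"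
      by (auto simp only: of_int_le_iff of_int_less_iff)
    then show "l i * d (i - 1) \<le> 16777216 * d i" "16777216 * d i < (l i + 1) * d (i - 1)"
      using ds[of j] ds[of i] that j by (auto simp: l_def)
  qed
  \<comment> \<open>Positivity is read off from the certificate: l d <= 2^24 e < (l + 1) d forces d
    > 0.\<close>
  have pos: "d i > 0" if "i < 487" for i
  proof -
    have "0 < (l (Suc i) + 1) * d i - l (Suc i) * d i" using b[of "Suc i"] that by auto
    then show ?thesis by (simp add: algebra_simps)
  qed
  have lnn: "l i \<ge> 0" if "1 \<le> i" "i < 487" for i
  proof -
    have "0 < (l i + 1) * d (i - 1)" using b(2)[of i] pos[of i] that by linarith
    moreover have "d (i - 1) > 0" by (rule pos) (use that in auto)
    ultimately have "0 < l i + 1" by (rule zero_less_mult_pos2)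
    then have "real_of_int 0 < real_of_int (ls ! (i - 1) + 1)" by (simp add: l_def)
    then have "0 < ls ! (i - 1) + 1" by (simp only: of_int_less_iff)
    then show ?thesis by (simp add: l_def)
  qed
  define r where "r i = 16777216 * d i / d (i - 1)" for i
  have r: "l i \<le> r i" "r i < l i + 1" if "1 \<le> i" "i < 487" for i
    using b[of i] pos[of "i - 1"] that by (auto simp: r_def pos_le_divide_eq pos_divide_less_eq)
  \<comment> \<open>List positions start at 0 and ratios at 1, so the entry for r(n) is at position
    n - 1, and at n - 1 - s after dropping.\<close>
  have "(drop s ls ! (n - 1 - s + 1) + 1) * (drop s ls ! (n - 1 - s + 1) + 1) < drop s ls ! (n - 1 - s) * drop s ls ! (n - 1 - s + 2)"
    by (rule ratios_log_convex_nth[OF conv]) (use n len in auto)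
  then have "(ls ! n + 1) * (ls ! n + 1) < ls ! (n - 1) * ls ! (n + 1)"
    using n len by (simp add: nth_drop)
  then have "real_of_int ((ls ! n + 1) * (ls ! n + 1)) < real_of_int (ls ! (n - 1) * ls ! (n + 1))"
    by (simp only: of_int_less_iff)
  then have c: "(l (n + 1) + 1) * (l (n + 1) + 1) < l n * l (n + 2)" by (simp add: l_def)
  have i: "1 \<le> n" "n < 487" "1 \<le> n + 1" "n + 1 < 487" "1 \<le> n + 2" "n + 2 < 487" using n by auto
  have "r (n + 1) * r (n + 1) \<le> (l (n + 1) + 1) * (l (n + 1) + 1)"
    using r[OF i(3,4)] lnn[OF i(3,4)] by (intro mult_mono) auto
  also note c
  also have "l n * l (n + 2) \<le> r n * r (n + 2)"
    using r[OF i(1,2)] r[OF i(5,6)] lnn[OF i(1,2)] lnn[OF i(5,6)] by (intro mult_mono) auto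
  finally have rr: "r (n + 1) * r (n + 1) < r n * r (n + 2)" .
  have p: "d (n - 1) > 0" "d n > 0" "d (n + 1) > 0" "d (n + 2) > 0" using pos n by auto
  have "Theta k n = r (n + 1) / r n" "Theta k (n + 1) = r (n + 2) / r (n + 1)"
    using p n by (auto simp: Theta_def r_def d_def[symmetric] power2_eq_square)
  moreover have "r n > 0" "r (n + 1) > 0" using p by (auto simp: r_def)
  moreover have "r (n + 1) / r n < r (n + 2) / r (n + 1)" if "r n > 0" "r (n + 1) > 0"
    using rr that by (simp add: divide_simps mult.commute)
  ultimately show ?thesis by simp
qed

lemma cert1_ratios: "ratio_bounds (Delta_list 1 487) cert1"
  by code_simp

lemma cert1_convex: "ratios_log_convex (drop 4 cert1) \<and> length cert1 = 487"
  by code_simp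

lemma cert2_ratios: "ratio_bounds (Delta_list 2 487) cert2"
  by code_simp

lemma cert2_convex: "ratios_log_convex (drop 6 cert2) \<and> length cert2 = 487"
  by code_simp

lemma Theta_increasing_small:
  shows "5 \<le> n \<Longrightarrow> n \<le> 483 \<Longrightarrow> Theta 1 n < Theta 1 (n + 1)"
    and "7 \<le> n \<Longrightarrow> n \<le> 483 \<Longrightarrow> Theta 2 n < Theta 2 (n + 1)"
  using Theta_less_of_ratios[OF cert1_ratios] Theta_less_of_ratios[OF cert2_ratios] cert1_convex cert2_convex
  by auto

theorem theorem1p6:
  shows "(\<forall>n::nat. n \<ge> 5 \<longrightarrow> Theta 1 n < Theta 1 (n + 1)) \<and>
         (\<forall>n::nat. n \<ge> 7 \<longrightarrow> Theta 2 n < Theta 2 (n + 1))"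
proof (intro conjI allI impI)
  fix n :: nat
  show "Theta 1 n < Theta 1 (n + 1)" if "n \<ge> 5"
    using Theta_increasing_small(1)[of n] Theta_increasing_large[of 1 n] that by (cases "n \<le> 483") auto
  show "Theta 2 n < Theta 2 (n + 1)" if "n \<ge> 7"
    using Theta_increasing_small(2)[of n] Theta_increasing_large[of 2 n] that by (cases "n \<le> 483") auto
qed

end
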